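(* Let $M$ be a compact metrizable space and let $\Gamma\subset\mathsf{Homeo}(M)$ be a non-elementary convergence group. Suppose $(\sigma,\bar\sigma,G)$ is a continuous GPS system for $\Gamma$ with $\delta:=\delta_\sigma(\Gamma)<+\infty$ and $Q_\sigma(\delta)=+\infty$. If the BMS measure $m_\Gamma$ is finite and the cross ratio spectrum $\mathcal{CR}$ is non-arithmetic, then the flow $\psi^t:(U_\Gamma,m_\Gamma)\to(U_\Gamma,m_\Gamma)$ is mixing.
   Context: $M^{(2)}\subset M\times M$ denotes the space of pairs of distinct points. Convergence groups. $\Gamma\subset\mathsf{Homeo}(M)$ is a (discrete) convergence group if for every sequence $\{\gamma_n\}$ of distinct elements of $\Gamma$ there are $x,y\in M$ and a subsequence with $\gamma_{n_j}|_{M\smallsetminus\{y\}}\to x$ locally uniformly. An element $\gamma$ is loxodromic if it has exactly two fixed points $\gamma^+,\gamma^-$ in $M$ and $\gamma^{\pm n}|_{M\smallsetminus\{\gamma^\mp\}}\to\gamma^\pm$ locally uniformly. The limit set $\Lambda(\Gamma)$ is the set of $x\in M$ for which there are $y\in M$ and $\{\gamma_n\}\subset\Gamma$ with $\gamma_n|_{M\smallsetminus\{y\}}\to x$ locally uniformly; $\Gamma$ is non-elementary if $\#\Lambda(\Gamma)\ge3$. GPS systems. A continuous cocycle is a continuous map $\sigma:\Gamma\times M\to\mathbb R$ ($\Gamma$ discrete) with $\sigma(\alpha\beta,x)=\sigma(\alpha,\beta x)+\sigma(\beta,x)$. Its period is $\ell_\sigma(\gamma)=\sigma(\gamma,\gamma^+)$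 if $\gamma$ is loxodromic and $\ell_\sigma(\gamma)=0$ otherwise. $\sigma$ is proper if $\ell_\sigma(\gamma_n)\to+\infty$ for every sequence of distinct loxodromic elements such that $\{(\gamma_n^-,\gamma_n^+)\}$ is relatively compact in $M^{(2)}$. A continuous GPS system is a triple $(\sigma,\bar\sigma,G)$ with $\sigma,\bar\sigma$ continuous proper cocycles and $G:M^{(2)}\to\mathbb R$ continuous such that $\bar\sigma(\gamma,x)+\sigma(\gamma,y)=G(\gamma x,\gamma y)-G(x,y)$ for all $\gamma\in\Gamma$, $(x,y)\in M^{(2)}$. Cross ratio spectrum. $B(x,x',y,y')=G(x,y)+G(x',y')-G(x',y)-G(x,y')$ for $x,x',y,y'\in M$ with $\{x,x'\}\cap\{y,y'\}=\varnothing$, and $\mathcal{CR}=\{B(x,x',y,y'):x,x',y,y'\in\Lambda(\Gamma),\ \{x,x'\}\cap\{y,y'\}=\varnothing\}$. It is non-arithmetic if it generates a dense subgroup of $\mathbb R$. Magnitudes and critical exponents. There is a unique topology on $\Gamma\sqcup M$ that is compact metrizable, for which $\Gamma$ (discrete) and $M$ are embedded and $\Gamma$ acts on $\Gamma\sqcup M$ as a convergence group; let $\mathrm d$ be a metric inducing it. For a GPS system, $\sigma$ is expanding (known): there are numbers $\|\gamma\|_\sigma\in\mathbb R$ (magnitudes), unique up to uniformly bounded additive error, such that for every $\epsilon>0$ there is $C>0$ with $\|\gamma\|_\sigma-C\le\sigma(\gamma,x)\le\|\gamma\|_\sigma+C$ whenever $\gamma\in\Gamma$, $x\in M$ and $\mathrm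 d(x,\gamma^{-1})>\epsilon$. Set $\delta_\sigma(\Gamma)=\limsup_{R\to\infty}\frac1R\log\#\{\gamma\in\Gamma:\|\gamma\|_\sigma\le R\}$ and $Q_\sigma(s)=\sum_{\gamma\in\Gamma}e^{-s\|\gamma\|_\sigma}$. (Likewise for $\bar\sigma$; it is known that $\delta_{\bar\sigma}(\Gamma)=\delta_\sigma(\Gamma)$.) Flow space and BMS measure. Let $\Lambda(\Gamma)^{(2)}$ be the set of pairs of distinct points of $\Lambda(\Gamma)$ and $\tilde U_\Gamma=\Lambda(\Gamma)^{(2)}\times\mathbb R$, with flow $\psi^t(x,y,s)=(x,y,s+t)$ and the (known to be properly discontinuous) action $\gamma(x,y,s)=(\gamma x,\gamma y,s+\sigma(\gamma,y))$. The flow descends to $U_\Gamma=\Gamma\backslash\tilde U_\Gamma$. A $\sigma$-Patterson–Sullivan measure of dimension $\beta$ is a probability measure $\mu$ on $M$ such that for all $\gamma\in\Gamma$, $\gamma_*\mu$ and $\mu$ are mutually absolutely continuous and $\frac{d\gamma_*\mu}{d\mu}=e^{-\beta\sigma(\gamma^{-1},\cdot)}$ $\mu$-a.e. When $\delta=\delta_\sigma(\Gamma)<\infty$ and $Q_\sigma(\delta)=+\infty$, there are (known) a unique $\sigma$-Patterson–Sullivan measure $\mu$ and a unique $\bar\sigma$-Patterson–Sullivan measure $\bar\mu$ of dimension $\delta$, both supported on $\Lambda(\Gamma)$. The measure $\tilde m=e^{\delta G(x,y)}d\bar\mu(x)\otimes d\mu(y)\otimes dt$ on $\tilde U_\Gamma$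 is $\Gamma$- and flow-invariant, and the BMS measure $m_\Gamma$ is the quotient measure on $U_\Gamma$: the unique Borel measure with $\int_{U_\Gamma}\big(\sum_{\gamma\in\Gamma}f(\gamma v)\big)dm_\Gamma([v])=\int_{\tilde U_\Gamma}f\,d\tilde m$ for all measurable $f:\tilde U_\Gamma\to[0,+\infty]$. Mixing: a flow preserving a finite measure $\nu$ of total mass $\|\nu\|$ is mixing if $\lim_{t\to\infty}\nu(A\cap\psi^t(B))=\nu(A)\nu(B)/\|\nu\|$ for all measurable $A,B$. *)

theory Defs
  imports
    "HOL-Probability.Probability"
    "HOL-Computational_Algebra.Group_Closure"
begin

text \<open>
  The space \<open>M\<close> is the whole of a type \<open>'m\<close> of class \<^class>\<open>polish_space\<close>, with compactness of
  \<^term>\<open>UNIV\<close> assumed separately.  Every nonempty compact metrizable space carries such a structure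
  (a compatible metric is automatically complete and separable), so nothing is lost; the chosen
  metric enters only through the topology, since uniform convergence to a constant does not depend
  on it.  A group of homeomorphisms of \<open>M\<close> is a set \<open>\<Gamma>\<close> of maps \<open>'m \<Rightarrow> 'm\<close>; cocycles are functions
  on \<open>('m \<Rightarrow> 'm) \<times> 'm\<close> of which only the values on \<open>\<Gamma> \<times> M\<close> matter, and \<open>G\<close> is a function of which
  only the values off the diagonal matter.
\<close>

section \<open>Convergence groups\<close>

text \<open>
  Locally uniform convergence on \<open>S\<close> of the maps \<open>f n\<close> to the constant map \<open>x\<close>, with respect to a
  metric \<open>d\<close>.  The metric is an explicit argument because the notion is needed for \<open>M\<close> and also for
  \<open>\<Gamma> \<squnion> M\<close>, which is not a metric type.
\<close>

definition loc_unif_conv ::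
    "('a \<Rightarrow> 'a \<Rightarrow> real) \<Rightarrow> 'a set \<Rightarrow> (nat \<Rightarrow> 'a \<Rightarrow> 'a) \<Rightarrow> 'a \<Rightarrow> bool" where
  "loc_unif_conv d S f x \<longleftrightarrow>
     (\<forall>z\<in>S. \<exists>r>0. \<forall>e>0. \<forall>\<^sub>F n in sequentially. \<forall>w\<in>S. d z w < r \<longrightarrow> d (f n w) x < e)"

lemma loc_unif_conv_dist:
  fixes f :: "nat \<Rightarrow> 'm::metric_space \<Rightarrow> 'm"
  shows "loc_unif_conv dist S f x \<longleftrightarrow>
     (\<forall>z\<in>S. \<exists>r>0. uniform_limit (S \<inter> ball z r) f (\<lambda>_. x) sequentially)"
  by (simp add: loc_unif_conv_def uniform_limit_iff Ball_def imp_conjL)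

definition homeo_group :: "('m::topological_space \<Rightarrow> 'm) set \<Rightarrow> bool" where
  "homeo_group \<Gamma> \<longleftrightarrow>
     (\<forall>\<gamma>\<in>\<Gamma>. homeomorphic_map euclidean euclidean \<gamma>) \<and>
     id \<in> \<Gamma> \<and> (\<forall>\<alpha>\<in>\<Gamma>. \<forall>\<beta>\<in>\<Gamma>. \<alpha> \<circ> \<beta> \<in> \<Gamma>) \<and> (\<forall>\<gamma>\<in>\<Gamma>. inv \<gamma> \<in> \<Gamma>)"

text \<open>The convergence property of an action \<open>act\<close> of \<open>\<Gamma>\<close> on a metric space with carrier \<open>A\<close>.\<close>

definition convergence_action ::
    "'g set \<Rightarrow> 'a set \<Rightarrow> ('a \<Rightarrow> 'a \<Rightarrow> real) \<Rightarrow> ('g \<Rightarrow> 'a \<Rightarrow> 'a) \<Rightarrow> bool" where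
  "convergence_action \<Gamma> A d act \<longleftrightarrow>
     (\<forall>g :: nat \<Rightarrow> 'g. inj g \<and> range g \<subseteq> \<Gamma> \<longrightarrow>
        (\<exists>x\<in>A. \<exists>y\<in>A. \<exists>r :: nat \<Rightarrow> nat. strict_mono r \<and>
           loc_unif_conv d (A - {y}) (\<lambda>n. act (g (r n))) x))"

definition convergence_group :: "('m::metric_space \<Rightarrow> 'm) set \<Rightarrow> bool" where
  "convergence_group \<Gamma> \<longleftrightarrow> homeo_group \<Gamma> \<and> convergence_action \<Gamma> UNIV dist (\<lambda>\<gamma>. \<gamma>)"

definition limit_set :: "('m::metric_space \<Rightarrow> 'm) set \<Rightarrow> 'm set" where
  "limit_set \<Gamma> =
     {x. \<exists>y. \<exists>g :: nat \<Rightarrow> 'm \<Rightarrow> 'm. range g \<subseteq> \<Gamma> \<and> loc_unif_conv dist (UNIV - {y}) g x}"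

definition non_elementary :: "('m::metric_space \<Rightarrow> 'm) set \<Rightarrow> bool" where
  "non_elementary \<Gamma> \<longleftrightarrow> (\<exists>T \<subseteq> limit_set \<Gamma>. card T = 3)"

text \<open>\<open>loxodromic_with \<gamma> a b\<close>: \<open>\<gamma>\<close> is loxodromic with \<open>\<gamma>\<^sup>+ = a\<close> and \<open>\<gamma>\<^sup>- = b\<close>.\<close>

definition loxodromic_with :: "('m::metric_space \<Rightarrow> 'm) \<Rightarrow> 'm \<Rightarrow> 'm \<Rightarrow> bool" where
  "loxodromic_with \<gamma> a b \<longleftrightarrow>
     a \<noteq> b \<and> {x. \<gamma> x = x} = {a, b} \<and>
     loc_unif_conv dist (UNIV - {b}) (\<lambda>n. \<gamma> ^^ n) a \<and>
     loc_unif_conv dist (UNIV - {a}) (\<lambda>n. inv \<gamma> ^^ n) b"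

definition loxodromic :: "('m::metric_space \<Rightarrow> 'm) \<Rightarrow> bool" where
  "loxodromic \<gamma> \<longleftrightarrow> (\<exists>a b. loxodromic_with \<gamma> a b)"

text \<open>
  The two points below are uniquely determined as soon as \<open>M\<close> has at least three points (see
  \<open>loxodromic_with_unique\<close>), in particular when \<open>\<Gamma>\<close> is non-elementary.
\<close>

definition attracting_pt :: "('m::metric_space \<Rightarrow> 'm) \<Rightarrow> 'm" where
  "attracting_pt \<gamma> = (THE a. \<exists>b. loxodromic_with \<gamma> a b)"

definition repelling_pt :: "('m::metric_space \<Rightarrow> 'm) \<Rightarrow> 'm" where
  "repelling_pt \<gamma> = (THE b. \<exists>a. loxodromic_with \<gamma> a b)"

lemma loc_unif_conv_dist_pointwise:
  fixes f :: "nat \<Rightarrow> 'm::metric_space \<Rightarrow> 'm"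
  assumes "loc_unif_conv dist S f x" "z \<in> S"
  shows "(\<lambda>n. f n z) \<longlonglongrightarrow> x"
proof -
  obtain r where "r > 0" "uniform_limit (S \<inter> ball z r) f (\<lambda>_. x) sequentially"
    using assms by (auto simp: loc_unif_conv_dist)
  then show ?thesis
    using assms(2) tendsto_uniform_limitI[where x = z and l = "\<lambda>_. x"] by fastforce
qed

lemma loxodromic_with_unique:
  fixes \<gamma> :: "'m::metric_space \<Rightarrow> 'm"
  assumes 1: "loxodromic_with \<gamma> a b" and 2: "loxodromic_with \<gamma> a' b'"
    and 3: "\<exists>T :: 'm set. card T = 3"
  shows "a' = a \<and> b' = b"
proof (rule ccontr)
  assume neq: "\<not> (a' = a \<and> b' = b)"
  have "{a, b} = {a', b'}" "a \<noteq> b" "a' \<noteq> b'"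
    using 1 2 unfolding loxodromic_with_def by auto
  with neq have sw: "a' = b" "b' = a" by (auto simp: doubleton_eq_iff)
  obtain T :: "'m set" where T: "card T = 3" using 3 by blast
  have "\<not> T \<subseteq> {a, b}"
    using T \<open>a \<noteq> b\<close> card_mono[of "{a, b}" T] by auto
  then obtain c where c: "c \<noteq> a" "c \<noteq> b" by blast
  have "loc_unif_conv dist (UNIV - {b}) (\<lambda>n. \<gamma> ^^ n) a"
    "loc_unif_conv dist (UNIV - {b'}) (\<lambda>n. \<gamma> ^^ n) a'"
    using 1 2 by (simp_all add: loxodromic_with_def)
  from this[THEN loc_unif_conv_dist_pointwise, of c]
  have "(\<lambda>n. (\<gamma> ^^ n) c) \<longlonglongrightarrow> a" "(\<lambda>n. (\<gamma> ^^ n) c) \<longlonglongrightarrow> a'"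
    using c sw by simp_all
  then show False
    using LIMSEQ_unique[of "\<lambda>n. (\<gamma> ^^ n) c" a a'] sw \<open>a \<noteq> b\<close> by simp
qed


section \<open>GPS systems and the cross ratio spectrum\<close>

definition distinct_pairs :: "'m set \<Rightarrow> ('m \<times> 'm) set" where
  "distinct_pairs S = {(x, y). x \<in> S \<and> y \<in> S \<and> x \<noteq> y}"

definition continuous_cocycle ::
    "('m::metric_space \<Rightarrow> 'm) set \<Rightarrow> (('m \<Rightarrow> 'm) \<Rightarrow> 'm \<Rightarrow> real) \<Rightarrow> bool" where
  "continuous_cocycle \<Gamma> \<sigma> \<longleftrightarrow>
     (\<forall>\<gamma>\<in>\<Gamma>. continuous_on UNIV (\<sigma> \<gamma>)) \<and>
     (\<forall>\<alpha>\<in>\<Gamma>. \<forall>\<beta>\<in>\<Gamma>. \<forall>x. \<sigma> (\<alpha> \<circ> \<beta>) x = \<sigma> \<alpha> (\<beta> x) + \<sigma> \<beta> x)"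

definition period :: "(('m::metric_space \<Rightarrow> 'm) \<Rightarrow> 'm \<Rightarrow> real) \<Rightarrow> ('m \<Rightarrow> 'm) \<Rightarrow> real" where
  "period \<sigma> \<gamma> = (if loxodromic \<gamma> then \<sigma> \<gamma> (attracting_pt \<gamma>) else 0)"

text \<open>Relative compactness in \<open>M\<^sup>(\<^sup>2\<^sup>)\<close> means being contained in a compact subset of \<open>M\<^sup>(\<^sup>2\<^sup>)\<close>.\<close>

definition proper_cocycle ::
    "('m::metric_space \<Rightarrow> 'm) set \<Rightarrow> (('m \<Rightarrow> 'm) \<Rightarrow> 'm \<Rightarrow> real) \<Rightarrow> bool" where
  "proper_cocycle \<Gamma> \<sigma> \<longleftrightarrow>
     (\<forall>g :: nat \<Rightarrow> 'm \<Rightarrow> 'm.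
        inj g \<and> range g \<subseteq> \<Gamma> \<and> (\<forall>n. loxodromic (g n)) \<and>
        (\<exists>K. compact K \<and> K \<subseteq> distinct_pairs UNIV \<and>
             range (\<lambda>n. (repelling_pt (g n), attracting_pt (g n))) \<subseteq> K)
        \<longrightarrow> filterlim (\<lambda>n. period \<sigma> (g n)) at_top sequentially)"

definition GPS_system ::
    "('m::metric_space \<Rightarrow> 'm) set \<Rightarrow> (('m \<Rightarrow> 'm) \<Rightarrow> 'm \<Rightarrow> real) \<Rightarrow> (('m \<Rightarrow> 'm) \<Rightarrow> 'm \<Rightarrow> real)
      \<Rightarrow> ('m \<times> 'm \<Rightarrow> real) \<Rightarrow> bool" where
  "GPS_system \<Gamma> \<sigma> \<sigma>' G \<longleftrightarrow>
     continuous_cocycle \<Gamma> \<sigma> \<and> proper_cocycle \<Gamma> \<sigma> \<and>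
     continuous_cocycle \<Gamma> \<sigma>' \<and> proper_cocycle \<Gamma> \<sigma>' \<and>
     continuous_on (distinct_pairs UNIV) G \<and>
     (\<forall>\<gamma>\<in>\<Gamma>. \<forall>(x, y)\<in>distinct_pairs UNIV.
        \<sigma>' \<gamma> x + \<sigma> \<gamma> y = G (\<gamma> x, \<gamma> y) - G (x, y))"

definition cross_ratio :: "('m \<times> 'm \<Rightarrow> real) \<Rightarrow> 'm \<Rightarrow> 'm \<Rightarrow> 'm \<Rightarrow> 'm \<Rightarrow> real" where
  "cross_ratio G x x' y y' = G (x, y) + G (x', y') - G (x', y) - G (x, y')"

definition cross_ratio_spectrum ::
    "('m::metric_space \<Rightarrow> 'm) set \<Rightarrow> ('m \<times> 'm \<Rightarrow> real) \<Rightarrow> real set" where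
  "cross_ratio_spectrum \<Gamma> G =
     {cross_ratio G x x' y y' | x x' y y'.
        {x, x', y, y'} \<subseteq> limit_set \<Gamma> \<and> {x, x'} \<inter> {y, y'} = {}}"

definition non_arithmetic :: "real set \<Rightarrow> bool" where
  "non_arithmetic S \<longleftrightarrow> closure (group_closure S) = UNIV"


section \<open>Magnitudes and critical exponents\<close>

text \<open>
  \<open>\<Gamma> \<squnion> M\<close> is the subset \<open>Inl ` \<Gamma> \<union> range Inr\<close> of the sum type, on which \<open>\<gamma>\<close> acts by left
  multiplication on \<open>\<Gamma>\<close> and by itself on \<open>M\<close>, i.e. as \<open>map_sum ((\<circ>) \<gamma>) \<gamma>\<close>.  The predicate below
  says that \<open>d\<close> is a metric inducing the distinguished compact topology.
\<close>

definition compactification_metric ::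
    "('m::metric_space \<Rightarrow> 'm) set \<Rightarrow> (('m \<Rightarrow> 'm) + 'm \<Rightarrow> ('m \<Rightarrow> 'm) + 'm \<Rightarrow> real) \<Rightarrow> bool" where
  "compactification_metric \<Gamma> d \<longleftrightarrow>
     (let A = Inl ` \<Gamma> \<union> range Inr; X = Metric_space.mtopology A d in
        Metric_space A d \<and> compact_space X \<and>
        embedding_map (discrete_topology \<Gamma>) X Inl \<and> embedding_map euclidean X Inr \<and>
        (\<forall>\<gamma>\<in>\<Gamma>. homeomorphic_map X X (map_sum ((\<circ>) \<gamma>) \<gamma>)) \<and>
        convergence_action \<Gamma> A d (\<lambda>\<gamma>. map_sum ((\<circ>) \<gamma>) \<gamma>))"

definition magnitude ::
    "('m \<Rightarrow> 'm) set \<Rightarrow> (('m \<Rightarrow> 'm) + 'm \<Rightarrow> ('m \<Rightarrow> 'm) + 'm \<Rightarrow> real)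
      \<Rightarrow> (('m \<Rightarrow> 'm) \<Rightarrow> 'm \<Rightarrow> real) \<Rightarrow> (('m \<Rightarrow> 'm) \<Rightarrow> real) \<Rightarrow> bool" where
  "magnitude \<Gamma> d \<sigma> N \<longleftrightarrow>
     (\<forall>\<epsilon>>0. \<exists>C>0. \<forall>\<gamma>\<in>\<Gamma>. \<forall>x.
        d (Inr x) (Inl (inv \<gamma>)) > \<epsilon> \<longrightarrow> N \<gamma> - C \<le> \<sigma> \<gamma> x \<and> \<sigma> \<gamma> x \<le> N \<gamma> + C)"

text \<open>
  In \<open>critical_exponent\<close> infinite sets are treated separately because \<^const>\<open>card\<close> vanishes on them.
\<close>

definition critical_exponent :: "'g set \<Rightarrow> ('g \<Rightarrow> real) \<Rightarrow> ereal" where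
  "critical_exponent \<Gamma> N =
     Limsup at_top (\<lambda>R::real.
       if finite {\<gamma>\<in>\<Gamma>. N \<gamma> \<le> R} then ereal (1 / R * ln (real (card {\<gamma>\<in>\<Gamma>. N \<gamma> \<le> R}))) else \<infinity>)"

definition poincare_series :: "'g set \<Rightarrow> ('g \<Rightarrow> real) \<Rightarrow> real \<Rightarrow> ennreal" where
  "poincare_series \<Gamma> N s = (\<Sum>\<^sub>\<infinity>\<gamma>\<in>\<Gamma>. ennreal (exp (- s * N \<gamma>)))"


section \<open>Patterson--Sullivan measures\<close>

definition patterson_sullivan ::
    "('m::metric_space \<Rightarrow> 'm) set \<Rightarrow> (('m \<Rightarrow> 'm) \<Rightarrow> 'm \<Rightarrow> real) \<Rightarrow> real \<Rightarrow> 'm measure \<Rightarrow> bool" where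
  "patterson_sullivan \<Gamma> \<sigma> \<beta> \<mu> \<longleftrightarrow>
     prob_space \<mu> \<and> sets \<mu> = sets borel \<and>
     (\<forall>\<gamma>\<in>\<Gamma>. absolutely_continuous \<mu> (distr \<mu> borel \<gamma>) \<and>
            absolutely_continuous (distr \<mu> borel \<gamma>) \<mu> \<and>
            (AE x in \<mu>. RN_deriv \<mu> (distr \<mu> borel \<gamma>) x = ennreal (exp (- \<beta> * \<sigma> (inv \<gamma>) x))))"


section \<open>The flow space and the BMS measure\<close>

definition flow_cover :: "('m::metric_space \<Rightarrow> 'm) set \<Rightarrow> ('m \<times> 'm \<times> real) set" where
  "flow_cover \<Gamma> = {(x, y, s). (x, y) \<in> distinct_pairs (limit_set \<Gamma>)}"

definition flow_act ::
    "(('m \<Rightarrow> 'm) \<Rightarrow> 'm \<Rightarrow> real) \<Rightarrow> ('m \<Rightarrow> 'm) \<Rightarrow> 'm \<times> 'm \<times> real \<Rightarrow> 'm \<times> 'm \<times> real" where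
  "flow_act \<sigma> \<gamma> = (\<lambda>(x, y, s). (\<gamma> x, \<gamma> y, s + \<sigma> \<gamma> y))"

definition flow_orbit ::
    "('m \<Rightarrow> 'm) set \<Rightarrow> (('m \<Rightarrow> 'm) \<Rightarrow> 'm \<Rightarrow> real) \<Rightarrow> 'm \<times> 'm \<times> real \<Rightarrow> ('m \<times> 'm \<times> real) set" where
  "flow_orbit \<Gamma> \<sigma> v = (\<lambda>\<gamma>. flow_act \<sigma> \<gamma> v) ` \<Gamma>"

text \<open>Points of \<open>U\<^sub>\<Gamma>\<close> are \<open>\<Gamma>\<close>-orbits in the cover; \<open>U\<^sub>\<Gamma>\<close> carries the quotient topology.\<close>

definition flow_space ::
    "('m::metric_space \<Rightarrow> 'm) set \<Rightarrow> (('m \<Rightarrow> 'm) \<Rightarrow> 'm \<Rightarrow> real) \<Rightarrow> ('m \<times> 'm \<times> real) set set" where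
  "flow_space \<Gamma> \<sigma> = flow_orbit \<Gamma> \<sigma> ` flow_cover \<Gamma>"

definition flow_topology ::
    "('m::metric_space \<Rightarrow> 'm) set \<Rightarrow> (('m \<Rightarrow> 'm) \<Rightarrow> 'm \<Rightarrow> real)
      \<Rightarrow> ('m \<times> 'm \<times> real) set topology" where
  "flow_topology \<Gamma> \<sigma> = topology (\<lambda>W. W \<subseteq> flow_space \<Gamma> \<sigma> \<and>
     openin (top_of_set (flow_cover \<Gamma>)) {v \<in> flow_cover \<Gamma>. flow_orbit \<Gamma> \<sigma> v \<in> W})"

lemma quotient_map_flow_orbit:
  "quotient_map (top_of_set (flow_cover \<Gamma>)) (flow_topology \<Gamma> \<sigma>) (flow_orbit \<Gamma> \<sigma>)"
proof -
  let ?X = "top_of_set (flow_cover \<Gamma>)"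
  let ?pre = "\<lambda>W. {v \<in> flow_cover \<Gamma>. flow_orbit \<Gamma> \<sigma> v \<in> W}"
  have "istopology (\<lambda>W. W \<subseteq> flow_space \<Gamma> \<sigma> \<and> openin ?X (?pre W))"
    unfolding istopology_def
  proof (intro conjI allI impI)
    fix S T
    assume "S \<subseteq> flow_space \<Gamma> \<sigma> \<and> openin ?X (?pre S)" "T \<subseteq> flow_space \<Gamma> \<sigma> \<and> openin ?X (?pre T)"
    moreover have "?pre (S \<inter> T) = ?pre S \<inter> ?pre T" by auto
    ultimately show "S \<inter> T \<subseteq> flow_space \<Gamma> \<sigma>" "openin ?X (?pre (S \<inter> T))" by auto
  next
    fix K
    assume K: "\<forall>S\<in>K. S \<subseteq> flow_space \<Gamma> \<sigma> \<and> openin ?X (?pre S)"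
    then show "\<Union>K \<subseteq> flow_space \<Gamma> \<sigma>" by auto
    have "?pre (\<Union>K) = \<Union>(?pre ` K)" by auto
    with K show "openin ?X (?pre (\<Union>K))" by auto
  qed
  then have op: "openin (flow_topology \<Gamma> \<sigma>) W \<longleftrightarrow> W \<subseteq> flow_space \<Gamma> \<sigma> \<and> openin ?X (?pre W)" for W
    unfolding flow_topology_def by (simp add: topology_inverse')
  have "?pre (flow_space \<Gamma> \<sigma>) = flow_cover \<Gamma>"
    by (auto simp: flow_space_def)
  then have "openin (flow_topology \<Gamma> \<sigma>) (flow_space \<Gamma> \<sigma>)"
    by (simp add: op)
  then have "topspace (flow_topology \<Gamma> \<sigma>) = flow_space \<Gamma> \<sigma>"
    by (meson op openin_subset openin_topspace subset_antisym)
  then show ?thesis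
    unfolding quotient_map_def by (auto simp: op flow_space_def)
qed

definition flow_tilde :: "real \<Rightarrow> 'm \<times> 'm \<times> real \<Rightarrow> 'm \<times> 'm \<times> real" where
  "flow_tilde t = (\<lambda>(x, y, s). (x, y, s + t))"

text \<open>Since the flow upstairs commutes with \<open>\<Gamma>\<close>, it maps the orbit of \<open>v\<close> onto the orbit of
  \<open>flow_tilde t v\<close>.\<close>

definition flow :: "real \<Rightarrow> ('m \<times> 'm \<times> real) set \<Rightarrow> ('m \<times> 'm \<times> real) set" where
  "flow t c = flow_tilde t ` c"

lemma flow_flow_orbit: "flow t (flow_orbit \<Gamma> \<sigma> v) = flow_orbit \<Gamma> \<sigma> (flow_tilde t v)"
proof -
  have "flow_tilde t (flow_act \<sigma> \<gamma> v) = flow_act \<sigma> \<gamma> (flow_tilde t v)" for \<gamma>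
    by (cases v) (simp add: flow_tilde_def flow_act_def)
  then show ?thesis
    unfolding flow_def flow_orbit_def image_image by simp
qed

text \<open>Restricting to the cover comes first, because \<open>G\<close> is only continuous off the diagonal.\<close>

definition BMS_cover_measure ::
    "('m::metric_space \<Rightarrow> 'm) set \<Rightarrow> ('m \<times> 'm \<Rightarrow> real) \<Rightarrow> real \<Rightarrow> 'm measure \<Rightarrow> 'm measure
      \<Rightarrow> ('m \<times> 'm \<times> real) measure" where
  "BMS_cover_measure \<Gamma> G \<delta> \<mu>' \<mu> =
     density (restrict_space (\<mu>' \<Otimes>\<^sub>M (\<mu> \<Otimes>\<^sub>M lborel)) (flow_cover \<Gamma>))
       (\<lambda>(x, y, s). ennreal (exp (\<delta> * G (x, y))))"

text \<open>
  \<open>m\<close> is a Borel measure on \<open>U\<^sub>\<Gamma>\<close> and the quotient of the measure above.  The map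
  \<open>v \<mapsto> (\<Sum>\<gamma>\<in>\<Gamma>. f (\<gamma> v))\<close> is constant on each orbit \<open>c\<close>, and \<^const>\<open>the_elem\<close> extracts its value.
\<close>

definition BMS_measure ::
    "('m::metric_space \<Rightarrow> 'm) set \<Rightarrow> (('m \<Rightarrow> 'm) \<Rightarrow> 'm \<Rightarrow> real) \<Rightarrow> ('m \<times> 'm \<Rightarrow> real) \<Rightarrow> real
      \<Rightarrow> 'm measure \<Rightarrow> 'm measure \<Rightarrow> ('m \<times> 'm \<times> real) set measure \<Rightarrow> bool" where
  "BMS_measure \<Gamma> \<sigma> G \<delta> \<mu>' \<mu> m \<longleftrightarrow>
     sets m = sets (sigma (flow_space \<Gamma> \<sigma>) {W. openin (flow_topology \<Gamma> \<sigma>) W}) \<and>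
     (\<forall>f \<in> borel_measurable (restrict_space borel (flow_cover \<Gamma>)).
        (\<integral>\<^sup>+ c. the_elem ((\<lambda>v. \<Sum>\<^sub>\<infinity>\<gamma>\<in>\<Gamma>. f (flow_act \<sigma> \<gamma> v)) ` c) \<partial>m)
        = (\<integral>\<^sup>+ v. (f v :: ennreal) \<partial>BMS_cover_measure \<Gamma> G \<delta> \<mu>' \<mu>))"

definition mixing :: "'a measure \<Rightarrow> (real \<Rightarrow> 'a \<Rightarrow> 'a) \<Rightarrow> bool" where
  "mixing \<nu> \<phi> \<longleftrightarrow>
     finite_measure \<nu> \<and>
     (\<forall>t. \<phi> t \<in> measurable \<nu> \<nu> \<and> distr \<nu> \<nu> (\<phi> t) = \<nu>) \<and>
     (\<forall>A\<in>sets \<nu>. \<forall>B\<in>sets \<nu>.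
        ((\<lambda>t. measure \<nu> (A \<inter> \<phi> t ` B))
           \<longlongrightarrow> measure \<nu> A * measure \<nu> B / measure \<nu> (space \<nu>)) at_top)"

end

theory Submission
  imports Defs
begin

text \<open>
  The proof is a version of Hopf's argument, in the spirit of Babillot's proof of mixing. Suppose
  that the correlations of two sets fail to converge to the product value. Then they stay away from it along some filter \<open>F\<close>
  of times tending to infinity, and by Tychonoff's theorem \<open>F\<close> can be refined so that every bounded
  observable \<open>h\<close> has a weak limit \<open>P h\<close> of \<open>h \<circ> \<psi>\<^sup>t\<close> and a weak limit \<open>P\<^sup>* h\<close> of \<open>h \<circ> \<psi>\<^sup>-\<^sup>t\<close> along \<open>F\<close>.
  The operators \<open>P\<close> and \<open>P\<^sup>*\<close> are adjoint to each other and commute with the flow, hence with each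
  other. Points \<open>(x, y, s)\<close> and \<open>(x', y, s)\<close> have asymptotic forward orbits in \<open>U\<^sub>\<Gamma>\<close>, so \<open>P h\<close> takes the
  same value at almost all such pairs; points \<open>(x, y, s)\<close> and \<open>(x, y', s + G(x, y') - G(x, y))\<close> have
  asymptotic backward orbits, so \<open>P\<^sup>* h\<close> is invariant along these pairs. Therefore \<open>P\<^sup>* P f = P P\<^sup>* f\<close>
  is invariant along both families. As soon as functions with both invariances are constant, say
  \<open>P\<^sup>* P f = c\<close>, the integral of \<open>(P f - c)\<^sup>2\<close> is seen to vanish, so \<open>P f = c\<close> and the correlations
  do converge to the product value along \<open>F\<close>, a contradiction. This is \<open>mixing_if_weak_limits_rigid\<close>.

  The asymptotics come from the convergence dynamics (\<open>stable_common_limit\<close>, \<open>unstable_common_limit\<close>):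
  if \<open>\<gamma>\<^sub>n\<close> brings \<open>(x, y, s + t\<^sub>n)\<close> back to a compact set and \<open>t\<^sub>n \<rightarrow> \<infinity>\<close>, then \<open>\<sigma>(\<gamma>\<^sub>n, y) \<rightarrow> -\<infinity>\<close>. Since
  \<open>\<sigma>\<close> is expanding, \<open>y\<close> is the repelling point of \<open>\<gamma>\<^sub>n\<close>, and \<open>\<gamma>\<^sub>n x\<close> and \<open>\<gamma>\<^sub>n x'\<close> have the same limit.
  Backward orbits are treated in the same way, with \<open>G\<close> accounting for the change of height.
  This settles observables built from compactly supported functions on the cover; they generate all
  measurable ones (\<open>asymptotic_all\<close>).

  It remains to see that a function with both invariances is constant (\<open>constant_if_leaf_invariant\<close>).
  Its lift to \<open>(x, y, s)\<close> is almost surely of the form \<open>H\<^sub>y(s)\<close>, by invariance along the first family,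
  and invariance along the second one turns into
  \<open>H\<^sub>y(s) = H\<^sub>y\<^sub>'(s + G(x, y') - G(x, y))\<close> for almost all \<open>x\<close>, \<open>y\<close>, \<open>y'\<close>. Comparing two values of \<open>x\<close>
  shows that the cross ratio \<open>B(x, x', y, y')\<close> is a period of \<open>H\<^sub>y\<close>. The \<open>H\<^sub>y\<close> are translates of each
  other, so they have the same group of periods, which is closed. The Patterson--Sullivan measures
  charge every open set meeting the limit set, because they are quasi-invariant and \<open>\<Gamma>\<close> has no global
  fixed point (\<open>quasi_invariant_support\<close>), and \<open>G\<close> is continuous; so every element of the cross ratio
  spectrum is a period. The spectrum generates a dense group, so every number is a period and
  each \<open>H\<^sub>y\<close> is constant.

  The quotient measure \<open>m\<^sub>\<Gamma>\<close> is only given through sums over orbits. It is made accessible by a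
  measurable weight on the cover whose sum over every orbit is \<open>1\<close> (\<open>orbit_sum_weight\<close>).
\<close>

section \<open>Weak limits of functions with values in the unit interval\<close>

text \<open>
  Tychonoff's theorem: the family takes its values in a product of compact intervals, so the image
  of the filter has a cluster point there. A filter is used in place of a subsequence because the index
  set will be the uncountable set of all observables.
\<close>

lemma convergent_subfilter_of_bounded_family:
  fixes \<Phi> :: "'t \<Rightarrow> 'i \<Rightarrow> real"
  assumes "F0 \<noteq> bot" and bnd: "\<And>t i. \<bar>\<Phi> t i\<bar> \<le> C i"
  shows "\<exists>F. F \<noteq> bot \<and> F \<le> F0 \<and> (\<forall>i. \<exists>l. ((\<lambda>t. \<Phi> t i) \<longlongrightarrow> l) F)"
proof -
  define K where "K = (\<Pi>\<^sub>E i\<in>UNIV. {- C i .. C i})"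
  have "compactin (product_topology (\<lambda>_. euclidean) UNIV) K"
    unfolding K_def compactin_PiE by simp
  then have "compact K"
    by (simp add: euclidean_product_topology)
  moreover have "eventually (\<lambda>x. x \<in> K) (filtermap \<Phi> F0)"
    using bnd by (auto simp: eventually_filtermap K_def abs_le_iff minus_le_iff intro!: always_eventually)
  moreover have "filtermap \<Phi> F0 \<noteq> bot"
    using assms(1) by (simp add: filtermap_bot_iff)
  ultimately obtain b where b: "inf (nhds b) (filtermap \<Phi> F0) \<noteq> bot"
    unfolding compact_filter by blast
  define F where "F = inf F0 (filtercomap \<Phi> (nhds b))"
  have "F \<noteq> bot"
  proof
    assume "F = bot"
    then have "eventually (\<lambda>_. False) F" by simp
    then obtain P Q where P: "eventually P F0" and Q: "eventually Q (nhds b)"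
      and PQ: "\<And>t. P t \<Longrightarrow> Q (\<Phi> t) \<Longrightarrow> False"
      unfolding F_def eventually_inf eventually_filtercomap by metis
    have "eventually (\<lambda>x. \<not> Q x) (filtermap \<Phi> F0)"
      unfolding eventually_filtermap using P by eventually_elim (use PQ in blast)
    with Q have "eventually (\<lambda>_. False) (inf (nhds b) (filtermap \<Phi> F0))"
      unfolding eventually_inf by blast
    with b show False by (simp add: trivial_limit_def)
  qed
  moreover have "F \<le> F0" by (simp add: F_def)
  moreover have "filterlim \<Phi> (nhds b) F"
    using filterlim_filtercomap[of \<Phi> "nhds b"] by (rule filterlim_mono) (auto simp: F_def)
  then have "((\<lambda>t. \<Phi> t i) \<longlongrightarrow> b i) F" for i
    using continuous_on_tendsto_compose[of UNIV "\<lambda>x. x i" \<Phi> b F] by simp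
  ultimately show ?thesis by blast
qed

text \<open>
  The Radon--Nikodym theorem with a density that is real valued and nonnegative everywhere.
\<close>

lemma integrable_density_exists:
  assumes "finite_measure M" "finite_measure N" and ac: "absolutely_continuous M N" and sets: "sets N = sets M"
  obtains D :: "'a \<Rightarrow> real" where "D \<in> borel_measurable M" "\<And>x. 0 \<le> D x"
    "density M (\<lambda>x. ennreal (D x)) = N" "integrable M D"
proof -
  interpret M: finite_measure M by fact
  obtain D where D: "D \<in> borel_measurable M" "AE x in M. RN_deriv M N x = ennreal (D x)" "\<And>x. 0 \<le> D x"
    using M.real_RN_deriv[OF assms(2) ac sets] by blast
  have dens: "density M (\<lambda>x. ennreal (D x)) = N"
    using M.density_RN_deriv[OF ac sets] density_cong[of "RN_deriv M N" M "\<lambda>x. ennreal (D x)"] D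
    by simp
  have "integrable (density M (\<lambda>x. ennreal (D x))) (\<lambda>_. 1::real)"
    unfolding dens by (rule finite_measure.integrable_const[OF assms(2)])
  then have "integrable M D"
    using integrable_density[of "\<lambda>_. 1::real" M D] D(1,3) by simp
  with D dens show thesis by (intro that)
qed

text \<open>
  The density of \<open>\<nu>\<close> exceeds \<open>n\<close> only on a set whose \<open>\<nu>\<close>-measure is smaller than \<open>\<epsilon>\<close> when \<open>n\<close> is
  large; elsewhere \<open>\<nu>\<close> is at most \<open>n\<close> times \<open>M\<close>. The point is that \<open>c\<close> is the same for all \<open>u\<close>.
\<close>

lemma dominated_by_constant_multiple:
  fixes M \<nu> :: "'a measure" and \<epsilon> :: real
  assumes "finite_measure M" "finite_measure \<nu>" and ac: "absolutely_continuous M \<nu>"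
    and sets: "sets \<nu> = sets M" and "\<epsilon> > 0"
  shows "\<exists>c>0. \<forall>u\<in>borel_measurable M. (\<forall>x. 0 \<le> u x \<and> u x \<le> 1) \<longrightarrow>
            (\<integral>x. u x \<partial>\<nu>) \<le> \<epsilon> + c * (\<integral>x. u x \<partial>M)"
proof -
  interpret M: finite_measure M by fact
  obtain D where D: "D \<in> borel_measurable M" "\<And>x. 0 \<le> D x"
    and dens: "density M (\<lambda>x. ennreal (D x)) = \<nu>" and intD: "integrable M D"
    using integrable_density_exists[OF assms(1,2) ac sets] by blast
  have "(\<lambda>n. \<integral>x. (if real n < D x then D x else 0) \<partial>M) \<longlonglongrightarrow> (\<integral>x. 0 \<partial>M)"
  proof (rule integral_dominated_convergence[where w = D])
    show "AE x in M. (\<lambda>n. if real n < D x then D x else 0) \<longlonglongrightarrow> 0"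
    proof (rule AE_I2)
      fix x
      obtain k where "D x \<le> real k" using real_arch_simple by blast
      then have "\<forall>\<^sub>F n in sequentially. (if real n < D x then D x else 0) = 0"
        by (intro eventually_sequentiallyI[of k]) auto
      then show "(\<lambda>n. if real n < D x then D x else 0) \<longlonglongrightarrow> 0"
        by (rule tendsto_eventually)
    qed
  qed (use D intD in auto)
  then have "\<forall>\<^sub>F n in sequentially. (\<integral>x. (if real n < D x then D x else 0) \<partial>M) < \<epsilon>"
    using \<open>\<epsilon> > 0\<close> by (auto dest!: order_tendstoD(2))
  then obtain n where n: "(\<integral>x. (if real n < D x then D x else 0) \<partial>M) < \<epsilon>"
    by (auto simp: eventually_sequentially)
  have "(\<integral>x. u x \<partial>\<nu>) \<le> \<epsilon> + (real n + 1) * (\<integral>x. u x \<partial>M)"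
    if u: "u \<in> borel_measurable M" "\<And>x. 0 \<le> u x \<and> u x \<le> 1" for u
  proof -
    have iu: "integrable M u"
      by (rule M.integrable_const_bound[where B = 1]) (use u in auto)
    have Dn: "integrable M (\<lambda>x. if real n < D x then D x else 0)"
      by (rule Bochner_Integration.integrable_bound[OF intD]) (use D in auto)
    have "(\<integral>x. u x \<partial>\<nu>) = (\<integral>x. D x * u x \<partial>M)"
      using D u by (subst dens[symmetric], subst integral_density) auto
    also have "\<dots> \<le> (\<integral>x. (if real n < D x then D x else 0) + (real n + 1) * u x \<partial>M)"
    proof (rule integral_mono)
      show "integrable M (\<lambda>x. D x * u x)"
        by (rule Bochner_Integration.integrable_bound[OF intD])
          (use D u in \<open>auto simp: abs_mult mult_left_le\<close>)
      show "integrable M (\<lambda>x. (if real n < D x then D x else 0) + (real n + 1) * u x)"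
        using Dn iu by simp
      fix x
      have "D x * u x \<le> D x" using D(2)[of x] u(2)[of x] by (simp add: mult_left_le)
      moreover have "D x * u x \<le> (real n + 1) * u x" if "\<not> real n < D x"
        using that u(2)[of x] by (intro mult_right_mono) auto
      moreover have "0 \<le> (real n + 1) * u x" using u(2)[of x] by simp
      ultimately show "D x * u x \<le> (if real n < D x then D x else 0) + (real n + 1) * u x" by auto
    qed
    also have "\<dots> = (\<integral>x. (if real n < D x then D x else 0) \<partial>M) + (real n + 1) * (\<integral>x. u x \<partial>M)"
      using Dn iu by simp
    finally show ?thesis using n by simp
  qed
  then show ?thesis by (intro exI[of _ "real n + 1"]) auto
qed

text \<open>
  Convergence against indicators extends to integrable \<open>\<kappa>\<close> by approximation in \<open>L\<^sup>1\<close>, uniformly in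
  \<open>t\<close> because all functions involved are bounded by \<open>1\<close>.
\<close>

lemma tendsto_integral_of_unit_valued:
  fixes M :: "'a measure" and u :: "'t \<Rightarrow> 'a \<Rightarrow> real" and g \<kappa> :: "'a \<Rightarrow> real"
  assumes "finite_measure M" and "F \<noteq> bot"
    and u: "\<And>t. u t \<in> borel_measurable M" "\<And>t x. 0 \<le> u t x \<and> u t x \<le> 1"
    and g: "g \<in> borel_measurable M" "\<And>x. 0 \<le> g x \<and> g x \<le> 1"
    and lim: "\<And>E. E \<in> sets M \<Longrightarrow> ((\<lambda>t. \<integral>x. u t x * indicator E x \<partial>M) \<longlongrightarrow> (\<integral>x. g x * indicator E x \<partial>M)) F"
    and \<kappa>: "integrable M \<kappa>"
  shows "((\<lambda>t. \<integral>x. u t x * \<kappa> x \<partial>M) \<longlongrightarrow> (\<integral>x. g x * \<kappa> x \<partial>M)) (F :: 't filter)"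
proof -
  have ab: "\<bar>v x * f x\<bar> \<le> \<bar>f x\<bar>" if "0 \<le> v x \<and> v x \<le> (1::real)" for v f :: "'a \<Rightarrow> real" and x
    using that by (simp add: abs_mult mult_left_le_one_le)
  have int: "integrable M (\<lambda>x. v x * f x)"
    if "v \<in> borel_measurable M" "\<And>x. 0 \<le> v x \<and> v x \<le> (1::real)" "integrable M f" for v f
    by (rule Bochner_Integration.integrable_bound[OF that(3)]) (use that in \<open>auto intro!: ab\<close>)
  show ?thesis
    using \<kappa>
  proof (induction rule: integrable_induct)
    case (base A c)
    have "((\<lambda>t. (\<integral>x. u t x * indicator A x \<partial>M) * c) \<longlongrightarrow> (\<integral>x. g x * indicator A x \<partial>M) * c) F"
      using lim[OF base(1)] by (intro tendsto_intros)
    then show ?case by (simp flip: mult.assoc)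
  next
    case (add f h)
    then show ?case
      using tendsto_add[OF add(3,4)] by (simp add: distrib_left int u g)
  next
    case (lim f s)
    have "(\<lambda>i. \<integral>x. \<bar>s i x - f x\<bar> \<partial>M) \<longlonglongrightarrow> (\<integral>x. 0 \<partial>M)"
    proof (rule integral_dominated_convergence[where w = "\<lambda>x. 3 * norm (f x)"])
      show "AE x in M. (\<lambda>i. \<bar>s i x - f x\<bar>) \<longlonglongrightarrow> 0"
        using lim(2) by (intro AE_I2) (metis LIM_zero tendsto_rabs_zero)
      show "AE x in M. norm \<bar>s i x - f x\<bar> \<le> 3 * norm (f x)" for i
      proof (rule AE_I2)
        fix x assume "x \<in> space M"
        then have "norm (s i x) \<le> 2 * norm (f x)" using lim(3) by blast
        then show "norm \<bar>s i x - f x\<bar> \<le> 3 * norm (f x)" by simp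
      qed
    qed (use lim in \<open>auto intro!: borel_measurable_integrable borel_measurable_abs borel_measurable_diff\<close>)
    then have L: "(\<lambda>i. \<integral>x. \<bar>s i x - f x\<bar> \<partial>M) \<longlonglongrightarrow> 0" by simp
    have close: "\<bar>(\<integral>x. v x * s i x \<partial>M) - (\<integral>x. v x * f x \<partial>M)\<bar> \<le> (\<integral>x. \<bar>s i x - f x\<bar> \<partial>M)"
      if v: "v \<in> borel_measurable M" "\<And>x. 0 \<le> v x \<and> v x \<le> (1::real)" for v i
    proof -
      have "(\<integral>x. v x * s i x \<partial>M) - (\<integral>x. v x * f x \<partial>M) = (\<integral>x. v x * (s i x - f x) \<partial>M)"
        using int[OF v lim(1)[of i]] int[OF v lim(4)] by (simp add: algebra_simps)
      also have "\<bar>\<dots>\<bar> \<le> (\<integral>x. \<bar>v x * (s i x - f x)\<bar> \<partial>M)"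
        using integral_norm_bound[of M "\<lambda>x. v x * (s i x - f x)"] by simp
      also have "\<dots> \<le> (\<integral>x. \<bar>s i x - f x\<bar> \<partial>M)"
        using int[OF v, of "\<lambda>x. s i x - f x"] lim v(2)
        by (intro integral_mono) (auto intro!: Bochner_Integration.integrable_diff ab)
      finally show ?thesis .
    qed
    show ?case
    proof (rule tendstoI)
      fix e :: real assume "e > 0"
      then have "\<forall>\<^sub>F i in sequentially. (\<integral>x. \<bar>s i x - f x\<bar> \<partial>M) < e / 3"
        using L by (intro order_tendstoD(2)) auto
      then obtain i where i: "(\<integral>x. \<bar>s i x - f x\<bar> \<partial>M) < e / 3"
        by (auto simp: eventually_sequentially)
      have "\<forall>\<^sub>F t in F. dist (\<integral>x. u t x * s i x \<partial>M) (\<integral>x. g x * s i x \<partial>M) < e / 3"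
        using lim(5)[of i] \<open>e > 0\<close> by (intro tendstoD) auto
      then show "\<forall>\<^sub>F t in F. dist (\<integral>x. u t x * f x \<partial>M) (\<integral>x. g x * f x \<partial>M) < e"
      proof eventually_elim
        case (elim t)
        then show ?case
          using close[OF u, of t i] close[OF g, of i] i unfolding dist_real_def by linarith
      qed
    qed
  qed
qed

text \<open>
  The limits of the integrals over \<open>E\<close> form an additive function of \<open>E\<close> that is at most \<open>M E\<close>. So it
  is a measure, absolutely continuous with respect to \<open>M\<close>, and its Radon--Nikodym density is the weak limit.
\<close>

lemma weak_limit_of_unit_valued:
  fixes M :: "'a measure" and u :: "'t \<Rightarrow> 'a \<Rightarrow> real"
  assumes "finite_measure M" and "F \<noteq> bot"
    and u: "\<And>t. u t \<in> borel_measurable M" "\<And>t x. 0 \<le> u t x \<and> u t x \<le> 1"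
    and conv: "\<And>E. E \<in> sets M \<Longrightarrow> \<exists>l. ((\<lambda>t. \<integral>x. u t x * indicator E x \<partial>M) \<longlongrightarrow> l) F"
  shows "\<exists>g\<in>borel_measurable M. (\<forall>x. 0 \<le> g x \<and> g x \<le> 1) \<and>
     (\<forall>\<kappa>. integrable M \<kappa> \<longrightarrow> ((\<lambda>t. \<integral>x. u t x * \<kappa> x \<partial>M) \<longlongrightarrow> (\<integral>x. g x * \<kappa> x \<partial>M)) (F :: 't filter))"
proof -
  interpret M: finite_measure M by fact
  define l where "l E = Lim F (\<lambda>t. \<integral>x. u t x * indicator E x \<partial>M)" for E
  have l: "((\<lambda>t. \<integral>x. u t x * indicator E x \<partial>M) \<longlongrightarrow> l E) F" if "E \<in> sets M" for E
    using conv[OF that] \<open>F \<noteq> bot\<close> tendsto_Lim unfolding l_def by blast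
  have int: "integrable M (\<lambda>x. u t x * indicator E x)" if "E \<in> sets M" for t E
    by (rule M.integrable_const_bound[where B = 1])
      (use u that in \<open>auto simp: indicator_def abs_mult intro!: borel_measurable_times\<close>)
  have l_nonneg: "0 \<le> l E" if "E \<in> sets M" for E
    by (rule tendsto_lowerbound[OF l[OF that] _ \<open>F \<noteq> bot\<close>])
      (use u in \<open>auto intro!: always_eventually integral_nonneg_AE\<close>)
  have l_le: "l E \<le> measure M E" if "E \<in> sets M" for E
  proof (rule tendsto_upperbound[OF l[OF that] _ \<open>F \<noteq> bot\<close>])
    have "integrable M (indicator E :: 'a \<Rightarrow> real)"
      using that by (simp add: M.emeasure_finite less_top[symmetric])
    then have "(\<integral>x. u t x * indicator E x \<partial>M) \<le> (\<integral>x. indicator E x \<partial>M)" for t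
      by (rule integral_mono[OF int[OF that]]) (use u in \<open>simp add: indicator_def\<close>)
    then show "\<forall>\<^sub>F t in F. (\<integral>x. u t x * indicator E x \<partial>M) \<le> measure M E"
      using that by (auto intro!: always_eventually)
  qed
  have l_add: "l (A \<union> B) = l A + l B" if "A \<in> sets M" "B \<in> sets M" "A \<inter> B = {}" for A B
  proof (rule tendsto_unique[OF \<open>F \<noteq> bot\<close>])
    show "((\<lambda>t. \<integral>x. u t x * indicator (A \<union> B) x \<partial>M) \<longlongrightarrow> l (A \<union> B)) F"
      using that by (intro l) auto
    have "(\<integral>x. u t x * indicator (A \<union> B) x \<partial>M)
      = (\<integral>x. u t x * indicator A x \<partial>M) + (\<integral>x. u t x * indicator B x \<partial>M)" for t
      using int that by (simp add: indicator_add[symmetric] indicator_disj_union distrib_left)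
    then show "((\<lambda>t. \<integral>x. u t x * indicator (A \<union> B) x \<partial>M) \<longlongrightarrow> l A + l B) F"
      using tendsto_add[OF l[OF that(1)] l[OF that(2)]] by simp
  qed
  have l_empty: "l {} = 0"
    using l_nonneg[of "{}"] l_le[of "{}"] by simp
  define N where "N = measure_of (space M) (sets M) (\<lambda>E. ennreal (l E))"
  have setsN: "sets N = sets M" by (simp add: N_def)
  have emN: "emeasure N E = ennreal (l E)" if "E \<in> sets M" for E
  proof (rule emeasure_measure_of[OF N_def])
    show "sets M \<subseteq> Pow (space M)" by (rule sets.space_closed)
    show "positive (sets N) (\<lambda>E. ennreal (l E))"
      by (simp add: positive_def l_empty)
    then show "countably_additive (sets N) (\<lambda>E. ennreal (l E))"
    proof (rule sets.empty_continuous_imp_countably_additive)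
      show "Measure_Space.additive (sets N) (\<lambda>E. ennreal (l E))"
        unfolding additive_def setsN using l_add l_nonneg by auto
      fix A :: "nat \<Rightarrow> 'a set" assume A: "range A \<subseteq> sets N" "decseq A" "(\<Inter>i. A i) = {}"
      have "(\<lambda>i. measure M (A i)) \<longlonglongrightarrow> measure M (\<Inter>i. A i)"
        using A setsN by (intro M.finite_Lim_measure_decseq) auto
      then have "(\<lambda>i. measure M (A i)) \<longlonglongrightarrow> 0" using A by simp
      then have "(\<lambda>i. l (A i)) \<longlonglongrightarrow> 0"
        by (rule tendsto_sandwich[OF _ _ tendsto_const, rotated 2])
          (use A l_le l_nonneg setsN in \<open>auto intro!: always_eventually\<close>)
      then show "(\<lambda>i. ennreal (l (A i))) \<longlonglongrightarrow> 0"
        using tendsto_ennrealI by fastforce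
    qed auto
    show "E \<in> sets N" using that setsN by simp
  qed
  have "finite_measure N"
  proof (rule finite_measureI)
    show "emeasure N (space N) \<noteq> \<infinity>"
      using emN[of "space M"] sets_eq_imp_space_eq[OF setsN] by simp
  qed
  have ac: "absolutely_continuous M N"
    unfolding absolutely_continuous_def
  proof
    fix E assume E: "E \<in> null_sets M"
    then have "l E \<le> 0" using l_le[of E] by (auto simp: null_sets_def measure_def)
    then show "E \<in> null_sets N" using E by (auto simp: null_sets_def setsN emN ennreal_neg)
  qed
  obtain D where D: "D \<in> borel_measurable M" "\<And>x. 0 \<le> D x"
    and dens: "density M (\<lambda>x. ennreal (D x)) = N" and intD: "integrable M D"
    using integrable_density_exists[OF assms(1) \<open>finite_measure N\<close> ac setsN] by blast
  have intD_E: "(\<integral>x. D x * indicator E x \<partial>M) = l E" if "E \<in> sets M" for E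
  proof -
    have "(\<integral>x. D x * indicator E x \<partial>M) = (\<integral>x. indicator E x \<partial>N)"
      using D that by (subst dens[symmetric], subst integral_density) auto
    also have "\<dots> = l E"
      using that setsN l_nonneg by (simp add: measure_def emN)
    finally show ?thesis .
  qed
  have "AE x in M. D x \<le> 1"
  proof -
    define E where "E = {x\<in>space M. D x > 1}"
    have [measurable]: "E \<in> sets M" unfolding E_def using D(1) by measurable
    have i1: "integrable M (\<lambda>x. D x * indicator E x)"
      using integrable_mult_indicator[OF \<open>E \<in> sets M\<close> intD] by (simp add: mult.commute)
    have i2: "integrable M (\<lambda>x. indicator E x :: real)"
      by (simp add: M.emeasure_finite less_top[symmetric])
    have nn: "0 \<le> (D x - 1) * indicator E x" for x
      by (auto simp: E_def indicator_def)
    have "(\<integral>x. (D x - 1) * indicator E x \<partial>M) \<le> 0"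
      using i1 i2 l_le[of E] by (simp add: left_diff_distrib intD_E)
    moreover have "0 \<le> (\<integral>x. (D x - 1) * indicator E x \<partial>M)"
      using nn by (simp add: integral_nonneg_AE)
    ultimately have "(\<integral>x. (D x - 1) * indicator E x \<partial>M) = 0" by simp
    then have "AE x in M. (D x - 1) * indicator E x = 0"
      using i1 i2 nn by (subst (asm) integral_nonneg_eq_0_iff_AE) (auto simp: left_diff_distrib)
    then show ?thesis
      by (rule AE_mp) (auto intro!: AE_I2 simp: E_def indicator_def split: if_splits)
  qed
  \<comment> \<open>The density is only almost everywhere at most \<open>1\<close>; truncation makes the bound hold everywhere.\<close>
  define g where "g x = min 1 (D x)" for x
  have g: "g \<in> borel_measurable M" "\<And>x. 0 \<le> g x \<and> g x \<le> 1"
    using D unfolding g_def[abs_def] by auto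
  have g_E: "(\<integral>x. g x * indicator E x \<partial>M) = l E" if "E \<in> sets M" for E
  proof -
    have "(\<integral>x. g x * indicator E x \<partial>M) = (\<integral>x. D x * indicator E x \<partial>M)"
      using \<open>AE x in M. D x \<le> 1\<close> D(1) g(1) that by (intro integral_cong_AE) (auto simp: g_def)
    then show ?thesis using intD_E[OF that] by simp
  qed
  show ?thesis
  proof (intro bexI[of _ g] conjI allI impI g)
    fix \<kappa> :: "'a \<Rightarrow> real" assume "integrable M \<kappa>"
    then show "((\<lambda>t. \<integral>x. u t x * \<kappa> x \<partial>M) \<longlongrightarrow> (\<integral>x. g x * \<kappa> x \<partial>M)) F"
      by (rule tendsto_integral_of_unit_valued[OF assms(1,2) u g, rotated 1]) (simp add: g_E l)
  qed (use g in auto)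
qed


section \<open>A mixing criterion for measure-preserving flows\<close>

definition unit_valued :: "'a measure \<Rightarrow> ('a \<Rightarrow> real) \<Rightarrow> bool" where
  "unit_valued M g \<longleftrightarrow> g \<in> borel_measurable M \<and> (\<forall>x. 0 \<le> g x \<and> g x \<le> 1)"

lemma unit_valuedD:
  assumes "unit_valued M g"
  shows "g \<in> borel_measurable M" "0 \<le> g x" "g x \<le> 1"
  using assms by (auto simp: unit_valued_def)

lemma unit_valued_indicator: "E \<in> sets M \<Longrightarrow> unit_valued M (indicator E)"
  by (auto simp: unit_valued_def indicator_def intro!: borel_measurable_indicator')

lemma unit_valued_compose:
  "unit_valued M g \<Longrightarrow> f \<in> measurable N M \<Longrightarrow> unit_valued N (\<lambda>x. g (f x))"
  by (auto simp: unit_valued_def)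

lemma integrable_unit_valued:
  assumes "finite_measure M" "unit_valued M g"
  shows "integrable M g"
  using assms(2) by (intro finite_measure.integrable_const_bound[OF assms(1), where B = 1])
    (auto simp: unit_valued_def)

lemma integrable_mult_unit_valued:
  fixes f :: "'a \<Rightarrow> real"
  assumes "integrable M f" "unit_valued M g"
  shows "integrable M (\<lambda>x. g x * f x)"
  by (rule Bochner_Integration.integrable_bound[OF assms(1)])
    (use assms in \<open>auto simp: unit_valued_def abs_mult mult_left_le_one_le\<close>)

lemma AE_eq_of_set_integrals:
  assumes "finite_measure M" "unit_valued M u" "unit_valued M v"
    and eq: "\<And>E. E \<in> sets M \<Longrightarrow> (\<integral>x. u x * indicator E x \<partial>M) = (\<integral>x. v x * indicator E x \<partial>M)"
  shows "AE x in M. u x = v x"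
proof -
  have *: "AE x in M. u x \<le> v x"
    if uv: "unit_valued M u" "unit_valued M v"
      and eq: "\<And>E. E \<in> sets M \<Longrightarrow> (\<integral>x. u x * indicator E x \<partial>M) = (\<integral>x. v x * indicator E x \<partial>M)"
    for u v
  proof -
    define E where "E = {x\<in>space M. u x > v x}"
    have [measurable]: "u \<in> borel_measurable M" "v \<in> borel_measurable M"
      using uv by (auto simp: unit_valued_def)
    have [measurable]: "E \<in> sets M" unfolding E_def by measurable
    have i: "integrable M (\<lambda>x. g x * indicator E x)" if "unit_valued M g" for g :: "'a \<Rightarrow> real"
      using integrable_mult_indicator[OF \<open>E \<in> sets M\<close> integrable_unit_valued[OF assms(1) that]]
      by (simp add: mult.commute)
    have "(\<integral>x. (u x - v x) * indicator E x \<partial>M) = 0"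
      using i[OF uv(1)] i[OF uv(2)] eq[of E] by (simp add: left_diff_distrib)
    then have "AE x in M. (u x - v x) * indicator E x = 0"
      using i[OF uv(1)] i[OF uv(2)]
      by (subst (asm) integral_nonneg_eq_0_iff_AE)
        (auto simp: left_diff_distrib E_def indicator_def)
    then show ?thesis
      by (rule AE_mp) (auto intro!: AE_I2 simp: E_def indicator_def split: if_splits)
  qed
  have "AE x in M. u x \<le> v x" "AE x in M. v x \<le> u x"
    by (rule *; use assms in simp)+
  then show ?thesis by (rule AE_mp[OF _ AE_mp]) (auto intro!: AE_I2)
qed

definition weak_limit :: "'a measure \<Rightarrow> 't filter \<Rightarrow> ('t \<Rightarrow> 'a \<Rightarrow> real) \<Rightarrow> ('a \<Rightarrow> real) \<Rightarrow> bool" where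
  "weak_limit M F u g \<longleftrightarrow> unit_valued M g \<and>
     (\<forall>\<kappa>. integrable M \<kappa> \<longrightarrow> ((\<lambda>t. \<integral>x. u t x * \<kappa> x \<partial>M) \<longlongrightarrow> (\<integral>x. g x * \<kappa> x \<partial>M)) F)"

lemma weak_limitD:
  assumes "weak_limit M F u g"
  shows "unit_valued M g"
    and "integrable M \<kappa> \<Longrightarrow> ((\<lambda>t. \<integral>x. u t x * \<kappa> x \<partial>M) \<longlongrightarrow> (\<integral>x. g x * \<kappa> x \<partial>M)) F"
  using assms by (auto simp: weak_limit_def)

lemma weak_limit_cong_AE:
  assumes "weak_limit M F u g" "unit_valued M g'" "AE x in M. g x = g' x"
  shows "weak_limit M F u g'"
  unfolding weak_limit_def
proof (intro conjI allI impI assms(2))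
  fix \<kappa> :: "'a \<Rightarrow> real" assume \<kappa>: "integrable M \<kappa>"
  have [measurable]: "\<kappa> \<in> borel_measurable M" "g \<in> borel_measurable M" "g' \<in> borel_measurable M"
    using assms \<kappa> by (auto simp: weak_limit_def unit_valued_def)
  have "(\<integral>x. g x * \<kappa> x \<partial>M) = (\<integral>x. g' x * \<kappa> x \<partial>M)"
    using assms(3) by (intro integral_cong_AE) auto
  then show "((\<lambda>t. \<integral>x. u t x * \<kappa> x \<partial>M) \<longlongrightarrow> (\<integral>x. g' x * \<kappa> x \<partial>M)) F"
    using weak_limitD(2)[OF assms(1) \<kappa>] by simp
qed

locale measure_preserving_flow = finite_measure M for M :: "'a measure" +
  fixes T :: "real \<Rightarrow> 'a \<Rightarrow> 'a"
  assumes T_measurable: "T t \<in> measurable M M"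
    and T_preserves: "distr M M (T t) = M"
    and T_add: "x \<in> space M \<Longrightarrow> T s (T t x) = T (s + t) x"
    and T_zero: "x \<in> space M \<Longrightarrow> T 0 x = x"
begin

lemma T_space: "x \<in> space M \<Longrightarrow> T t x \<in> space M"
  using T_measurable[of t] by (auto simp: measurable_def)

lemma reversed: "measure_preserving_flow M (\<lambda>t. T (- t))"
  by unfold_locales (auto simp: T_measurable T_preserves T_add T_zero add.commute)

lemma integral_T: "f \<in> borel_measurable M \<Longrightarrow> (\<integral>x. f (T t x) \<partial>M) = (\<integral>x. (f x :: real) \<partial>M)"
  using integral_distr[OF T_measurable[of t], of f] by (simp add: T_preserves)

lemma integral_T_mult:
  assumes [measurable]: "f \<in> borel_measurable M" "h \<in> borel_measurable M"
  shows "(\<integral>x. f (T (- t) x) * h x \<partial>M) = (\<integral>x. f x * (h (T t x) :: real) \<partial>M)"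
proof -
  note [measurable] = T_measurable
  have "(\<integral>x. f (T (- t) x) * h x \<partial>M) = (\<integral>x. f (T (- t) (T t x)) * h (T t x) \<partial>M)"
    using integral_T[of "\<lambda>x. f (T (- t) x) * h x" t] by simp
  also have "\<dots> = (\<integral>x. f x * h (T t x) \<partial>M)"
    by (rule Bochner_Integration.integral_cong) (auto simp: T_add T_zero)
  finally show ?thesis .
qed

lemma unit_valued_T: "unit_valued M f \<Longrightarrow> unit_valued M (\<lambda>x. f (T t x))"
  by (rule unit_valued_compose[OF _ T_measurable])

lemma image_T:
  assumes "B \<in> sets M"
  shows "T t ` B = {x\<in>space M. T (- t) x \<in> B}"
proof
  have "B \<subseteq> space M" using assms by (rule sets.sets_into_space)
  then show "T t ` B \<subseteq> {x\<in>space M. T (- t) x \<in> B}"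
    by (auto simp: T_add T_zero T_space subset_iff)
  show "{x\<in>space M. T (- t) x \<in> B} \<subseteq> T t ` B"
    using T_add[of _ t "- t"] T_zero by (force simp: image_iff)
qed

lemma measure_Int_image_T:
  assumes [measurable]: "A \<in> sets M" "B \<in> sets M"
  shows "measure M (A \<inter> T t ` B) = (\<integral>x. indicator A (T t x) * indicator B x \<partial>M)"
proof -
  note [measurable] = T_measurable
  have "{x\<in>space M. T (- t) x \<in> B} \<in> sets M" by measurable
  then have [measurable]: "A \<inter> {x\<in>space M. T (- t) x \<in> B} \<in> sets M" by measurable
  have "measure M (A \<inter> T t ` B) = (\<integral>x. indicator (A \<inter> {x\<in>space M. T (- t) x \<in> B}) x \<partial>M)"
    by (subst image_T) auto
  also have "\<dots> = (\<integral>x. indicator B (T (- t) x) * indicator A x \<partial>M)"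
    by (rule Bochner_Integration.integral_cong) (auto simp: indicator_def)
  also have "\<dots> = (\<integral>x. indicator B x * indicator A (T t x) \<partial>M)"
    by (rule integral_T_mult) auto
  finally show ?thesis by (simp add: mult.commute)
qed

text \<open>
  A single filter serves all observables and both time directions: the integrals of all
  \<open>h \<circ> T\<^sub>\<plusminus>\<^sub>t\<close> over all measurable sets form one bounded family.
\<close>

lemma weak_limits_exist_along_subfilter:
  assumes "F0 \<noteq> bot"
  shows "\<exists>F. F \<noteq> bot \<and> F \<le> F0 \<and> (\<forall>h. unit_valued M h \<longrightarrow>
     (\<exists>g. weak_limit M F (\<lambda>t x. h (T t x)) g) \<and> (\<exists>g. weak_limit M F (\<lambda>t x. h (T (- t) x)) g))"
proof -
  define \<Phi> where "\<Phi> t = (\<lambda>(b, h, E). if unit_valued M h \<and> E \<in> sets M then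
     (\<integral>x. h (T (if b then t else - t) x) * indicator E x \<partial>M) else 0)" for t
  have "\<bar>\<Phi> t i\<bar> \<le> measure M (space M)" for t i
  proof (cases i)
    case (fields b h E)
    show ?thesis
    proof (cases "unit_valued M h \<and> E \<in> sets M")
      case True
      define s where "s = (if b then t else - t)"
      have h: "unit_valued M (\<lambda>x. h (T s x))" using True by (intro unit_valued_T) auto
      have "integrable M (\<lambda>x. h (T s x) * indicator E x)"
        using integrable_mult_unit_valued[OF integrable_unit_valued[OF finite_measure_axioms unit_valued_indicator] h, of E] True
        by simp
      moreover have "0 \<le> h x" "h x \<le> 1" for x using True by (auto simp: unit_valued_def)
      ultimately have "0 \<le> (\<integral>x. h (T s x) * indicator E x \<partial>M)"
        "(\<integral>x. h (T s x) * indicator E x \<partial>M) \<le> (\<integral>x. 1 \<partial>M)"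
        by (auto intro!: integral_nonneg_AE integral_mono simp del: lebesgue_integral_const simp: indicator_def)
      then show ?thesis using True by (simp add: \<Phi>_def fields s_def)
    qed (auto simp: \<Phi>_def fields)
  qed
  from convergent_subfilter_of_bounded_family[of F0 \<Phi>, OF assms this]
  obtain F where F: "F \<noteq> bot" "F \<le> F0" and lim: "\<And>i. \<exists>l. ((\<lambda>t. \<Phi> t i) \<longlongrightarrow> l) F" by blast
  have "\<exists>g. weak_limit M F (\<lambda>t x. h (T (if b then t else - t) x)) g" if h: "unit_valued M h" for h b
  proof -
    have u: "unit_valued M (\<lambda>x. h (T (if b then t else - t) x))" for t
      using h by (intro unit_valued_T)
    have "\<exists>l. ((\<lambda>t. \<integral>x. h (T (if b then t else - t) x) * indicator E x \<partial>M) \<longlongrightarrow> l) F"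
      if "E \<in> sets M" for E
      using lim[of "(b, h, E)"] h that by (simp add: \<Phi>_def)
    with weak_limit_of_unit_valued[OF finite_measure_axioms F(1), of "\<lambda>t x. h (T (if b then t else - t) x)"] u
    show ?thesis unfolding weak_limit_def unit_valued_def by blast
  qed
  from this[where b = True] this[where b = False] show ?thesis using F by auto
qed

text \<open>
  Think of \<open>S\<close> and \<open>U\<close> as invariance along stable and unstable leaves. Weak limits of \<open>h \<circ> T\<^sub>t\<close> are
  assumed to satisfy the first and those of \<open>h \<circ> T\<^sub>-\<^sub>t\<close> the second, and the function \<open>g1\<close> below is a weak
  limit of both kinds.
\<close>

theorem mixing_if_weak_limits_rigid:
  assumes stable: "\<And>F h g. \<lbrakk>F \<noteq> bot; F \<le> at_top; unit_valued M h;
       weak_limit M F (\<lambda>t x. h (T t x)) g\<rbrakk> \<Longrightarrow> S g"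
    and unstable: "\<And>F h g. \<lbrakk>F \<noteq> bot; F \<le> at_top; unit_valued M h;
       weak_limit M F (\<lambda>t x. h (T (- t) x)) g\<rbrakk> \<Longrightarrow> U g"
    and rigid: "\<And>g. \<lbrakk>unit_valued M g; S g; U g\<rbrakk> \<Longrightarrow> \<exists>c. AE x in M. g x = c"
  shows "mixing M T"
  unfolding mixing_def
proof (intro conjI allI ballI finite_measure_axioms T_measurable T_preserves)
  fix A B assume A[measurable]: "A \<in> sets M" and B[measurable]: "B \<in> sets M"
  let ?X = "space M"
  define L where "L = measure M A * measure M B / measure M ?X"
  define f :: "'a \<Rightarrow> real" where "f = indicator A"
  have f: "unit_valued M f" unfolding f_def by (rule unit_valued_indicator[OF A])
  have b: "integrable M (indicator B :: 'a \<Rightarrow> real)"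
    by (rule integrable_unit_valued[OF finite_measure_axioms unit_valued_indicator[OF B]])
  note int = integrable_unit_valued[OF finite_measure_axioms]
  have "((\<lambda>t. \<integral>x. f (T t x) * indicator B x \<partial>M) \<longlongrightarrow> L) at_top"
  proof (rule ccontr)
    let ?c = "\<lambda>t. \<integral>x. f (T t x) * indicator B x \<partial>M"
    assume "\<not> (?c \<longlongrightarrow> L) at_top"
    then obtain \<epsilon> where \<epsilon>: "\<epsilon> > 0" "\<not> (\<forall>\<^sub>F t in at_top. dist (?c t) L < \<epsilon>)"
      unfolding tendsto_iff by blast
    define F0 where "F0 = inf at_top (principal {t. \<epsilon> \<le> dist (?c t) L})"
    have "F0 \<noteq> bot"
    proof
      assume "F0 = bot"
      then have "\<forall>\<^sub>F t in F0. False" by simp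
      then have "\<forall>\<^sub>F t in at_top. t \<in> {t. \<epsilon> \<le> dist (?c t) L} \<longrightarrow> False"
        unfolding F0_def eventually_inf_principal .
      then show False using \<epsilon>(2) by (simp add: not_le)
    qed
    from weak_limits_exist_along_subfilter[OF this] obtain F where
      F: "F \<noteq> bot" "F \<le> F0"
      and ex: "\<And>h. unit_valued M h \<Longrightarrow> \<exists>g. weak_limit M F (\<lambda>t x. h (T t x)) g"
      and ex': "\<And>h. unit_valued M h \<Longrightarrow> \<exists>g. weak_limit M F (\<lambda>t x. h (T (- t) x)) g"
      by blast
    have F_top: "F \<le> at_top" using F(2) by (simp add: F0_def)
    \<comment> \<open>With \<open>P\<close> the operator of weak limits along \<open>F\<close> and \<open>P\<^sup>*\<close> its adjoint, \<open>g = P f\<close>,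
        \<open>e = P\<^sup>* f\<close>, \<open>g1 = P\<^sup>* P f\<close> and \<open>g2 = P P\<^sup>* f\<close>.\<close>
    obtain g where g: "weak_limit M F (\<lambda>t x. f (T t x)) g" using ex[OF f] by blast
    obtain e where e: "weak_limit M F (\<lambda>t x. f (T (- t) x)) e" using ex'[OF f] by blast
    note ug = weak_limitD(1)[OF g] and ue = weak_limitD(1)[OF e]
    obtain g1 where g1: "weak_limit M F (\<lambda>t x. g (T (- t) x)) g1" using ex'[OF ug] by blast
    obtain g2 where g2: "weak_limit M F (\<lambda>t x. e (T t x)) g2" using ex[OF ue] by blast
    note ug1 = weak_limitD(1)[OF g1] and ug2 = weak_limitD(1)[OF g2]
    \<comment> \<open>In \<open>\<integral> P\<^sup>* P f \<cdot> h = \<integral> P f \<cdot> P h\<close> the flow is moved from one factor to the other before the limit is taken.\<close>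
    have adj1: "(\<integral>x. g1 x * h x \<partial>M) = (\<integral>x. g x * k x \<partial>M)"
      if h: "unit_valued M h" and k: "weak_limit M F (\<lambda>t x. h (T t x)) k" for h k
    proof (rule tendsto_unique[OF F(1)])
      show "((\<lambda>t. \<integral>x. g (T (- t) x) * h x \<partial>M) \<longlongrightarrow> (\<integral>x. g1 x * h x \<partial>M)) F"
        by (rule weak_limitD(2)[OF g1 int[OF h]])
      have "((\<lambda>t. \<integral>x. h (T t x) * g x \<partial>M) \<longlongrightarrow> (\<integral>x. k x * g x \<partial>M)) F"
        by (rule weak_limitD(2)[OF k int[OF ug]])
      then show "((\<lambda>t. \<integral>x. g (T (- t) x) * h x \<partial>M) \<longlongrightarrow> (\<integral>x. g x * k x \<partial>M)) F"
        using h ug by (subst integral_T_mult) (auto simp: unit_valued_def mult.commute)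
    qed
    \<comment> \<open>The same value for \<open>\<integral> P P\<^sup>* f \<cdot> h\<close>, because \<open>P\<^sup>*\<close> commutes with the flow: at time \<open>t\<close> the integral
        is \<open>\<integral> (f \<circ> T\<^sub>t) \<cdot> P h\<close>.\<close>
    have adj2: "(\<integral>x. g2 x * h x \<partial>M) = (\<integral>x. g x * k x \<partial>M)"
      if h: "unit_valued M h" and k: "weak_limit M F (\<lambda>t x. h (T t x)) k" for h k
    proof (rule tendsto_unique[OF F(1)])
      show "((\<lambda>t. \<integral>x. e (T t x) * h x \<partial>M) \<longlongrightarrow> (\<integral>x. g2 x * h x \<partial>M)) F"
        by (rule weak_limitD(2)[OF g2 int[OF h]])
      have "(\<integral>x. e (T t x) * h x \<partial>M) = (\<integral>x. f (T t x) * k x \<partial>M)" for t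
      proof -
        have "(\<integral>x. e (T t x) * h x \<partial>M) = (\<integral>x. e x * h (T (- t) x) \<partial>M)"
          using integral_T_mult[of e h "- t"] ue h by (simp add: unit_valued_def)
        also have "\<dots> = (\<integral>x. f (T t x) * k x \<partial>M)"
        proof (rule tendsto_unique[OF F(1)])
          show "((\<lambda>s. \<integral>x. f (T (- s) x) * h (T (- t) x) \<partial>M) \<longlongrightarrow> (\<integral>x. e x * h (T (- t) x) \<partial>M)) F"
            by (rule weak_limitD(2)[OF e int[OF unit_valued_T[OF h]]])
          have "(\<integral>x. f (T (- s) x) * h (T (- t) x) \<partial>M) = (\<integral>x. h (T s x) * f (T t x) \<partial>M)" for s
          proof -
            have "(\<integral>x. f (T (- s) x) * h (T (- t) x) \<partial>M) = (\<integral>x. f x * h (T (- t) (T s x)) \<partial>M)"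
              using unit_valuedD(1)[OF f] unit_valuedD(1)[OF unit_valued_T[OF h]]
              by (rule integral_T_mult)
            also have "\<dots> = (\<integral>x. h (T (- t) (T s x)) * f x \<partial>M)"
              by (simp add: mult.commute)
            also have "\<dots> = (\<integral>x. h (T s (T (- t) x)) * f x \<partial>M)"
              by (rule Bochner_Integration.integral_cong) (auto simp: T_add add.commute)
            also have "\<dots> = (\<integral>x. h (T s x) * f (T t x) \<partial>M)"
              using unit_valuedD(1)[OF unit_valued_T[OF h]] unit_valuedD(1)[OF f]
              by (rule integral_T_mult)
            finally show ?thesis .
          qed
          moreover have "((\<lambda>s. \<integral>x. h (T s x) * f (T t x) \<partial>M) \<longlongrightarrow> (\<integral>x. k x * f (T t x) \<partial>M)) F"
            by (rule weak_limitD(2)[OF k int[OF unit_valued_T[OF f]]])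
          ultimately show "((\<lambda>s. \<integral>x. f (T (- s) x) * h (T (- t) x) \<partial>M) \<longlongrightarrow> (\<integral>x. f (T t x) * k x \<partial>M)) F"
            by (simp add: mult.commute)
        qed
        finally show ?thesis .
      qed
      then show "((\<lambda>t. \<integral>x. e (T t x) * h x \<partial>M) \<longlongrightarrow> (\<integral>x. g x * k x \<partial>M)) F"
        using weak_limitD(2)[OF g int[OF weak_limitD(1)[OF k]]] by simp
    qed
    have "AE x in M. g1 x = g2 x"
    proof (rule AE_eq_of_set_integrals[OF finite_measure_axioms ug1 ug2])
      fix E assume "E \<in> sets M"
      then have E: "unit_valued M (indicator E)" by (rule unit_valued_indicator)
      then obtain k where "weak_limit M F (\<lambda>t x. indicator E (T t x)) k" using ex by blast
      with adj1[OF E] adj2[OF E]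
      show "(\<integral>x. g1 x * indicator E x \<partial>M) = (\<integral>x. g2 x * indicator E x \<partial>M)" by simp
    qed
    then have "weak_limit M F (\<lambda>t x. e (T t x)) g1"
      by (intro weak_limit_cong_AE[OF g2 ug1]) auto
    then have "S g1" "U g1"
      using stable[OF F(1) F_top ue] unstable[OF F(1) F_top ug g1] by auto
    then obtain c where c: "AE x in M. g1 x = c" using rigid[OF ug1] by blast
    have int1: "(\<integral>x. g x \<partial>M) = measure M A"
    proof (rule tendsto_unique[OF F(1)])
      show "((\<lambda>t. \<integral>x. f (T t x) * 1 \<partial>M) \<longlongrightarrow> (\<integral>x. g x \<partial>M)) F"
        using weak_limitD(2)[OF g, of "\<lambda>_. 1"] by simp
      have "(\<integral>x. f (T t x) * 1 \<partial>M) = measure M A" for t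
        using integral_T[of f t] f by (simp add: unit_valued_def f_def)
      then show "((\<lambda>t. \<integral>x. f (T t x) * 1 \<partial>M) \<longlongrightarrow> measure M A) F" by simp
    qed
    have int2: "c * measure M ?X = measure M A"
    proof -
      have "(\<integral>x. g1 x \<partial>M) = (\<integral>x. g x \<partial>M)"
      proof (rule tendsto_unique[OF F(1)])
        show "((\<lambda>t. \<integral>x. g (T (- t) x) * 1 \<partial>M) \<longlongrightarrow> (\<integral>x. g1 x \<partial>M)) F"
          using weak_limitD(2)[OF g1, of "\<lambda>_. 1"] by simp
        show "((\<lambda>t. \<integral>x. g (T (- t) x) * 1 \<partial>M) \<longlongrightarrow> (\<integral>x. g x \<partial>M)) F"
          using ug by (simp add: integral_T unit_valued_def)
      qed
      moreover have "(\<integral>x. g1 x \<partial>M) = (\<integral>x. c \<partial>M)"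
        using c ug1 by (intro integral_cong_AE) (auto simp: unit_valued_def)
      ultimately show ?thesis using int1 by (simp add: mult.commute)
    qed
    \<comment> \<open>Here \<open>\<integral> (P f)\<^sup>2 = \<integral> P\<^sup>* P f \<cdot> f\<close> is evaluated using that \<open>P\<^sup>* P f\<close> is constant.\<close>
    have int3: "(\<integral>x. g x * g x \<partial>M) = c * measure M A"
    proof -
      have "(\<integral>x. g x * g x \<partial>M) = (\<integral>x. g1 x * f x \<partial>M)"
        using adj1[OF f g] by simp
      also have "\<dots> = (\<integral>x. c * f x \<partial>M)"
        using c ug1 f by (intro integral_cong_AE) (auto simp: unit_valued_def)
      finally show ?thesis by (simp add: f_def)
    qed
    have igg: "integrable M (\<lambda>x. g x * g x)"
      by (rule integrable_mult_unit_valued[OF int[OF ug] ug])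
    have sq: "(g x - c)\<^sup>2 = g x * g x - 2 * c * g x + c * c" for x
      by (simp add: power2_eq_square algebra_simps)
    have "(\<integral>x. (g x - c)\<^sup>2 \<partial>M) = c * measure M A - 2 * c * measure M A + c * (c * measure M ?X)"
      using igg int[OF ug] by (simp add: sq int1 int3)
    then have "(\<integral>x. (g x - c)\<^sup>2 \<partial>M) = 0" by (simp add: int2)
    moreover have "integrable M (\<lambda>x. (g x - c)\<^sup>2)"
      unfolding sq using igg int[OF ug] by simp
    ultimately have "AE x in M. g x = c"
      by (subst (asm) integral_nonneg_eq_0_iff_AE) auto
    then have "(\<integral>x. g x * indicator B x \<partial>M) = (\<integral>x. c * indicator B x \<partial>M)"
      using unit_valuedD(1)[OF ug] by (intro integral_cong_AE) auto
    also have "\<dots> = L"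
    proof (cases "measure M ?X = 0")
      case True
      then have "measure M B = 0"
        using bounded_measure[of B] by (simp add: measure_le_0_iff)
      then show ?thesis by (simp add: L_def)
    next
      case False
      then show ?thesis by (simp add: L_def flip: int2)
    qed
    finally have "(?c \<longlongrightarrow> L) F"
      using weak_limitD(2)[OF g b] by simp
    then have "\<forall>\<^sub>F t in F. dist (?c t) L < \<epsilon>"
      using \<epsilon>(1) by (rule tendstoD)
    moreover have "\<forall>\<^sub>F t in F. \<epsilon> \<le> dist (?c t) L"
      by (rule filter_leD[OF F(2)]) (simp add: F0_def eventually_inf_principal)
    ultimately have "\<forall>\<^sub>F t in F. False" by eventually_elim simp
    then show False using F(1) by simp
  qed
  then show "((\<lambda>t. measure M (A \<inter> T t ` B)) \<longlongrightarrow> measure M A * measure M B / measure M ?X) at_top"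
    by (simp add: measure_Int_image_T L_def f_def)
qed

end


section \<open>Weak limits are invariant along asymptotic pairs\<close>

text \<open>
  A number is approximated by averages of indicators of superlevel sets, which reduces statements on
  functions with values in the unit interval to statements on measurable sets.
\<close>

lemma tendsto_staircase:
  fixes u :: real
  assumes "0 \<le> u" "u \<le> 1"
  shows "(\<lambda>n. (\<Sum>j<n. indicator {y. real (Suc j) / real n \<le> y} u / real n)) \<longlonglongrightarrow> u"
proof (rule tendsto_sandwich[of "\<lambda>n. u - 1 / real n" _ _ "\<lambda>n. u"])
  have eq: "(\<Sum>j<n. indicator {y. real (Suc j) / real n \<le> y} u / real n) = of_int \<lfloor>real n * u\<rfloor> / real n"
    if "n > 0" for n
  proof -
    have "{j. j < n \<and> real (Suc j) / real n \<le> u} = {..<nat \<lfloor>real n * u\<rfloor>}"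
    proof (intro equalityI subsetI)
      fix j assume "j \<in> {j. j < n \<and> real (Suc j) / real n \<le> u}"
      then have "real_of_int (int (Suc j)) \<le> real n * u"
        using that by (simp add: field_simps)
      then have "int (Suc j) \<le> \<lfloor>real n * u\<rfloor>" by (simp only: le_floor_iff)
      then show "j \<in> {..<nat \<lfloor>real n * u\<rfloor>}" by (auto; linarith)
    next
      fix j assume "j \<in> {..<nat \<lfloor>real n * u\<rfloor>}"
      then have "int (Suc j) \<le> \<lfloor>real n * u\<rfloor>" by (auto; linarith)
      then have j: "real_of_int (int (Suc j)) \<le> real n * u" by (simp only: le_floor_iff)
      moreover have "real n * u \<le> real n" using assms by (simp add: mult_left_le)
      ultimately have "real (Suc j) \<le> real n" by linarith
      then show "j \<in> {j. j < n \<and> real (Suc j) / real n \<le> u}"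
        using j that by (simp add: field_simps)
    qed
    moreover have "(\<Sum>j<n. indicator {y. real (Suc j) / real n \<le> y} u) = (\<Sum>j | j < n \<and> real (Suc j) / real n \<le> u. 1::real)"
      by (rule sum.mono_neutral_cong_right) (auto simp: indicator_def)
    ultimately show ?thesis
      using assms by (simp flip: sum_divide_distrib)
  qed
  show "\<forall>\<^sub>F n in sequentially. u - 1 / real n \<le> (\<Sum>j<n. indicator {y. real (Suc j) / real n \<le> y} u / real n)"
    using eventually_gt_at_top[of 0]
  proof eventually_elim
    case (elim n)
    have "u - 1 / real n = (real n * u - 1) / real n" using elim by (simp add: field_simps)
    also have "\<dots> \<le> of_int \<lfloor>real n * u\<rfloor> / real n"
      by (rule divide_right_mono) (linarith, simp)
    finally show ?case by (simp only: eq[OF elim])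
  qed
  show "\<forall>\<^sub>F n in sequentially. (\<Sum>j<n. indicator {y. real (Suc j) / real n \<le> y} u / real n) \<le> u"
    using eventually_gt_at_top[of 0]
  proof eventually_elim
    case (elim n)
    have "of_int \<lfloor>real n * u\<rfloor> / real n \<le> real n * u / real n"
      by (rule divide_right_mono) (linarith, simp)
    then show ?case unfolding eq[OF elim] using elim by simp
  qed
  show "(\<lambda>n. u - 1 / real n) \<longlonglongrightarrow> u"
    using tendsto_diff[OF tendsto_const[of u] lim_1_over_n[where 'a = real]] by simp
qed simp

lemma unit_valued_abs_diff: "unit_valued M h \<Longrightarrow> \<bar>h x - h y\<bar> \<le> 1"
  using unit_valuedD(2,3)[of M h x] unit_valuedD(2,3)[of M h y] by linarith

text \<open>
  \<open>P\<close> parametrises pairs of points \<open>p w\<close> and \<open>q w\<close> that are thought of as lying on a common leaf.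
  Absolute continuity is what gives sense to values at \<open>p w\<close> and \<open>q w\<close> of functions that are defined
  only up to \<open>M\<close>-null sets, such as weak limits.
\<close>

locale leaf_pairs = measure_preserving_flow M T + P: finite_measure P
  for M :: "'a measure" and T and P :: "'b measure" +
  fixes p q :: "'b \<Rightarrow> 'a"
  assumes p_measurable: "p \<in> measurable P M" and q_measurable: "q \<in> measurable P M"
    and p_ac: "absolutely_continuous M (distr P M p)"
    and q_ac: "absolutely_continuous M (distr P M q)"
begin

text \<open>
  Differences are averaged over sets of pairs. In contrast to the pointwise condition of
  \<open>asymptotic_pointwise\<close>, this one survives limits of \<open>h\<close>, and it is all that a weak limit can see.
\<close>

definition asymptotic :: "('a \<Rightarrow> real) \<Rightarrow> bool" where
  "asymptotic h \<longleftrightarrow> (\<forall>D\<in>sets P.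
     ((\<lambda>t. \<integral>w. indicator D w * (h (T t (p w)) - h (T t (q w))) \<partial>P) \<longlongrightarrow> 0) at_top)"

lemma unit_valued_leaf:
  assumes "unit_valued M h"
  shows "unit_valued P (\<lambda>w. h (T t (p w)))" "unit_valued P (\<lambda>w. h (T t (q w)))"
  using unit_valued_compose[OF unit_valued_T[OF assms] p_measurable]
    unit_valued_compose[OF unit_valued_T[OF assms] q_measurable] by auto

lemma integrable_leaf_diff:
  assumes "D \<in> sets P" "unit_valued M h"
  shows "integrable P (\<lambda>w. indicator D w * (h (T t (p w)) - h (T t (q w))))"
proof -
  have "integrable P (\<lambda>w. h (T t (p w)) - h (T t (q w)))"
    using unit_valued_leaf[OF assms(2)]
    by (intro Bochner_Integration.integrable_diff integrable_unit_valued P.finite_measure_axioms)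
  from integrable_mult_indicator[OF assms(1) this] show ?thesis by simp
qed

lemma asymptotic_pointwise:
  assumes h: "unit_valued M h"
    and lim: "\<And>w. w \<in> space P \<Longrightarrow> ((\<lambda>t. h (T t (p w)) - h (T t (q w))) \<longlongrightarrow> 0) at_top"
  shows "asymptotic h"
  unfolding asymptotic_def
proof
  fix D assume D: "D \<in> sets P"
  have "((\<lambda>t. \<integral>w. indicator D w * (h (T t (p w)) - h (T t (q w))) \<partial>P) \<longlongrightarrow> (\<integral>w. 0 \<partial>P)) at_top"
  proof (rule integral_dominated_convergence_at_top[where w = "\<lambda>_. 1"])
    show "AE w in P. ((\<lambda>t. indicator D w * (h (T t (p w)) - h (T t (q w)))) \<longlongrightarrow> 0) at_top"
      using lim by (intro AE_I2) (auto intro: tendsto_mult_right_zero)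
    show "\<forall>\<^sub>F t in at_top. AE w in P. norm (indicator D w * (h (T t (p w)) - h (T t (q w)))) \<le> 1"
      using unit_valued_abs_diff[OF h]
      by (intro always_eventually allI AE_I2) (auto simp: indicator_def)
    show "(\<lambda>w. indicator D w * (h (T t (p w)) - h (T t (q w)))) \<in> borel_measurable P" for t
      using integrable_leaf_diff[OF D h] by (rule borel_measurable_integrable)
  qed auto
  then show "((\<lambda>t. \<integral>w. indicator D w * (h (T t (p w)) - h (T t (q w))) \<partial>P) \<longlongrightarrow> 0) at_top" by simp
qed

text \<open>
  The bound is uniform in \<open>t\<close>, since \<open>M\<close> is invariant: at time \<open>t\<close> it is the bound at time \<open>0\<close> applied to
  \<open>u \<circ> T\<^sub>t\<close>.
\<close>

lemma leaf_integral_bound: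
  assumes "\<epsilon> > 0"
  shows "\<exists>c>0. \<forall>u t. unit_valued M u \<longrightarrow>
    (\<integral>w. u (T t (p w)) \<partial>P) + (\<integral>w. u (T t (q w)) \<partial>P) \<le> \<epsilon> + c * (\<integral>x. u x \<partial>M)"
proof -
  have *: "\<exists>c>0. \<forall>u t. unit_valued M u \<longrightarrow> (\<integral>w. u (T t (f w)) \<partial>P) \<le> \<epsilon> / 2 + c * (\<integral>x. u x \<partial>M)"
    if f[measurable]: "f \<in> measurable P M" and ac: "absolutely_continuous M (distr P M f)" for f
  proof -
    have "finite_measure (distr P M f)" using f by (rule P.finite_measure_distr)
    from dominated_by_constant_multiple[OF finite_measure_axioms this ac _ half_gt_zero[OF assms]]
    obtain c where c: "c > 0" "\<And>u. unit_valued M u \<Longrightarrow>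
       (\<integral>x. u x \<partial>distr P M f) \<le> \<epsilon> / 2 + c * (\<integral>x. u x \<partial>M)"
      unfolding unit_valued_def by auto
    have "(\<integral>w. u (T t (f w)) \<partial>P) \<le> \<epsilon> / 2 + c * (\<integral>x. u x \<partial>M)" if u: "unit_valued M u" for u t
    proof -
      have uT: "unit_valued M (\<lambda>x. u (T t x))" by (rule unit_valued_T[OF u])
      have "(\<integral>w. u (T t (f w)) \<partial>P) = (\<integral>x. u (T t x) \<partial>distr P M f)"
        using uT by (subst integral_distr) (auto simp: unit_valued_def)
      also have "\<dots> \<le> \<epsilon> / 2 + c * (\<integral>x. u (T t x) \<partial>M)" by (rule c(2)[OF uT])
      also have "(\<integral>x. u (T t x) \<partial>M) = (\<integral>x. u x \<partial>M)"
        using u by (intro integral_T) (auto simp: unit_valued_def)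
      finally show ?thesis .
    qed
    with c(1) show ?thesis by blast
  qed
  from *[OF p_measurable p_ac] *[OF q_measurable q_ac] obtain c d where
    cd: "c > 0" "d > 0"
    and c: "\<And>u t. unit_valued M u \<Longrightarrow> (\<integral>w. u (T t (p w)) \<partial>P) \<le> \<epsilon> / 2 + c * (\<integral>x. u x \<partial>M)"
    and d: "\<And>u t. unit_valued M u \<Longrightarrow> (\<integral>w. u (T t (q w)) \<partial>P) \<le> \<epsilon> / 2 + d * (\<integral>x. u x \<partial>M)"
    by blast
  show ?thesis
  proof (intro exI[of _ "c + d"] conjI allI impI)
    show "0 < c + d" using cd by simp
    fix u t assume "unit_valued M u"
    from c[OF this, of t] d[OF this, of t]
    show "(\<integral>w. u (T t (p w)) \<partial>P) + (\<integral>w. u (T t (q w)) \<partial>P) \<le> \<epsilon> + (c + d) * (\<integral>x. u x \<partial>M)"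
      by (simp add: distrib_right)
  qed
qed

text \<open>
  The convergence takes place in \<open>L\<^sup>1(M)\<close>, and \<open>leaf_integral_bound\<close> carries it over to the pairs
  uniformly in time, so that the limits in \<open>k\<close> and in \<open>t\<close> can be interchanged.
\<close>

lemma asymptotic_limit:
  assumes hk: "\<And>k::nat. unit_valued M (h k)" "\<And>k. asymptotic (h k)"
    and h: "unit_valued M g"
    and lim: "\<And>x. x \<in> space M \<Longrightarrow> (\<lambda>k. h k x) \<longlonglongrightarrow> g x"
  shows "asymptotic g"
  unfolding asymptotic_def
proof (intro ballI tendstoI)
  fix D and e :: real assume D: "D \<in> sets P" and "e > 0"
  then obtain c where c: "c > 0" and bound: "\<And>u t. unit_valued M u \<Longrightarrow>
    (\<integral>w. u (T t (p w)) \<partial>P) + (\<integral>w. u (T t (q w)) \<partial>P) \<le> e / 3 + c * (\<integral>x. u x \<partial>M)"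
    using leaf_integral_bound[of "e / 3"] by auto
  have u: "unit_valued M (\<lambda>x. \<bar>h k x - g x\<bar>)" for k
    using hk(1)[of k] h by (auto simp: unit_valued_def abs_le_iff add_increasing2 diff_le_eq)
  have "(\<lambda>k. \<integral>x. \<bar>h k x - g x\<bar> \<partial>M) \<longlonglongrightarrow> (\<integral>x. 0 \<partial>M)"
  proof (rule integral_dominated_convergence[where w = "\<lambda>_. 1"])
    show "AE x in M. (\<lambda>k. \<bar>h k x - g x\<bar>) \<longlonglongrightarrow> 0"
      using lim by (intro AE_I2) (metis LIM_zero tendsto_rabs_zero)
  qed (use u in \<open>auto simp: unit_valued_def\<close>)
  then have "\<forall>\<^sub>F k in sequentially. (\<integral>x. \<bar>h k x - g x\<bar> \<partial>M) < e / (3 * c)"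
    using \<open>e > 0\<close> c by (intro order_tendstoD(2)) auto
  then obtain k where "(\<integral>x. \<bar>h k x - g x\<bar> \<partial>M) < e / (3 * c)" by (auto simp: eventually_sequentially)
  then have k: "c * (\<integral>x. \<bar>h k x - g x\<bar> \<partial>M) < e / 3" using c by (simp add: field_simps)
  let ?I = "\<lambda>h t. \<integral>w. indicator D w * (h (T t (p w)) - h (T t (q w))) \<partial>P"
  have close: "\<bar>?I g t - ?I (h k) t\<bar> < 2 * e / 3" for t
  proof -
    let ?d = "\<lambda>w. indicator D w * (g (T t (p w)) - g (T t (q w)))
       - indicator D w * (h k (T t (p w)) - h k (T t (q w)))"
    have "?I g t - ?I (h k) t = (\<integral>w. ?d w \<partial>P)"
      using D h hk(1) by (simp add: integrable_leaf_diff)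
    also have "\<bar>\<dots>\<bar> \<le> (\<integral>w. \<bar>h k (T t (p w)) - g (T t (p w))\<bar> + \<bar>h k (T t (q w)) - g (T t (q w))\<bar> \<partial>P)"
    proof (rule order_trans[OF integral_abs_bound integral_mono])
      show "integrable P (\<lambda>w. \<bar>?d w\<bar>)"
        using D h hk(1) by (intro integrable_abs Bochner_Integration.integrable_diff integrable_leaf_diff)
      show "integrable P (\<lambda>w. \<bar>h k (T t (p w)) - g (T t (p w))\<bar> + \<bar>h k (T t (q w)) - g (T t (q w))\<bar>)"
        using unit_valued_leaf[OF u[of k], of t]
        by (intro Bochner_Integration.integrable_add integrable_unit_valued P.finite_measure_axioms)
    qed (auto simp: indicator_def)
    also have "\<dots> = (\<integral>w. \<bar>h k (T t (p w)) - g (T t (p w))\<bar> \<partial>P) + (\<integral>w. \<bar>h k (T t (q w)) - g (T t (q w))\<bar> \<partial>P)"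
      using unit_valued_leaf[OF u[of k], of t]
      by (intro Bochner_Integration.integral_add integrable_unit_valued P.finite_measure_axioms)
    also have "\<dots> < 2 * e / 3"
      using bound[OF u[of k], of t] k by simp
    finally show ?thesis .
  qed
  have "\<forall>\<^sub>F t in at_top. dist (?I (h k) t) 0 < e / 3"
    using hk(2)[of k] D \<open>e > 0\<close> unfolding asymptotic_def by (intro tendstoD) auto
  then show "\<forall>\<^sub>F t in at_top. dist (?I g t) 0 < e"
  proof eventually_elim
    case (elim t)
    then show ?case using close[of t] unfolding dist_real_def by linarith
  qed
qed

lemma asymptotic_const: "asymptotic (\<lambda>_. c)"
  by (simp add: asymptotic_def)

lemma asymptotic_cong_diff:
  assumes "asymptotic f" "\<And>x y. x \<in> space M \<Longrightarrow> y \<in> space M \<Longrightarrow> f x - f y = g x - g y"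
  shows "asymptotic g"
proof -
  have "(\<integral>w. indicator D w * (f (T t (p w)) - f (T t (q w))) \<partial>P)
      = (\<integral>w. indicator D w * (g (T t (p w)) - g (T t (q w))) \<partial>P)" for D t
    by (rule Bochner_Integration.integral_cong)
      (auto simp: assms(2) T_space measurable_space[OF p_measurable] measurable_space[OF q_measurable])
  then show ?thesis using assms(1) by (simp add: asymptotic_def)
qed

lemma asymptotic_scale:
  assumes "asymptotic f"
  shows "asymptotic (\<lambda>x. c * f x)"
  unfolding asymptotic_def
proof
  fix D assume "D \<in> sets P"
  then have "((\<lambda>t. c * (\<integral>w. indicator D w * (f (T t (p w)) - f (T t (q w))) \<partial>P)) \<longlongrightarrow> 0) at_top"
    using assms unfolding asymptotic_def by (intro tendsto_mult_right_zero) auto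
  moreover have "c * (\<integral>w. indicator D w * (f (T t (p w)) - f (T t (q w))) \<partial>P) =
     (\<integral>w. indicator D w * (c * f (T t (p w)) - c * f (T t (q w))) \<partial>P)" for t
    by (subst integral_mult_right_zero[symmetric]) (simp add: algebra_simps)
  ultimately show "((\<lambda>t. \<integral>w. indicator D w * (c * f (T t (p w)) - c * f (T t (q w))) \<partial>P) \<longlongrightarrow> 0) at_top"
    by simp
qed

lemma asymptotic_sum:
  assumes "\<And>j. j \<in> J \<Longrightarrow> asymptotic (f j)" "\<And>j. j \<in> J \<Longrightarrow> unit_valued M (f j)"
    and fin: "finite J"
  shows "asymptotic (\<lambda>x. \<Sum>j\<in>J. f j x)"
  unfolding asymptotic_def
proof
  fix D assume D: "D \<in> sets P"
  have "(\<integral>w. indicator D w * ((\<Sum>j\<in>J. f j (T t (p w))) - (\<Sum>j\<in>J. f j (T t (q w)))) \<partial>P)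
    = (\<Sum>j\<in>J. \<integral>w. indicator D w * (f j (T t (p w)) - f j (T t (q w))) \<partial>P)" for t
    unfolding sum_subtractf[symmetric] sum_distrib_left
    by (rule Bochner_Integration.integral_sum) (rule integrable_leaf_diff[OF D assms(2)])
  moreover have "((\<lambda>t. \<Sum>j\<in>J. \<integral>w. indicator D w * (f j (T t (p w)) - f j (T t (q w))) \<partial>P) \<longlongrightarrow> 0) at_top"
    using assms(1) D unfolding asymptotic_def by (intro tendsto_null_sum) auto
  ultimately show "((\<lambda>t. \<integral>w. indicator D w * ((\<Sum>j\<in>J. f j (T t (p w))) - (\<Sum>j\<in>J. f j (T t (q w)))) \<partial>P)
    \<longlongrightarrow> 0) at_top" by simp
qed

text \<open>
  Sets with asymptotic indicators form a Dynkin system, by \<open>asymptotic_limit\<close>; functions follow by the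
  staircase approximation.
\<close>

lemma asymptotic_of_generator:
  assumes gen: "sets M = sigma_sets (space M) \<O>" "Int_stable \<O>" "\<O> \<subseteq> Pow (space M)"
    and open_asym: "\<And>W. W \<in> \<O> \<Longrightarrow> asymptotic (indicator W)"
    and g: "unit_valued M g"
  shows "asymptotic g"
proof -
  have ind: "asymptotic (indicator E)" if "E \<in> sigma_sets (space M) \<O>" for E
    using gen(2,3) that
  proof (induction rule: sigma_sets_induct_disjoint)
    case (basic W) then show ?case by (rule open_asym)
  next
    case empty
    have "indicator {} = (\<lambda>_::'a. 0::real)" by auto
    then show ?case using asymptotic_const[of 0] by simp
  next
    case (compl E)
    have "asymptotic (\<lambda>x. - 1 * indicator E x)" by (rule asymptotic_scale) (rule compl)
    then show ?case
      by (rule asymptotic_cong_diff) (auto simp: indicator_def)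
  next
    case (union A)
    then have A: "A i \<in> sets M" for i using gen(1) by auto
    have eq: "(\<Sum>i<n. indicator (A i) x) = (indicator (\<Union>i<n. A i) x :: real)" for n x
      using union(1) by (subst indicator_UN_disjoint) (auto simp: disjoint_family_on_def)
    show ?case
    proof (rule asymptotic_limit[where h = "\<lambda>n x. \<Sum>i<n. indicator (A i) x"])
      show "unit_valued M (\<lambda>x. \<Sum>i<n. indicator (A i) x)" for n
        unfolding eq using A by (intro unit_valued_indicator) auto
      show "asymptotic (\<lambda>x. \<Sum>i<n. indicator (A i) x)" for n
        using union A by (intro asymptotic_sum unit_valued_indicator) auto
      show "unit_valued M (indicator (\<Union>i. A i))"
        using A by (intro unit_valued_indicator) auto
      show "(\<lambda>n. \<Sum>i<n. indicator (A i) x) \<longlonglongrightarrow> (indicator (\<Union>i. A i) x :: real)" for x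
        unfolding eq by (rule LIMSEQ_indicator_UN)
    qed
  qed
  show ?thesis
  proof (rule asymptotic_limit[where h = "\<lambda>n x. \<Sum>j<n. indicator {y. real (Suc j) / real n \<le> y} (g x) / real n"])
    have E: "{x\<in>space M. real (Suc j) / real n \<le> g x} \<in> sets M" for j n
      using unit_valuedD(1)[OF g] by measurable
    have ind': "asymptotic (\<lambda>x. indicator {y. real (Suc j) / real n \<le> y} (g x))" for j n
    proof -
      have "asymptotic (indicator {x\<in>space M. real (Suc j) / real n \<le> g x})"
        using E ind gen(1) by auto
      then show ?thesis
        by (rule asymptotic_cong_diff) (auto simp: indicator_def)
    qed
    have m: "(\<lambda>x. indicator {y. real (Suc j) / real n \<le> y} (g x) :: real) \<in> borel_measurable M" for j n
      using unit_valuedD(1)[OF g] by measurable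
    show "asymptotic (\<lambda>x. \<Sum>j<n. indicator {y. real (Suc j) / real n \<le> y} (g x) / real n)" for n
    proof (rule asymptotic_sum)
      fix j
      show "asymptotic (\<lambda>x. indicator {y. real (Suc j) / real n \<le> y} (g x) / real n)"
        using asymptotic_scale[OF ind', of "1 / real n" j n] by simp
      show "unit_valued M (\<lambda>x. indicator {y. real (Suc j) / real n \<le> y} (g x) / real n)"
        using m[of j n] by (cases "n = 0") (auto simp: unit_valued_def indicator_def)
    qed simp
    show "unit_valued M (\<lambda>x. \<Sum>j<n. indicator {y. real (Suc j) / real n \<le> y} (g x) / real n)" for n
    proof -
      have "(\<Sum>j<n. indicator {y. real (Suc j) / real n \<le> y} (g x) / real n) \<le> (\<Sum>j<n. 1 / real n)" for x
        by (intro sum_mono divide_right_mono) (auto simp: indicator_def)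
      also have "\<dots> \<le> 1" by simp
      finally have "(\<Sum>j<n. indicator {y. real (Suc j) / real n \<le> y} (g x) / real n) \<le> 1" for x .
      moreover have "(\<lambda>x. \<Sum>j<n. indicator {y. real (Suc j) / real n \<le> y} (g x) / real n) \<in> borel_measurable M"
        using m by (intro borel_measurable_sum borel_measurable_divide) auto
      ultimately show ?thesis by (auto simp: unit_valued_def intro!: sum_nonneg)
    qed
    show "(\<lambda>n. \<Sum>j<n. indicator {y. real (Suc j) / real n \<le> y} (g x) / real n) \<longlonglongrightarrow> g x" for x
      using unit_valuedD(2,3)[OF g] by (rule tendsto_staircase)
  qed (rule g)
qed

text \<open>
  Averaging \<open>u \<circ> p\<close> over a set of pairs amounts to integrating \<open>u\<close> against an \<open>M\<close>-integrable density,
  so the averages of \<open>h \<circ> T\<^sub>t\<close> over the points \<open>p w\<close> and \<open>q w\<close> converge to those of \<open>g\<close>. Their difference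
  tends to \<open>0\<close>.
\<close>

lemma weak_limit_leaf_invariant:
  assumes F: "F \<noteq> bot" "F \<le> at_top" and h: "unit_valued M h" "asymptotic h"
    and g: "weak_limit M F (\<lambda>t x. h (T t x)) g"
  shows "AE w in P. g (p w) = g (q w)"
proof -
  have push: "((\<lambda>t. \<integral>w. indicator D w * h (T t (f w)) \<partial>P) \<longlongrightarrow> (\<integral>w. indicator D w * g (f w) \<partial>P)) F"
    if f[measurable]: "f \<in> measurable P M" and ac: "absolutely_continuous M (distr P M f)"
      and D[measurable]: "D \<in> sets P" for f D
  proof -
    define N where "N = distr (density P (indicator D)) M f"
    have "finite_measure (density P (indicator D))"
      by (rule finite_measureI) (simp add: emeasure_density P.emeasure_finite)
    then have finN: "finite_measure N"
      unfolding N_def by (rule finite_measure.finite_measure_distr) (simp add: f)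
    have setsN: "sets N = sets M" by (simp add: N_def)
    have acN: "absolutely_continuous M N"
      unfolding absolutely_continuous_def
    proof
      fix E assume "E \<in> null_sets M"
      then have E: "E \<in> sets M" "emeasure P (f -` E \<inter> space P) = 0"
        using ac by (auto simp: absolutely_continuous_def null_sets_def emeasure_distr)
      note [measurable] = E(1)
      have "emeasure N E = emeasure (density P (indicator D)) (f -` E \<inter> space P)"
        by (simp add: N_def emeasure_distr)
      also have "\<dots> = (\<integral>\<^sup>+w. indicator D w * indicator (f -` E \<inter> space P) w \<partial>P)"
        by (rule emeasure_density) auto
      also have "\<dots> \<le> (\<integral>\<^sup>+w. indicator (f -` E \<inter> space P) w \<partial>P)"
        by (rule nn_integral_mono) (auto simp: indicator_def)
      also have "\<dots> = 0" using E by simp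
      finally show "E \<in> null_sets N" using E(1) by (auto simp: null_sets_def setsN)
    qed
    obtain R where R: "R \<in> borel_measurable M" "\<And>x. 0 \<le> R x"
      and dens: "density M (\<lambda>x. ennreal (R x)) = N" and intR: "integrable M R"
      using integrable_density_exists[OF finite_measure_axioms finN acN setsN] by blast
    have eq: "(\<integral>w. indicator D w * u (f w) \<partial>P) = (\<integral>x. u x * R x \<partial>M)" if "unit_valued M u" for u
    proof -
      have [measurable]: "u \<in> borel_measurable M" using that by (simp add: unit_valued_def)
      have "(\<integral>x. u x * R x \<partial>M) = (\<integral>x. u x \<partial>density M (\<lambda>x. ennreal (R x)))"
        using R by (subst integral_density) (auto simp: mult.commute)
      also have "\<dots> = (\<integral>x. u x \<partial>N)" by (simp add: dens)
      also have "\<dots> = (\<integral>w. u (f w) \<partial>density P (\<lambda>w. ennreal (indicator D w)))"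
        unfolding N_def by (subst integral_distr) (auto simp: ennreal_indicator)
      also have "\<dots> = (\<integral>w. indicator D w * u (f w) \<partial>P)"
        by (subst integral_density) auto
      finally show ?thesis by simp
    qed
    show ?thesis
      unfolding eq[OF unit_valued_T[OF h(1)]] eq[OF weak_limitD(1)[OF g]]
      by (rule weak_limitD(2)[OF g intR])
  qed
  have iD: "integrable P (\<lambda>w. indicator D w * v w)" if "D \<in> sets P" "unit_valued P v" for D v
    using integrable_mult_indicator[OF that(1) integrable_unit_valued[OF P.finite_measure_axioms that(2)]]
    by simp
  note ug = weak_limitD(1)[OF g]
  note up = unit_valued_compose[OF ug p_measurable] and uq = unit_valued_compose[OF ug q_measurable]
  show ?thesis
  proof (rule AE_eq_of_set_integrals[OF P.finite_measure_axioms up uq])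
    fix D assume D: "D \<in> sets P"
    have "((\<lambda>t. \<integral>w. indicator D w * (h (T t (p w)) - h (T t (q w))) \<partial>P)
       \<longlongrightarrow> (\<integral>w. indicator D w * g (p w) \<partial>P) - (\<integral>w. indicator D w * g (q w) \<partial>P)) F"
      using tendsto_diff[OF push[OF p_measurable p_ac D] push[OF q_measurable q_ac D]]
        iD[OF D unit_valued_leaf(1)[OF h(1)]] iD[OF D unit_valued_leaf(2)[OF h(1)]]
      by (simp add: right_diff_distrib)
    moreover have "((\<lambda>t. \<integral>w. indicator D w * (h (T t (p w)) - h (T t (q w))) \<partial>P) \<longlongrightarrow> 0) F"
      using h(2) D F(2) unfolding asymptotic_def by (blast intro: tendsto_mono)
    ultimately show "(\<integral>w. g (p w) * indicator D w \<partial>P) = (\<integral>w. g (q w) * indicator D w \<partial>P)"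
      using tendsto_unique[OF F(1)] by (fastforce simp: mult.commute)
  qed
qed

end


section \<open>Escaping sequences in a convergence group\<close>

lemma injective_subsequence:
  fixes g :: "nat \<Rightarrow> 'a"
  assumes "infinite (range g)"
  shows "\<exists>r::nat \<Rightarrow> nat. strict_mono r \<and> inj (\<lambda>n. g (r n))"
proof -
  define S where "S = {n. \<forall>k<n. g k \<noteq> g n}"
  have "range g \<subseteq> g ` S"
  proof
    fix y assume "y \<in> range g"
    then have ex: "\<exists>n. g n = y" by auto
    define n where "n = (LEAST n. g n = y)"
    have "g n = y" unfolding n_def using ex by (rule LeastI_ex)
    moreover have "g k \<noteq> y" if "k < n" for k
      using not_less_Least that unfolding n_def by blast
    ultimately show "y \<in> g ` S" by (auto simp: S_def)
  qed
  then have "infinite S" using assms finite_surj by blast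
  have "inj_on g S"
    by (intro linorder_inj_onI) (auto simp: S_def)
  then have "inj (\<lambda>n. g (enumerate S n))"
    using enumerate_in_set[OF \<open>infinite S\<close>] strict_mono_eq[OF strict_mono_enumerate[OF \<open>infinite S\<close>]]
    by (intro injI) (simp add: inj_on_eq_iff)
  then show ?thesis using strict_mono_enumerate[OF \<open>infinite S\<close>] by blast
qed

lemma infinite_range_if_filterlim:
  fixes f :: "nat \<Rightarrow> real"
  assumes "filterlim f at_top sequentially \<or> filterlim f at_bot sequentially" "\<And>n. f n = h (g n)"
  shows "infinite (range g)"
proof
  assume "finite (range g)"
  then have "finite (range f)" using assms(2) finite_surj[of "range g" "range f" h] by auto
  then obtain B where B: "\<And>n. \<bar>f n\<bar> \<le> B"
    using finite_imp_bounded[of "range f"] unfolding bounded_iff by auto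
  have "\<forall>\<^sub>F n in sequentially. B < f n \<or> f n < - B"
    using assms(1) unfolding filterlim_at_top_dense filterlim_at_bot_dense
    by (auto elim: eventually_mono)
  then obtain n where "B < f n \<or> f n < - B" by (auto simp: eventually_sequentially)
  with B[of n] show False by auto
qed

lemma loc_unif_conv_tendsto:
  assumes conv: "loc_unif_conv d S f x" and z: "z \<in> S" and zs: "\<forall>\<^sub>F n in sequentially. zs n \<in> S"
    and lim: "(\<lambda>n. d z (zs n)) \<longlonglongrightarrow> 0" and nn: "\<And>n. 0 \<le> d (f n (zs n)) x"
  shows "(\<lambda>n. d (f n (zs n)) x) \<longlonglongrightarrow> (0::real)"
proof (rule tendstoI)
  fix e :: real assume "e > 0"
  obtain r where r: "r > 0" "\<And>e. e > 0 \<Longrightarrow> \<forall>\<^sub>F n in sequentially. \<forall>w\<in>S. d z w < r \<longrightarrow> d (f n w) x < e"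
    using conv z unfolding loc_unif_conv_def by blast
  have "\<forall>\<^sub>F n in sequentially. d z (zs n) < r" using lim r(1) by (rule order_tendstoD(2))
  with r(2)[OF \<open>e > 0\<close>] zs show "\<forall>\<^sub>F n in sequentially. dist (d (f n (zs n)) x) 0 < e"
    by eventually_elim (use nn in auto)
qed

lemma loc_unif_conv_subseq:
  assumes "loc_unif_conv d S f x" "strict_mono r"
  shows "loc_unif_conv d S (\<lambda>n. f (r n)) x"
  unfolding loc_unif_conv_def
proof
  fix z assume "z \<in> S"
  then obtain q where "q > 0" "\<And>e. e > 0 \<Longrightarrow> \<forall>\<^sub>F n in sequentially. \<forall>w\<in>S. d z w < q \<longrightarrow> d (f n w) x < e"
    using assms(1) unfolding loc_unif_conv_def by blast
  then show "\<exists>q>0. \<forall>e>0. \<forall>\<^sub>F n in sequentially. \<forall>w\<in>S. d z w < q \<longrightarrow> d (f (r n) w) x < e"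
    using eventually_subseq[OF assms(2)] by (intro exI[of _ q]) blast
qed

text \<open>
  On a compact space this is locally uniform convergence of \<open>g\<close> to \<open>a\<close> off \<open>b\<close>, put in a form that can
  be applied to moving points.
\<close>

definition collapses :: "(nat \<Rightarrow> 'm \<Rightarrow> 'm) \<Rightarrow> 'm::topological_space \<Rightarrow> 'm \<Rightarrow> bool" where
  "collapses g a b \<longleftrightarrow> (\<forall>zs z. zs \<longlonglongrightarrow> z \<longrightarrow> z \<noteq> b \<longrightarrow> (\<lambda>n. g n (zs n)) \<longlonglongrightarrow> a)"

text \<open>
  The dynamics of \<open>\<Gamma>\<close> on \<open>\<Gamma> \<squnion> M\<close> is part of \<open>compactification_metric\<close>. Finiteness of the critical
  exponent is used in the form that sublevel sets of the magnitude are finite.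
\<close>

locale expanding_convergence_group =
  fixes \<Gamma> :: "('m::metric_space \<Rightarrow> 'm) set"
    and d :: "('m \<Rightarrow> 'm) + 'm \<Rightarrow> ('m \<Rightarrow> 'm) + 'm \<Rightarrow> real"
    and \<sigma> :: "('m \<Rightarrow> 'm) \<Rightarrow> 'm \<Rightarrow> real"
    and N :: "('m \<Rightarrow> 'm) \<Rightarrow> real"
  assumes compact_M: "compact (UNIV :: 'm set)"
    and homeo: "homeo_group \<Gamma>"
    and three: "non_elementary \<Gamma>"
    and compactif: "compactification_metric \<Gamma> d"
    and cocycle: "continuous_cocycle \<Gamma> \<sigma>"
    and magn: "magnitude \<Gamma> d \<sigma> N"
    and finite_sublevel: "finite {\<gamma>\<in>\<Gamma>. N \<gamma> \<le> R}"
begin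

lemma id_in: "id \<in> \<Gamma>" and comp_in: "\<alpha> \<in> \<Gamma> \<Longrightarrow> \<beta> \<in> \<Gamma> \<Longrightarrow> \<alpha> \<circ> \<beta> \<in> \<Gamma>"
  and inv_in: "\<gamma> \<in> \<Gamma> \<Longrightarrow> inv \<gamma> \<in> \<Gamma>"
  using homeo by (auto simp: homeo_group_def)

lemma bij_elem: "\<gamma> \<in> \<Gamma> \<Longrightarrow> bij \<gamma>"
  using homeo homeomorphic_imp_injective_map[of euclidean euclidean \<gamma>]
    homeomorphic_imp_surjective_map[of euclidean euclidean \<gamma>]
  by (auto simp: homeo_group_def bij_def)

lemma continuous_elem: "\<gamma> \<in> \<Gamma> \<Longrightarrow> continuous_on UNIV \<gamma>"
  using homeo homeomorphic_imp_continuous_map[of euclidean euclidean \<gamma>]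
  by (auto simp: homeo_group_def)

lemma tendsto_elem: "\<gamma> \<in> \<Gamma> \<Longrightarrow> (f \<longlongrightarrow> l) F \<Longrightarrow> ((\<lambda>x. \<gamma> (f x)) \<longlongrightarrow> \<gamma> l) F"
  using continuous_on_tendsto_compose[OF continuous_elem, of \<gamma> f l F] by simp

lemma inv_elem [simp]:
  assumes "\<gamma> \<in> \<Gamma>"
  shows "\<gamma> (inv \<gamma> x) = x" "inv \<gamma> (\<gamma> x) = x" "inv (inv \<gamma>) = \<gamma>"
    "\<gamma> \<circ> inv \<gamma> = id" "inv \<gamma> \<circ> \<gamma> = id"
proof -
  have "inj \<gamma>" "surj \<gamma>" "bij \<gamma>" using bij_elem[OF assms] by (auto simp: bij_def)
  then show "\<gamma> (inv \<gamma> x) = x" "inv \<gamma> (\<gamma> x) = x" "inv (inv \<gamma>) = \<gamma>"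
    "\<gamma> \<circ> inv \<gamma> = id" "inv \<gamma> \<circ> \<gamma> = id"
    by (simp_all add: surj_f_inv_f inv_inv_eq surj_iff[THEN iffD1])
qed

lemma countable_group: "countable \<Gamma>"
proof -
  have "\<Gamma> \<subseteq> (\<Union>n. {\<gamma>\<in>\<Gamma>. N \<gamma> \<le> real n})" using real_arch_simple by auto
  then show ?thesis
    using finite_sublevel by (meson countable_UN countable_finite countable_subset countableI_type)
qed

lemma cocycle_comp: "\<alpha> \<in> \<Gamma> \<Longrightarrow> \<beta> \<in> \<Gamma> \<Longrightarrow> \<sigma> (\<alpha> \<circ> \<beta>) x = \<sigma> \<alpha> (\<beta> x) + \<sigma> \<beta> x"
  using cocycle by (auto simp: continuous_cocycle_def)

lemma cocycle_id: "\<sigma> id x = 0"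
  using cocycle_comp[OF id_in id_in, of x] by simp

lemma cocycle_inv: "\<gamma> \<in> \<Gamma> \<Longrightarrow> \<sigma> (inv \<gamma>) (\<gamma> x) = - \<sigma> \<gamma> x"
  using cocycle_comp[OF inv_in, of \<gamma> \<gamma> x] by (simp add: cocycle_id)

lemma cocycle_continuous: "\<gamma> \<in> \<Gamma> \<Longrightarrow> continuous_on UNIV (\<sigma> \<gamma>)"
  using cocycle by (auto simp: continuous_cocycle_def)

abbreviation "A \<equiv> Inl ` \<Gamma> \<union> range Inr :: (('m \<Rightarrow> 'm) + 'm) set"
abbreviation "act \<gamma> \<equiv> map_sum ((\<circ>) \<gamma>) \<gamma> :: ('m \<Rightarrow> 'm) + 'm \<Rightarrow> ('m \<Rightarrow> 'm) + 'm"

sublocale A: Metric_space A d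
  using compactif by (simp add: compactification_metric_def Let_def)

lemma tendsto_Inr_iff: "(\<lambda>n. d (Inr (zs n)) (Inr z)) \<longlonglongrightarrow> 0 \<longleftrightarrow> zs \<longlonglongrightarrow> z"
proof -
  have emb: "homeomorphic_map euclidean (subtopology A.mtopology (range Inr)) (Inr :: 'm \<Rightarrow> _)"
    using compactif by (simp add: compactification_metric_def Let_def embedding_map_def)
  then obtain g where g: "homeomorphic_maps euclidean (subtopology A.mtopology (range Inr)) Inr g"
    by (auto simp: homeomorphic_map_maps)
  then have cont: "continuous_map (subtopology A.mtopology (range Inr)) euclidean g"
    and inv: "\<And>x. g (Inr x) = x"
    by (auto simp: homeomorphic_maps_def)
  have "limitin (subtopology A.mtopology (range Inr)) (\<lambda>n. Inr (zs n)) (Inr z) sequentially \<longleftrightarrow> zs \<longlonglongrightarrow> z"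
  proof
    assume "limitin (subtopology A.mtopology (range Inr)) (\<lambda>n. Inr (zs n)) (Inr z) sequentially"
    from continuous_map_limit[OF cont this] show "zs \<longlonglongrightarrow> z" by (simp add: comp_def inv)
  next
    assume "zs \<longlonglongrightarrow> z"
    then have "limitin euclidean zs z sequentially" by simp
    from continuous_map_limit[OF homeomorphic_imp_continuous_map[OF emb] this]
    show "limitin (subtopology A.mtopology (range Inr)) (\<lambda>n. Inr (zs n)) (Inr z) sequentially"
      by (simp add: comp_def)
  qed
  then show ?thesis
    by (simp add: limitin_subtopology A.limitin_metric_dist_null)
qed

lemma d_limit_unique:
  assumes "(\<lambda>n::nat. d (f n) x) \<longlonglongrightarrow> 0" "(\<lambda>n. d (f n) y) \<longlonglongrightarrow> 0" "\<And>n. f n \<in> A" "x \<in> A" "y \<in> A"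
  shows "x = y"
proof -
  have "(\<lambda>n. d (f n) x + d (f n) y) \<longlonglongrightarrow> 0 + 0" using assms(1,2) by (rule tendsto_add)
  then have "d x y \<le> 0 + 0"
    by (rule tendsto_lowerbound)
      (use assms A.triangle'' in \<open>auto intro!: always_eventually simp del: Un_iff\<close>)
  then show ?thesis using assms(4,5) A.nonneg[of x y] by (simp del: Un_iff)
qed

lemma act_closed: "\<gamma> \<in> \<Gamma> \<Longrightarrow> z \<in> A \<Longrightarrow> act \<gamma> z \<in> A"
  by (auto simp: comp_in)

lemma act_inv: "\<gamma> \<in> \<Gamma> \<Longrightarrow> act \<gamma> (act (inv \<gamma>) z) = z"
  by (cases z) (auto simp: fun_eq_iff)

lemma act_conv:
  assumes "loc_unif_conv d (A - {q}) (\<lambda>n. act (g n)) p" "\<And>n. g n \<in> \<Gamma>" "p \<in> A" "q \<in> A"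
    and "\<And>n. zs n \<in> A" "z \<in> A" "z \<noteq> q" and lim: "(\<lambda>n. d (zs n) z) \<longlonglongrightarrow> 0"
  shows "(\<lambda>n. d (act (g n) (zs n)) p) \<longlonglongrightarrow> 0"
proof (rule loc_unif_conv_tendsto[OF assms(1), of z zs])
  have "0 < d z q" using assms(4,6,7) by (intro A.mdist_pos_less)
  then have "\<forall>\<^sub>F n in sequentially. d (zs n) z < d z q" using lim by (intro order_tendstoD(2))
  then show "\<forall>\<^sub>F n in sequentially. zs n \<in> A - {q}"
  proof eventually_elim
    case (elim n)
    then have "zs n \<noteq> q" using A.commute[of q z] by (intro notI) simp
    then show ?case using assms(5)[of n] by simp
  qed
  show "(\<lambda>n. d z (zs n)) \<longlonglongrightarrow> 0" using lim unfolding A.commute[of z] .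
  show "z \<in> A - {q}" using assms(6,7) by simp
  show "0 \<le> d (act (g n) (zs n)) p" for n by (rule A.nonneg)
qed

lemma three_points: "\<exists>z::'m. z \<noteq> x \<and> z \<noteq> y"
proof -
  obtain S where "S \<subseteq> limit_set \<Gamma>" "card S = 3" using three by (auto simp: non_elementary_def)
  then have "\<not> S \<subseteq> {x, y}"
    using card_mono[of "{x, y}" S] card_insert_le_m1[of 2 "{y}" x] by force
  then show ?thesis by auto
qed

text \<open>
  If the attracting point \<open>p'\<close> of the inverses were different from the repelling point \<open>q\<close>, then
  \<open>g\<^sub>n\<close> would take \<open>g\<^sub>n\<^sup>-\<^sup>1 z \<rightarrow> p'\<close> to points converging to \<open>p\<close>. But these points are all equal to \<open>z\<close>.
\<close>

lemma act_limits_swap: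
  assumes 1: "loc_unif_conv d (A - {q}) (\<lambda>n. act (g n)) p" "p \<in> A" "q \<in> A"
    and 2: "loc_unif_conv d (A - {q'}) (\<lambda>n. act (inv (g n))) p'" "p' \<in> A" "q' \<in> A"
    and g: "\<And>n. g n \<in> \<Gamma>"
  shows "p' = q"
proof (rule ccontr)
  assume "p' \<noteq> q"
  have "\<exists>z\<in>A. z \<noteq> q' \<and> z \<noteq> p"
  proof -
    obtain z0 where z0: "Inr z0 \<noteq> q'" "Inr z0 \<noteq> p"
      using three_points[of "case q' of Inr x \<Rightarrow> x | _ \<Rightarrow> undefined" "case p of Inr x \<Rightarrow> x | _ \<Rightarrow> undefined"]
      by (cases q'; cases p) auto
    then show ?thesis by (intro bexI[of _ "Inr z0"]) auto
  qed
  then obtain z where z: "z \<in> A" "z \<noteq> q'" "z \<noteq> p" by blast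
  have "(\<lambda>n. d z z) \<longlonglongrightarrow> 0" using z by simp
  from act_conv[OF 2(1) inv_in[OF g] 2(2,3) z(1) z(1,2) this]
  have "(\<lambda>n. d (act (inv (g n)) z) p') \<longlonglongrightarrow> 0" .
  from act_conv[OF 1(1) g 1(2,3) _ 2(2) \<open>p' \<noteq> q\<close> this] act_closed[OF inv_in[OF g] z(1)]
  have "(\<lambda>n. d (act (g n) (act (inv (g n)) z)) p) \<longlonglongrightarrow> 0" by blast
  then have "(\<lambda>n::nat. d z p) \<longlonglongrightarrow> 0" by (simp only: act_inv[OF g])
  then have "d z p = 0" by (simp add: LIMSEQ_const_iff)
  then show False using z 1(2) by (simp del: Un_iff)
qed

text \<open>
  The attracting point is a limit of points of \<open>M\<close>, and \<open>M\<close> is compact.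
\<close>

lemma act_limit_in_M:
  assumes "loc_unif_conv d (A - {q}) (\<lambda>n. act (g n)) p" "\<And>n. g n \<in> \<Gamma>" "p \<in> A" "q \<in> A"
  shows "\<exists>a. p = Inr a"
proof -
  obtain z0 where z0: "Inr z0 \<noteq> q"
    using three_points[of "case q of Inr x \<Rightarrow> x | _ \<Rightarrow> undefined"] by (cases q) auto
  have "(\<lambda>n. d (Inr z0) (Inr z0)) \<longlonglongrightarrow> 0" by simp
  from act_conv[OF assms _ _ z0 this]
  have lim: "(\<lambda>n. d (Inr (g n z0)) p) \<longlonglongrightarrow> 0" by simp
  obtain w s where s: "strict_mono (s :: nat \<Rightarrow> nat)" "(\<lambda>n. g (s n) z0) \<longlonglongrightarrow> w"
    using compact_M[unfolded compact_def, rule_format, of "\<lambda>n. g n z0"] by (auto simp: comp_def)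
  have "(\<lambda>n. d (Inr (g (s n) z0)) (Inr w)) \<longlonglongrightarrow> 0" using s(2) by (simp add: tendsto_Inr_iff)
  moreover have "(\<lambda>n. d (Inr (g (s n) z0)) p) \<longlonglongrightarrow> 0"
    using LIMSEQ_subseq_LIMSEQ[OF lim s(1)] by (simp add: comp_def)
  ultimately have "Inr w = p" by (rule d_limit_unique) (use assms in auto)
  then show ?thesis by auto
qed

text \<open>
  What happens along a sequence leaving all finite subsets of \<open>\<Gamma>\<close>, after passing to a subsequence:
  north-south dynamics from \<open>b\<close> to \<open>a\<close>, expansion of the cocycle away from the repelling points of the
  sequence and of its inverse, and convergence to \<open>a\<close> in \<open>\<Gamma> \<squnion> M\<close>.
\<close>

definition escapes :: "(nat \<Rightarrow> 'm \<Rightarrow> 'm) \<Rightarrow> 'm \<Rightarrow> 'm \<Rightarrow> bool" where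
  "escapes g a b \<longleftrightarrow> (\<forall>n. g n \<in> \<Gamma>) \<and> collapses g a b \<and> collapses (\<lambda>n. inv (g n)) b a \<and>
     (\<forall>zs z. zs \<longlonglongrightarrow> z \<longrightarrow> z \<noteq> b \<longrightarrow> filterlim (\<lambda>n. \<sigma> (g n) (zs n)) at_top sequentially) \<and>
     (\<forall>zs z. zs \<longlonglongrightarrow> z \<longrightarrow> z \<noteq> a \<longrightarrow> filterlim (\<lambda>n. \<sigma> (inv (g n)) (zs n)) at_top sequentially) \<and>
     (\<lambda>n. d (Inl (g n)) (Inr a)) \<longlonglongrightarrow> 0"

lemma escapesD:
  assumes "escapes g a b"
  shows "g n \<in> \<Gamma>"
    and "zs \<longlonglongrightarrow> z \<Longrightarrow> z \<noteq> b \<Longrightarrow> (\<lambda>n. g n (zs n)) \<longlonglongrightarrow> a"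
    and "zs \<longlonglongrightarrow> z \<Longrightarrow> z \<noteq> a \<Longrightarrow> (\<lambda>n. inv (g n) (zs n)) \<longlonglongrightarrow> b"
    and "zs \<longlonglongrightarrow> z \<Longrightarrow> z \<noteq> b \<Longrightarrow> filterlim (\<lambda>n. \<sigma> (g n) (zs n)) at_top sequentially"
    and "zs \<longlonglongrightarrow> z \<Longrightarrow> z \<noteq> a \<Longrightarrow> filterlim (\<lambda>n. \<sigma> (inv (g n)) (zs n)) at_top sequentially"
    and "(\<lambda>n. d (Inl (g n)) (Inr a)) \<longlonglongrightarrow> 0"
proof -
  have *: "\<forall>n. g n \<in> \<Gamma>"
    "\<forall>zs z. zs \<longlonglongrightarrow> z \<longrightarrow> z \<noteq> b \<longrightarrow> (\<lambda>n. g n (zs n)) \<longlonglongrightarrow> a"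
    "\<forall>zs z. zs \<longlonglongrightarrow> z \<longrightarrow> z \<noteq> a \<longrightarrow> (\<lambda>n. inv (g n) (zs n)) \<longlonglongrightarrow> b"
    "\<forall>zs z. zs \<longlonglongrightarrow> z \<longrightarrow> z \<noteq> b \<longrightarrow> filterlim (\<lambda>n. \<sigma> (g n) (zs n)) at_top sequentially"
    "\<forall>zs z. zs \<longlonglongrightarrow> z \<longrightarrow> z \<noteq> a \<longrightarrow> filterlim (\<lambda>n. \<sigma> (inv (g n)) (zs n)) at_top sequentially"
    "(\<lambda>n. d (Inl (g n)) (Inr a)) \<longlonglongrightarrow> 0"
    by (insert assms[unfolded escapes_def collapses_def]; elim conjE; assumption)+
  show "g n \<in> \<Gamma>" using *(1) by blast
  show "zs \<longlonglongrightarrow> z \<Longrightarrow> z \<noteq> b \<Longrightarrow> (\<lambda>n. g n (zs n)) \<longlonglongrightarrow> a" by (rule *(2)[rule_format])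
  show "zs \<longlonglongrightarrow> z \<Longrightarrow> z \<noteq> a \<Longrightarrow> (\<lambda>n. inv (g n) (zs n)) \<longlonglongrightarrow> b" by (rule *(3)[rule_format])
  show "zs \<longlonglongrightarrow> z \<Longrightarrow> z \<noteq> b \<Longrightarrow> filterlim (\<lambda>n. \<sigma> (g n) (zs n)) at_top sequentially"
    by (rule *(4)[rule_format])
  show "zs \<longlonglongrightarrow> z \<Longrightarrow> z \<noteq> a \<Longrightarrow> filterlim (\<lambda>n. \<sigma> (inv (g n)) (zs n)) at_top sequentially"
    by (rule *(5)[rule_format])
  show "(\<lambda>n. d (Inl (g n)) (Inr a)) \<longlonglongrightarrow> 0" by (rule *(6))
qed

lemma magnitude_at_top:
  assumes "inj g" "\<And>n::nat. g n \<in> \<Gamma>"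
  shows "filterlim (\<lambda>n. N (g n)) at_top sequentially"
  unfolding filterlim_at_top_dense
proof
  fix R
  have "finite (g -` {\<gamma>\<in>\<Gamma>. N \<gamma> \<le> R})"
    using finite_sublevel assms(1) by (rule finite_vimageI)
  moreover have "g -` {\<gamma>\<in>\<Gamma>. N \<gamma> \<le> R} = {n. \<not> R < N (g n)}" using assms(2) by auto
  ultimately show "\<forall>\<^sub>F n in sequentially. R < N (g n)"
    by (simp add: eventually_cofinite flip: cofinite_eq_sequentially)
qed

text \<open>
  As \<open>g\<^sub>n\<^sup>-\<^sup>1 \<rightarrow> b\<close> in \<open>\<Gamma> \<squnion> M\<close> and \<open>z \<noteq> b\<close>, the points \<open>zs n\<close> stay at a definite distance from \<open>g\<^sub>n\<^sup>-\<^sup>1\<close>.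
  There \<open>\<sigma>(g\<^sub>n, \<cdot>)\<close> differs from the magnitude of \<open>g\<^sub>n\<close> by a bounded amount.
\<close>

lemma cocycle_at_top:
  assumes g: "inj g" "\<And>n::nat. g n \<in> \<Gamma>" and b: "(\<lambda>n. d (Inl (inv (g n))) (Inr b)) \<longlonglongrightarrow> 0"
    and z: "zs \<longlonglongrightarrow> z" "z \<noteq> b"
  shows "filterlim (\<lambda>n. \<sigma> (g n) (zs n)) at_top sequentially"
proof -
  define e where "e = d (Inr z) (Inr b) / 3"
  have "e > 0" using z(2) A.mdist_pos_less[of "Inr z" "Inr b"] by (simp add: e_def)
  then obtain C where C: "C > 0" "\<And>\<gamma> x. \<gamma> \<in> \<Gamma> \<Longrightarrow> d (Inr x) (Inl (inv \<gamma>)) > e \<Longrightarrow> N \<gamma> - C \<le> \<sigma> \<gamma> x"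
    using magn unfolding magnitude_def by blast
  have z': "(\<lambda>n. d (Inr (zs n)) (Inr z)) \<longlonglongrightarrow> 0" using z(1) by (simp add: tendsto_Inr_iff)
  have "\<forall>\<^sub>F n in sequentially. N (g n) - C \<le> \<sigma> (g n) (zs n)"
    using order_tendstoD(2)[OF b \<open>e > 0\<close>] order_tendstoD(2)[OF z' \<open>e > 0\<close>]
  proof eventually_elim
    case (elim n)
    have mem: "Inl (inv (g n)) \<in> A" using g(2) inv_in by auto
    have "d (Inr z) (Inr b) \<le> d (Inr z) (Inr (zs n)) + d (Inr (zs n)) (Inr b)"
      by (rule A.triangle) auto
    moreover have "d (Inr (zs n)) (Inr b) \<le> d (Inr (zs n)) (Inl (inv (g n))) + d (Inl (inv (g n))) (Inr b)"
      by (rule A.triangle) (use mem in auto)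
    moreover have "d (Inr z) (Inr (zs n)) = d (Inr (zs n)) (Inr z)" by (rule A.commute)
    ultimately have "e < d (Inr (zs n)) (Inl (inv (g n)))" using elim unfolding e_def by linarith
    then show ?case by (rule C(2)[OF g(2)])
  qed
  moreover have "filterlim (\<lambda>n. N (g n) - C) at_top sequentially"
    using filterlim_tendsto_add_at_top[OF tendsto_const[of "- C"] magnitude_at_top[OF g]] by simp
  ultimately show ?thesis by (rule filterlim_at_top_mono[rotated])
qed

text \<open>
  The convergence property is applied to \<open>g\<close> and then to its inverses. By \<open>act_limits_swap\<close> the two
  pairs of limit points are exchanged, and evaluating at the point \<open>id\<close> of \<open>\<Gamma>\<close> shows that \<open>g\<^sub>n\<close> and
  \<open>g\<^sub>n\<^sup>-\<^sup>1\<close> themselves converge to them in \<open>\<Gamma> \<squnion> M\<close>.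
\<close>

lemma escaping_subsequence:
  assumes g: "inj g" "\<And>n::nat. g n \<in> \<Gamma>"
  shows "\<exists>r a b. strict_mono r \<and> escapes (\<lambda>n. g (r n)) a b"
proof -
  have ca: "\<exists>x\<in>A. \<exists>y\<in>A. \<exists>r. strict_mono r \<and> loc_unif_conv d (A - {y}) (\<lambda>n. act (h (r n))) x"
    if "inj h" "\<And>n::nat. h n \<in> \<Gamma>" for h
    using compactif that unfolding compactification_metric_def convergence_action_def Let_def by blast
  obtain p q r1 where 1: "p \<in> A" "q \<in> A" "strict_mono r1"
     "loc_unif_conv d (A - {q}) (\<lambda>n. act (g (r1 n))) p"
    using ca[OF g] by blast
  have "inj (\<lambda>n. inv (g (r1 n)))"
  proof (rule injI)
    fix m n assume "inv (g (r1 m)) = inv (g (r1 n))"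
    then have "inv (inv (g (r1 m))) = inv (inv (g (r1 n)))" by simp
    then have "g (r1 m) = g (r1 n)" using g(2) by simp
    then have "r1 m = r1 n" using g(1) by (simp add: inj_eq)
    then show "m = n" using 1(3) by (simp add: strict_mono_eq)
  qed
  from ca[OF this inv_in[OF g(2)]] obtain p' q' r2 where 2: "p' \<in> A" "q' \<in> A" "strict_mono r2"
     "loc_unif_conv d (A - {q'}) (\<lambda>n. act (inv (g (r1 (r2 n))))) p'"
    by blast
  define r where "r n = r1 (r2 n)" for n
  have r: "strict_mono r" unfolding r_def[abs_def] using 1(3) 2(3) by (simp add: strict_mono_def)
  define h where "h n = g (r n)" for n
  have h: "h n \<in> \<Gamma>" for n by (simp add: h_def g)
  have injh: "inj h" unfolding h_def[abs_def] using g(1) r by (metis injD injI strict_mono_eq)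
  have injh': "inj (\<lambda>n. inv (h n))"
  proof (rule injI)
    fix m n assume "inv (h m) = inv (h n)"
    then have "inv (inv (h m)) = inv (inv (h n))" by simp
    then show "m = n" using h injh by (simp add: inj_eq)
  qed
  have c1: "loc_unif_conv d (A - {q}) (\<lambda>n. act (h n)) p"
    using loc_unif_conv_subseq[OF 1(4) 2(3)] by (simp add: h_def r_def)
  have c2: "loc_unif_conv d (A - {q'}) (\<lambda>n. act (inv (h n))) p'"
    using 2(4) by (simp add: h_def r_def)
  have "p' = q" by (rule act_limits_swap[OF c1 1(1,2) c2 2(1,2) h])
  have "p = q'"
    using act_limits_swap[of q' "\<lambda>n. inv (h n)" p' q p] c1 c2 1 2 h by (simp add: inv_in del: Un_iff)
  obtain a where a: "p = Inr a" using act_limit_in_M[OF c1 h 1(1,2)] by blast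
  obtain b where b: "p' = Inr b" using act_limit_in_M[OF c2 inv_in[OF h] 2(1,2)] by blast
  have c1': "loc_unif_conv d (A - {Inr b}) (\<lambda>n. act (h n)) (Inr a)" using c1 a b \<open>p' = q\<close> by simp
  have c2': "loc_unif_conv d (A - {Inr a}) (\<lambda>n. act (inv (h n))) (Inr b)" using c2 a b \<open>p = q'\<close> by simp
  have lim1: "(\<lambda>n. d (Inl (h n)) (Inr a)) \<longlonglongrightarrow> 0"
    using act_conv[OF c1' h, of "\<lambda>_. Inl id" "Inl id"] id_in by simp
  have lim2: "(\<lambda>n. d (Inl (inv (h n))) (Inr b)) \<longlonglongrightarrow> 0"
    using act_conv[OF c2' inv_in[OF h], of "\<lambda>_. Inl id" "Inl id"] id_in by simp
  have col1: "collapses h a b"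
    unfolding collapses_def
  proof (intro allI impI)
    fix zs z assume "zs \<longlonglongrightarrow> z" "z \<noteq> b"
    then show "(\<lambda>n. h n (zs n)) \<longlonglongrightarrow> a"
      using act_conv[OF c1' h, of "\<lambda>n. Inr (zs n)" "Inr z"] by (simp add: tendsto_Inr_iff)
  qed
  have col2: "collapses (\<lambda>n. inv (h n)) b a"
    unfolding collapses_def
  proof (intro allI impI)
    fix zs z assume "zs \<longlonglongrightarrow> z" "z \<noteq> a"
    then show "(\<lambda>n. inv (h n) (zs n)) \<longlonglongrightarrow> b"
      using act_conv[OF c2' inv_in[OF h], of "\<lambda>n. Inr (zs n)" "Inr z"] by (simp add: tendsto_Inr_iff)
  qed
  have "escapes h a b"
    unfolding escapes_def
    using h col1 col2 lim1 cocycle_at_top[OF injh h lim2]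
      cocycle_at_top[OF injh' inv_in[OF h], of a] by (simp add: h)
  then show ?thesis using r unfolding h_def by blast
qed

end


section \<open>The limit set and global fixed points\<close>

lemma constant_subsequence:
  fixes g :: "nat \<Rightarrow> 'a"
  assumes "finite (range g)"
  obtains r :: "nat \<Rightarrow> nat" and c where "strict_mono r" "\<And>n. g (r n) = c"
proof -
  obtain k where "infinite {n. g n = g k}"
    using pigeonhole_infinite[of UNIV g] assms by auto
  from that[OF strict_mono_enumerate[OF this], of "g k"] enumerate_in_set[OF this] show ?thesis
    by simp
qed

context expanding_convergence_group
begin

lemma escape_of_infinite_range:
  assumes "infinite (range g)" "\<And>n::nat. g n \<in> \<Gamma>"
  shows "\<exists>r a b. strict_mono r \<and> inj (\<lambda>n. g (r n)) \<and> escapes (\<lambda>n. g (r n)) a b"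
proof -
  obtain r where r: "strict_mono (r :: nat \<Rightarrow> nat)" "inj (\<lambda>n. g (r n))"
    using injective_subsequence[OF assms(1)] by blast
  obtain s a b where s: "strict_mono (s :: nat \<Rightarrow> nat)" "escapes (\<lambda>n. g (r (s n))) a b"
    using escaping_subsequence[OF r(2)] assms(2) by blast
  have "strict_mono (\<lambda>n. r (s n))" using r(1) s(1) by (simp add: strict_mono_def)
  moreover have "inj (\<lambda>n. g (r (s n)))"
    using inj_compose[OF r(2) strict_mono_imp_inj_on[OF s(1)]] by (simp add: comp_def)
  ultimately show ?thesis using s(2) by blast
qed

text \<open>
  If uniformity failed near \<open>z\<close>, the exceptional points would accumulate at some \<open>l \<noteq> b\<close> by compactness,
  and completing them to a sequence converging to \<open>l\<close> contradicts the assumption.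
\<close>

lemma loc_unif_conv_of_collapses:
  assumes "collapses g a b"
  shows "loc_unif_conv dist (UNIV - {b}) g (a::'m)"
  unfolding loc_unif_conv_def
proof
  fix z assume "z \<in> UNIV - {b}"
  then have "z \<noteq> b" by simp
  show "\<exists>r>0. \<forall>e>0. \<forall>\<^sub>F n in sequentially. \<forall>w\<in>UNIV - {b}. dist z w < r \<longrightarrow> dist (g n w) a < e"
  proof (intro exI[of _ "dist z b / 2"] conjI allI impI)
    show "0 < dist z b / 2" using \<open>z \<noteq> b\<close> by simp
    fix e :: real assume "e > 0"
    show "\<forall>\<^sub>F n in sequentially. \<forall>w\<in>UNIV - {b}. dist z w < dist z b / 2 \<longrightarrow> dist (g n w) a < e"
    proof (rule ccontr)
      assume "\<not> ?thesis"
      then have "\<exists>\<^sub>F n in sequentially. \<exists>w. dist z w < dist z b / 2 \<and> e \<le> dist (g n w) a"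
        by (rule contrapos_np) (auto simp: frequently_def not_le elim!: eventually_mono)
      then have "infinite {n. \<exists>w. dist z w < dist z b / 2 \<and> e \<le> dist (g n w) a}"
        by (simp add: frequently_cofinite flip: cofinite_eq_sequentially)
      define S where "S = {n. \<exists>w. dist z w < dist z b / 2 \<and> e \<le> dist (g n w) a}"
      have "\<forall>n\<in>S. \<exists>w. dist z w < dist z b / 2 \<and> e \<le> dist (g n w) a" by (simp add: S_def)
      then obtain w where w: "\<And>n. n \<in> S \<Longrightarrow> dist z (w n) < dist z b / 2 \<and> e \<le> dist (g n (w n)) a"
        by metis
      have S: "infinite S" unfolding S_def by fact
      obtain r l where r: "strict_mono (r :: nat \<Rightarrow> nat)" "(\<lambda>n. w (enumerate S (r n))) \<longlonglongrightarrow> l"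
        using compact_M[unfolded compact_def, rule_format, of "\<lambda>n. w (enumerate S n)"]
        by (auto simp: comp_def)
      define k where "k n = enumerate S (r n)" for n
      have k: "strict_mono k" unfolding k_def[abs_def]
        using strict_mono_enumerate[OF S] r(1) by (simp add: strict_mono_def)
      have kS: "k n \<in> S" for n by (simp add: k_def enumerate_in_set[OF S])
      have wl: "(\<lambda>n. w (k n)) \<longlonglongrightarrow> l" using r(2) by (simp add: k_def)
      have "dist z l \<le> dist z b / 2"
        by (rule tendsto_upperbound[OF tendsto_dist[OF tendsto_const wl]])
          (use w kS in \<open>auto intro!: always_eventually less_imp_le\<close>)
      then have "l \<noteq> b" using \<open>z \<noteq> b\<close> zero_less_dist_iff[of z b] by fastforce
      \<comment> \<open>The exceptional points exist for the times in \<open>range k\<close> only; the value \<open>l\<close> fills the gaps.\<close>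
      define zs where "zs n = (if n \<in> range k then w n else l)" for n
      have "zs \<longlonglongrightarrow> l"
      proof (rule tendstoI)
        fix \<epsilon> :: real assume "\<epsilon> > 0"
        then obtain m where m: "\<And>n. n \<ge> m \<Longrightarrow> dist (w (k n)) l < \<epsilon>"
          using tendstoD[OF wl] by (auto simp: eventually_sequentially)
        have "dist (zs n) l < \<epsilon>" if "n \<ge> k m" for n
        proof (cases "n \<in> range k")
          case True
          then obtain j where j: "n = k j" by auto
          then have "j \<ge> m" using that k by (simp add: strict_mono_less_eq)
          then show ?thesis using m[of j] j by (simp add: zs_def)
        qed (use \<open>\<epsilon> > 0\<close> in \<open>simp add: zs_def\<close>)
        then show "\<forall>\<^sub>F n in sequentially. dist (zs n) l < \<epsilon>" by (auto simp: eventually_sequentially)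
      qed
      with assms \<open>l \<noteq> b\<close> have "(\<lambda>n. g n (zs n)) \<longlonglongrightarrow> a" by (simp add: collapses_def)
      from LIMSEQ_subseq_LIMSEQ[OF this k] have "(\<lambda>n. g (k n) (w (k n))) \<longlonglongrightarrow> a"
        by (simp add: comp_def zs_def)
      from tendstoD[OF this \<open>e > 0\<close>] obtain n where "dist (g (k n) (w (k n))) a < e"
        by (auto simp: eventually_sequentially)
      then show False using w[OF kS[of n]] by simp
    qed
  qed
qed

lemma limit_set_if_collapses:
  assumes "\<And>n. g n \<in> \<Gamma>" "collapses g a b"
  shows "a \<in> limit_set \<Gamma>"
  unfolding limit_set_def using assms loc_unif_conv_of_collapses[OF assms(2)] by blast

text \<open>
  Infinitely many distinct elements occur in a sequence converging to a constant off one point,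
  since \<open>M\<close> has at least three points and the elements are injective.
\<close>

lemma limit_set_escape:
  assumes "x \<in> limit_set \<Gamma>"
  shows "\<exists>g b. inj g \<and> escapes g x b"
proof -
  obtain y g where g: "range g \<subseteq> \<Gamma>" "loc_unif_conv dist (UNIV - {y}) g x"
    using assms by (auto simp: limit_set_def)
  have lim: "(\<lambda>n. g n z) \<longlonglongrightarrow> x" if "z \<noteq> y" for z
    using loc_unif_conv_dist_pointwise[OF g(2)] that by simp
  have "infinite (range g)"
  proof
    assume "finite (range g)"
    then obtain r :: "nat \<Rightarrow> nat" and \<gamma> where r: "strict_mono r" "\<And>n. g (r n) = \<gamma>"
      by (rule constant_subsequence) blast
    have eq: "\<gamma> z = x" if "z \<noteq> y" for z
      using LIMSEQ_subseq_LIMSEQ[OF lim[OF that] r(1)] by (simp add: comp_def r(2) LIMSEQ_const_iff)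
    have "\<gamma> \<in> \<Gamma>" using g(1) r(2)[of 0] by auto
    then have "inj \<gamma>" using bij_elem bij_is_inj by blast
    obtain z1 where z1: "z1 \<noteq> y" using three_points by blast
    obtain z2 where z2: "z2 \<noteq> y" "z2 \<noteq> z1" using three_points by blast
    have "\<gamma> z1 = \<gamma> z2" using eq[OF z1] eq[OF z2(1)] by simp
    then show False using \<open>inj \<gamma>\<close> z2(2) by (auto simp: inj_eq)
  qed
  then obtain r a b where r: "strict_mono r" "inj (\<lambda>n. g (r n))" "escapes (\<lambda>n. g (r n)) a b"
    using escape_of_infinite_range[of g] g(1) by blast
  obtain z where z: "z \<noteq> y" "z \<noteq> b" using three_points by blast
  have "(\<lambda>n. g (r n) z) \<longlonglongrightarrow> x" using LIMSEQ_subseq_LIMSEQ[OF lim[OF z(1)] r(1)] by (simp add: comp_def)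
  moreover have "(\<lambda>n. g (r n) z) \<longlonglongrightarrow> a" using escapesD(2)[OF r(3) tendsto_const z(2)] .
  ultimately have "a = x" by (rule LIMSEQ_unique[THEN sym])
  then show ?thesis using r by blast
qed

text \<open>
  The limit set is where \<open>\<Gamma>\<close> accumulates in \<open>\<Gamma> \<squnion> M\<close>; in this description it is plainly closed.
\<close>

lemma limit_set_iff: "x \<in> limit_set \<Gamma> \<longleftrightarrow> (\<forall>e>0. \<exists>\<gamma>\<in>\<Gamma>. d (Inl \<gamma>) (Inr x) < e)"
proof
  assume "x \<in> limit_set \<Gamma>"
  then obtain g b where g: "escapes g x b" using limit_set_escape by blast
  show "\<forall>e>0. \<exists>\<gamma>\<in>\<Gamma>. d (Inl \<gamma>) (Inr x) < e"
  proof (intro allI impI)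
    fix e :: real assume "e > 0"
    from order_tendstoD(2)[OF escapesD(6)[OF g] this] obtain n where "d (Inl (g n)) (Inr x) < e"
      by (auto simp: eventually_sequentially)
    then show "\<exists>\<gamma>\<in>\<Gamma>. d (Inl \<gamma>) (Inr x) < e" using escapesD(1)[OF g] by blast
  qed
next
  assume *: "\<forall>e>0. \<exists>\<gamma>\<in>\<Gamma>. d (Inl \<gamma>) (Inr x) < e"
  have "\<exists>\<gamma>. \<gamma> \<in> \<Gamma> \<and> d (Inl \<gamma>) (Inr x) < 1 / real (Suc n)" for n
    using *[rule_format, of "1 / real (Suc n)"] by auto
  then obtain g where g: "\<And>n. g n \<in> \<Gamma>" "\<And>n. d (Inl (g n)) (Inr x) < 1 / real (Suc n)" by metis
  have lim: "(\<lambda>n. d (Inl (g n)) (Inr x)) \<longlonglongrightarrow> 0"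
  proof (rule tendsto_sandwich[OF _ _ tendsto_const LIMSEQ_inverse_real_of_nat])
    show "\<forall>\<^sub>F n in sequentially. d (Inl (g n)) (Inr x) \<le> inverse (real (Suc n))"
      using g(2) by (intro always_eventually allI) (simp add: less_imp_le inverse_eq_divide)
  qed (auto intro: always_eventually)
  have "infinite (range g)"
  proof
    assume "finite (range g)"
    then obtain r :: "nat \<Rightarrow> nat" and \<gamma> where r: "strict_mono r" "\<And>n. g (r n) = \<gamma>"
      by (rule constant_subsequence) blast
    have "(\<lambda>n. d (Inl (g (r n))) (Inr x)) \<longlonglongrightarrow> 0"
      using LIMSEQ_subseq_LIMSEQ[OF lim r(1)] by (simp add: comp_def)
    then have "d (Inl \<gamma>) (Inr x) = 0" by (simp add: r(2) LIMSEQ_const_iff)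
    moreover have "\<gamma> \<in> \<Gamma>" using g(1)[of "r 0"] r(2)[of 0] by simp
    ultimately show False by simp
  qed
  then obtain r a b where r: "strict_mono r" "escapes (\<lambda>n. g (r n)) a b"
    using escape_of_infinite_range[of g] g(1) by blast
  have "Inr a = (Inr x :: ('m \<Rightarrow> 'm) + 'm)"
  proof (rule d_limit_unique)
    show "(\<lambda>n. d (Inl (g (r n))) (Inr a)) \<longlonglongrightarrow> 0" by (rule escapesD(6)[OF r(2)])
    show "(\<lambda>n. d (Inl (g (r n))) (Inr x)) \<longlonglongrightarrow> 0"
      using LIMSEQ_subseq_LIMSEQ[OF lim r(1)] by (simp add: comp_def)
  qed (use g in auto)
  then show "x \<in> limit_set \<Gamma>"
    using limit_set_if_collapses[of "\<lambda>n. g (r n)" a b] r(2) g(1) by (simp add: escapes_def)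
qed

lemma closed_limit_set: "closed (limit_set \<Gamma>)"
  unfolding closed_sequential_limits
proof (intro allI impI, elim conjE)
  fix xs x assume xs: "\<forall>n. xs n \<in> limit_set \<Gamma>" and "xs \<longlonglongrightarrow> x"
  then have lim: "(\<lambda>n. d (Inr (xs n)) (Inr x)) \<longlonglongrightarrow> 0" by (simp add: tendsto_Inr_iff)
  show "x \<in> limit_set \<Gamma>"
    unfolding limit_set_iff
  proof (intro allI impI)
    fix e :: real assume "e > 0"
    then obtain n where n: "d (Inr (xs n)) (Inr x) < e / 2"
      using order_tendstoD(2)[OF lim, of "e / 2"] by (auto simp: eventually_sequentially)
    obtain \<gamma> where \<gamma>: "\<gamma> \<in> \<Gamma>" "d (Inl \<gamma>) (Inr (xs n)) < e / 2"
      using xs \<open>e > 0\<close> half_gt_zero unfolding limit_set_iff by blast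
    have "d (Inl \<gamma>) (Inr x) \<le> d (Inl \<gamma>) (Inr (xs n)) + d (Inr (xs n)) (Inr x)"
      by (rule A.triangle) (use \<gamma> in auto)
    then show "\<exists>\<gamma>\<in>\<Gamma>. d (Inl \<gamma>) (Inr x) < e" using n \<gamma> by (intro bexI[of _ \<gamma>]) auto
  qed
qed

lemma limit_set_elem: "\<gamma> \<in> \<Gamma> \<Longrightarrow> x \<in> limit_set \<Gamma> \<Longrightarrow> \<gamma> x \<in> limit_set \<Gamma>"
proof -
  assume \<gamma>: "\<gamma> \<in> \<Gamma>" and "x \<in> limit_set \<Gamma>"
  then obtain g b where g: "escapes g x b" using limit_set_escape by blast
  have "collapses (\<lambda>n. \<gamma> \<circ> g n) (\<gamma> x) b"
    unfolding collapses_def using tendsto_elem[OF \<gamma> escapesD(2)[OF g]] by simp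
  then show ?thesis
    by (rule limit_set_if_collapses[rotated]) (simp add: comp_in \<gamma> escapesD(1)[OF g])
qed

lemma limit_set_elem_iff: "\<gamma> \<in> \<Gamma> \<Longrightarrow> \<gamma> x \<in> limit_set \<Gamma> \<longleftrightarrow> x \<in> limit_set \<Gamma>"
  using limit_set_elem[of \<gamma> x] limit_set_elem[OF inv_in, of \<gamma> "\<gamma> x"] by auto

lemma elem_eq_iff: "\<gamma> \<in> \<Gamma> \<Longrightarrow> \<gamma> x = \<gamma> y \<longleftrightarrow> x = y"
  using bij_elem by (metis bij_is_inj inj_eq)

lemma three_limit_points: "\<exists>z\<in>limit_set \<Gamma>. z \<noteq> x \<and> z \<noteq> y"
proof -
  obtain S where S: "S \<subseteq> limit_set \<Gamma>" "card S = 3" using three by (auto simp: non_elementary_def)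
  have "card {x, y} \<le> 2" by (simp add: card_insert_if)
  then have "\<not> S \<subseteq> {x, y}" using S(2) card_mono[of "{x, y}" S] by auto
  then show ?thesis using S(1) by auto
qed

lemma filterlim_const_at_top: "\<not> filterlim (\<lambda>_::nat. c::real) at_top sequentially"
  unfolding filterlim_at_top_dense by (auto intro!: exI[of _ c])

text \<open>
  Consider \<open>f\<^sub>n = g\<^sub>n h g\<^sub>n\<^sup>-\<^sup>1\<close>. Since \<open>p\<close> is fixed by everything, \<open>\<sigma>(f\<^sub>n, p) = \<sigma>(h, p)\<close> is
  constant in \<open>n\<close>. If infinitely many \<open>f\<^sub>n\<close> were distinct, expansion would force both limit points of an
  escaping subsequence to be \<open>p\<close>; but \<open>f\<^sub>n\<close> takes \<open>g\<^sub>n w\<close> to \<open>g\<^sub>n h w\<close>, and both converge to \<open>x \<noteq> p\<close>. So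
  some value of \<open>f\<^sub>n\<close> occurs infinitely often, and by the same convergence it fixes \<open>x\<close>.
\<close>

lemma conjugates_fix:
  assumes fix_p: "\<And>\<gamma>. \<gamma> \<in> \<Gamma> \<Longrightarrow> \<gamma> p = p" and g: "escapes g x p" and "x \<noteq> p" and h: "h \<in> \<Gamma>"
  shows "\<exists>n. h (inv (g n) x) = inv (g n) x"
proof -
  define f where "f n = g n \<circ> (h \<circ> inv (g n))" for n
  note gG = escapesD(1)[OF g]
  have fG: "f n \<in> \<Gamma>" for n unfolding f_def by (intro comp_in gG h inv_in)
  have \<sigma>f: "\<sigma> (f n) p = \<sigma> h p" for n
  proof -
    have "\<sigma> (f n) p = \<sigma> (g n) p + (\<sigma> h p + \<sigma> (inv (g n)) p)"
      unfolding f_def using gG[of n] h inv_in[OF gG[of n]] comp_in[OF h inv_in[OF gG[of n]]]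
      by (simp only: cocycle_comp fix_p comp_apply)
    moreover have "\<sigma> (inv (g n)) p = - \<sigma> (g n) p"
      using cocycle_inv[OF gG[of n], of p] by (simp add: fix_p[OF gG])
    ultimately show ?thesis by simp
  qed
  have \<sigma>f': "\<sigma> (inv (f n)) p = - \<sigma> h p" for n
    using cocycle_inv[OF fG[of n], of p] by (simp add: fix_p[OF fG] \<sigma>f)
  obtain w where w: "w \<noteq> p" using three_points by blast
  then have hw: "h w \<noteq> p" using fix_p[OF h] elem_eq_iff[OF h, of w p] by simp
  have z: "(\<lambda>n. g n w) \<longlonglongrightarrow> x" by (rule escapesD(2)[OF g tendsto_const w])
  have fz: "f n (g n w) = g n (h w)" for n by (simp add: f_def gG)
  have fz_lim: "(\<lambda>n. f n (g n w)) \<longlonglongrightarrow> x"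
    unfolding fz by (rule escapesD(2)[OF g tendsto_const hw])
  have "finite (range f)"
  proof (rule ccontr)
    assume "infinite (range f)"
    then obtain r a b where r: "strict_mono r" "escapes (\<lambda>n. f (r n)) a b"
      using escape_of_infinite_range[of f] fG by blast
    have "b = p"
    proof (rule ccontr)
      assume "b \<noteq> p"
      then have "filterlim (\<lambda>n. \<sigma> (f (r n)) p) at_top sequentially"
        by (intro escapesD(4)[OF r(2) tendsto_const]) auto
      then show False by (simp add: \<sigma>f filterlim_const_at_top)
    qed
    moreover have "a = p"
    proof (rule ccontr)
      assume "a \<noteq> p"
      then have "filterlim (\<lambda>n. \<sigma> (inv (f (r n))) p) at_top sequentially"
        by (intro escapesD(5)[OF r(2) tendsto_const]) auto
      then show False by (simp add: \<sigma>f' filterlim_const_at_top)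
    qed
    moreover have "(\<lambda>n. g (r n) w) \<longlonglongrightarrow> x" using LIMSEQ_subseq_LIMSEQ[OF z r(1)] by (simp add: comp_def)
    ultimately have "(\<lambda>n. f (r n) (g (r n) w)) \<longlonglongrightarrow> p"
      using escapesD(2)[OF r(2)] \<open>x \<noteq> p\<close> by simp
    moreover have "(\<lambda>n. f (r n) (g (r n) w)) \<longlonglongrightarrow> x"
      using LIMSEQ_subseq_LIMSEQ[OF fz_lim r(1)] by (simp add: comp_def)
    ultimately show False using LIMSEQ_unique \<open>x \<noteq> p\<close> by blast
  qed
  then obtain r :: "nat \<Rightarrow> nat" and f0 where r: "strict_mono r" "\<And>n. f (r n) = f0"
    by (rule constant_subsequence) blast
  have f0: "f0 \<in> \<Gamma>" using fG[of "r 0"] r(2)[of 0] by simp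
  have "(\<lambda>n. g (r n) w) \<longlonglongrightarrow> x" using LIMSEQ_subseq_LIMSEQ[OF z r(1)] by (simp add: comp_def)
  then have "(\<lambda>n. f0 (g (r n) w)) \<longlonglongrightarrow> f0 x" by (rule tendsto_elem[OF f0])
  moreover have "(\<lambda>n. f0 (g (r n) w)) \<longlonglongrightarrow> x"
    using LIMSEQ_subseq_LIMSEQ[OF fz_lim r(1)] by (simp add: comp_def r(2))
  ultimately have "f0 x = x" by (rule LIMSEQ_unique)
  then have "f (r 0) x = x" by (simp add: r(2))
  then have "inv (g (r 0)) (g (r 0) (h (inv (g (r 0)) x))) = inv (g (r 0)) x" by (simp add: f_def)
  then show ?thesis using gG by auto
qed

text \<open>
  At a global fixed point \<open>p\<close>, every escaping sequence attracted to another point is repelled by \<open>p\<close>,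
  and \<open>\<sigma>(\<cdot>, p)\<close> is a homomorphism. Choose \<open>h\<close> with \<open>\<sigma>(h, p) < 0\<close>, a member of such a sequence; by
  \<open>conjugates_fix\<close> it has a second fixed point \<open>w\<close>, which then attracts powers of \<open>h\<close>. Applying
  \<open>conjugates_fix\<close> to these powers shows that all of \<open>\<Gamma>\<close> fixes \<open>w\<close>. But a sequence
  attracted to a third limit point and repelled by \<open>p\<close> moves \<open>w\<close>.
\<close>

lemma no_global_fixed_point: "\<exists>\<gamma>\<in>\<Gamma>. \<gamma> p \<noteq> p"
proof (rule ccontr)
  assume "\<not> ?thesis"
  then have fix_p: "\<And>\<gamma>. \<gamma> \<in> \<Gamma> \<Longrightarrow> \<gamma> p = p" by blast
  have base: "b = p" if "escapes g x b" "x \<noteq> p" for g x b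
  proof (rule ccontr)
    assume "b \<noteq> p"
    then have "(\<lambda>n. g n p) \<longlonglongrightarrow> x" by (intro escapesD(2)[OF that(1) tendsto_const]) auto
    then show False using that(2) by (simp add: fix_p[OF escapesD(1)[OF that(1)]] LIMSEQ_const_iff)
  qed
  obtain x where x: "x \<in> limit_set \<Gamma>" "x \<noteq> p" using three_limit_points by blast
  obtain g where g: "escapes g x p" using limit_set_escape[OF x(1)] base x(2) by blast
  note gG = escapesD(1)[OF g]
  have "filterlim (\<lambda>n. \<sigma> (inv (g n)) p) at_top sequentially"
    using x(2) by (intro escapesD(5)[OF g tendsto_const]) auto
  then obtain k where k: "\<sigma> (inv (g k)) p > 0"
    unfolding filterlim_at_top_dense by (auto simp: eventually_sequentially)
  define h where "h = g k"
  have h: "h \<in> \<Gamma>" by (simp add: h_def gG)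
  define c where "c = \<sigma> h p"
  have "c < 0" using k cocycle_inv[OF h, of p] by (simp add: c_def h_def fix_p[OF gG])
  obtain n where n: "h (inv (g n) x) = inv (g n) x"
    using conjugates_fix[of p g x h] fix_p g x(2) h by blast
  define w where "w = inv (g n) x"
  have hw: "h w = w" using n by (simp add: w_def)
  have "w \<noteq> p"
  proof
    assume "w = p"
    then have "g n (inv (g n) x) = g n p" by (simp add: w_def)
    then show False using x(2) gG fix_p by simp
  qed
  have pow: "h ^^ j \<in> \<Gamma> \<and> \<sigma> (h ^^ j) p = real j * c \<and> (h ^^ j) w = w" for j
  proof (induction j)
    case 0 then show ?case using id_in[unfolded id_def] cocycle_id[unfolded id_def] by simp
  next
    case (Suc j)
    then have "\<sigma> (h \<circ> h ^^ j) p = c + real j * c"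
      using h by (simp add: cocycle_comp fix_p c_def)
    then have "\<sigma> (h \<circ> h ^^ j) p = real (Suc j) * c" by (simp add: algebra_simps)
    moreover have "h \<circ> h ^^ j \<in> \<Gamma>" using Suc h comp_in by blast
    moreover have "(h \<circ> h ^^ j) w = w" using Suc by (simp add: hw)
    ultimately show ?case by (simp only: funpow.simps simp_thms)
  qed
  have "inj (\<lambda>j. h ^^ j)"
  proof (rule injI)
    fix i j assume "h ^^ i = h ^^ j"
    then have "real i * c = real j * c" using pow by metis
    then show "i = j" using \<open>c < 0\<close> by simp
  qed
  then obtain r a b where r: "strict_mono r" "escapes (\<lambda>j. h ^^ r j) a b"
    using escaping_subsequence[of "\<lambda>j. h ^^ j"] pow by blast
  have "b = p"
  proof (rule ccontr)
    assume "b \<noteq> p"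
    then have "filterlim (\<lambda>j. \<sigma> (h ^^ r j) p) at_top sequentially"
      by (intro escapesD(4)[OF r(2) tendsto_const]) auto
    then obtain j where "\<sigma> (h ^^ r j) p > 0"
      unfolding filterlim_at_top_dense by (auto simp: eventually_sequentially)
    then show False using pow[of "r j"] \<open>c < 0\<close> by (simp add: zero_less_mult_iff)
  qed
  have "(\<lambda>j. (h ^^ r j) w) \<longlonglongrightarrow> a"
    using \<open>w \<noteq> p\<close> \<open>b = p\<close> by (intro escapesD(2)[OF r(2) tendsto_const]) auto
  then have "a = w" by (simp add: pow LIMSEQ_const_iff)
  have fix_w: "\<gamma> w = w" if "\<gamma> \<in> \<Gamma>" for \<gamma>
  proof -
    have "escapes (\<lambda>j. h ^^ r j) w p" using r(2) \<open>a = w\<close> \<open>b = p\<close> by simp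
    from conjugates_fix[of p, OF _ this \<open>w \<noteq> p\<close> that] fix_p
    obtain j where j: "\<gamma> (inv (h ^^ r j) w) = inv (h ^^ r j) w" by blast
    have "inv (h ^^ r j) w = w" using inv_elem(2)[of "h ^^ r j" w] pow[of "r j"] by simp
    then show ?thesis using j by simp
  qed
  obtain y where y: "y \<in> limit_set \<Gamma>" "y \<noteq> p" "y \<noteq> w" using three_limit_points by blast
  obtain g' where g': "escapes g' y p" using limit_set_escape[OF y(1)] base y(2) by blast
  have "(\<lambda>n. g' n w) \<longlonglongrightarrow> y" by (rule escapesD(2)[OF g' tendsto_const \<open>w \<noteq> p\<close>])
  then show False using y(3) by (simp add: fix_w[OF escapesD(1)[OF g']] LIMSEQ_const_iff)
qed

text \<open>
  If \<open>U \<inter> \<Lambda>(\<Gamma>)\<close> is a null set and \<open>x\<close> attracts a sequence \<open>g\<close> with repelling point \<open>b\<close>, the sets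
  \<open>g\<^sub>n\<^sup>-\<^sup>1 U\<close> cover the limit set except for \<open>b\<close>. So \<open>\<Lambda>(\<Gamma>) - {b}\<close> is a null set, and moving \<open>b\<close> by an
  element that does not fix it shows that \<open>\<Lambda>(\<Gamma>)\<close> is one too.
\<close>

lemma quasi_invariant_support:
  assumes sets: "sets \<mu> = sets borel"
    and qi: "\<And>\<gamma> E. \<lbrakk>\<gamma> \<in> \<Gamma>; E \<in> sets borel; emeasure \<mu> E = 0\<rbrakk> \<Longrightarrow> emeasure \<mu> (\<gamma> -` E) = 0"
    and pos: "emeasure \<mu> (limit_set \<Gamma>) \<noteq> 0"
    and U: "open U" "x \<in> U" "x \<in> limit_set \<Gamma>"
  shows "emeasure \<mu> (U \<inter> limit_set \<Gamma>) \<noteq> 0"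
proof
  let ?L = "limit_set \<Gamma>"
  have L: "?L \<in> sets borel" using closed_limit_set by (rule borel_closed)
  have UL: "U \<inter> ?L \<in> sets borel" using U(1) L by auto
  assume null: "emeasure \<mu> (U \<inter> ?L) = 0"
  obtain g b where g: "escapes g x b" using limit_set_escape[OF U(3)] by blast
  note gG = escapesD(1)[OF g]
  have vimage_borel: "\<gamma> -` E \<in> sets \<mu>" if "\<gamma> \<in> \<Gamma>" "E \<in> sets borel" for \<gamma> E
    using measurable_sets[OF borel_measurable_continuous_onI[OF continuous_elem[OF that(1)]] that(2)]
    by (simp add: sets)
  have "?L - {b} \<subseteq> (\<Union>n. g n -` (U \<inter> ?L))"
  proof
    fix z assume z: "z \<in> ?L - {b}"
    then have "(\<lambda>n. g n z) \<longlonglongrightarrow> x" by (intro escapesD(2)[OF g tendsto_const]) auto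
    then have "\<forall>\<^sub>F n in sequentially. g n z \<in> U" using U by (intro topological_tendstoD)
    then obtain n where "g n z \<in> U" by (auto simp: eventually_sequentially)
    then show "z \<in> (\<Union>n. g n -` (U \<inter> ?L))" using z limit_set_elem[OF gG] by auto
  qed
  moreover have "emeasure \<mu> (\<Union>n. g n -` (U \<inter> ?L)) = 0"
    using vimage_borel[OF gG UL] qi[OF gG UL null]
    by (intro null_setsD1 null_sets_UN) (auto simp: null_sets_def)
  moreover have "(\<Union>n. g n -` (U \<inter> ?L)) \<in> sets \<mu>" using vimage_borel[OF gG UL] by auto
  ultimately have Lb: "emeasure \<mu> (?L - {b}) = 0"
    by (metis emeasure_eq_0)
  obtain \<gamma> where \<gamma>: "\<gamma> \<in> \<Gamma>" "\<gamma> b \<noteq> b" using no_global_fixed_point by blast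
  have Lb_meas: "?L - {b} \<in> sets borel" using L by auto
  have "?L \<subseteq> (?L - {b}) \<union> \<gamma> -` (?L - {b})"
    using \<gamma> limit_set_elem[OF \<gamma>(1)] by auto
  then have "emeasure \<mu> ?L \<le> emeasure \<mu> ((?L - {b}) \<union> \<gamma> -` (?L - {b}))"
    using Lb_meas vimage_borel[OF \<gamma>(1) Lb_meas] sets by (intro emeasure_mono) auto
  also have "\<dots> \<le> emeasure \<mu> (?L - {b}) + emeasure \<mu> (\<gamma> -` (?L - {b}))"
    using Lb_meas vimage_borel[OF \<gamma>(1) Lb_meas] sets by (intro emeasure_subadditive) auto
  also have "\<dots> = 0" using Lb qi[OF \<gamma>(1) Lb_meas Lb] by simp
  finally show False using pos by simp
qed

end


section \<open>Return times and asymptotic orbits\<close>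

lemma tendsto_not_at_top:
  assumes "f \<longlonglongrightarrow> (c::real)"
  shows "\<not> filterlim f at_top sequentially"
proof
  assume "filterlim f at_top sequentially"
  then have "\<forall>\<^sub>F n in sequentially. c + 1 < f n" by (simp add: filterlim_at_top_dense)
  moreover have "\<forall>\<^sub>F n in sequentially. f n < c + 1"
    using assms by (rule order_tendstoD(2)) simp
  ultimately have "\<forall>\<^sub>F n in sequentially. False" by eventually_elim simp
  then show False by simp
qed

lemma at_bot_not_at_top:
  assumes "filterlim (f :: nat \<Rightarrow> real) at_bot sequentially"
  shows "\<not> filterlim f at_top sequentially"
proof
  assume "filterlim f at_top sequentially"
  then have "\<forall>\<^sub>F n in sequentially. 0 < f n" by (simp add: filterlim_at_top_dense)
  moreover have "\<forall>\<^sub>F n in sequentially. f n < 0"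
    using assms by (simp add: filterlim_at_bot_dense)
  ultimately have "\<forall>\<^sub>F n in sequentially. False" by eventually_elim simp
  then show False by simp
qed

lemma compact_subsequence:
  fixes u :: "nat \<Rightarrow> 'a::metric_space"
  assumes "compact K" "\<And>n::nat. u n \<in> K"
  shows "\<exists>r \<kappa>. strict_mono (r :: nat \<Rightarrow> nat) \<and> \<kappa> \<in> K \<and> (\<lambda>n. u (r n)) \<longlonglongrightarrow> \<kappa>"
proof -
  obtain \<kappa> r where "\<kappa> \<in> K" "strict_mono (r :: nat \<Rightarrow> nat)" "(u \<circ> r) \<longlonglongrightarrow> \<kappa>"
    using spec[OF assms(1)[unfolded compact_def], of u] assms(2) by auto
  then show ?thesis by (intro exI[of _ r] exI[of _ \<kappa>]) (simp add: comp_def)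
qed

lemma flow_act_eq:
  "flow_act \<sigma> \<gamma> v = (\<gamma> (fst v), \<gamma> (fst (snd v)), snd (snd v) + \<sigma> \<gamma> (fst (snd v)))"
  by (cases v) (simp add: flow_act_def)

context expanding_convergence_group
begin

text \<open>
  Proper discontinuity. If distinct \<open>h\<^sub>n\<close> took points \<open>w\<^sub>n \<rightarrow> (x, y, s)\<close> of \<open>K\<close> to points converging to
  \<open>(x', y', s')\<close>, then \<open>\<sigma>(h\<^sub>n, \<cdot>)\<close> would be bounded along the second coordinates. Expansion of \<open>h\<^sub>n\<close> and of
  its inverse would give \<open>y = b\<close> and \<open>y' = a\<close>, and then also \<open>x' = a = y'\<close>.
\<close>

lemma finite_returns:
  assumes K: "compact K" "\<And>x y s. (x, y, s) \<in> K \<Longrightarrow> x \<noteq> y"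
  shows "finite {\<gamma>\<in>\<Gamma>. \<exists>v\<in>K. flow_act \<sigma> \<gamma> v \<in> K}"
proof (rule ccontr)
  assume "infinite {\<gamma>\<in>\<Gamma>. \<exists>v\<in>K. flow_act \<sigma> \<gamma> v \<in> K}"
  then obtain g :: "nat \<Rightarrow> 'm \<Rightarrow> 'm" where g: "inj g" "range g \<subseteq> {\<gamma>\<in>\<Gamma>. \<exists>v\<in>K. flow_act \<sigma> \<gamma> v \<in> K}"
    using infinite_countable_subset by blast
  have "\<exists>v. v \<in> K \<and> flow_act \<sigma> (g n) v \<in> K" for n using g(2) by blast
  then obtain v where v: "\<And>n. v n \<in> K" "\<And>n. flow_act \<sigma> (g n) (v n) \<in> K" by metis
  have gG: "g n \<in> \<Gamma>" for n using g(2) by auto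
  have "compact (K \<times> K)" using K(1) by (intro compact_Times)
  moreover have "(v n, flow_act \<sigma> (g n) (v n)) \<in> K \<times> K" for n using v by simp
  ultimately obtain r1 kk where r1: "strict_mono r1" "kk \<in> K \<times> K"
     "(\<lambda>n. (v (r1 n), flow_act \<sigma> (g (r1 n)) (v (r1 n)))) \<longlonglongrightarrow> kk"
    using compact_subsequence[of "K \<times> K" "\<lambda>n. (v n, flow_act \<sigma> (g n) (v n))"] by blast
  have "inj (\<lambda>n. g (r1 n))" using inj_compose[OF g(1) strict_mono_imp_inj_on[OF r1(1)]] by (simp add: comp_def)
  then obtain r2 a b where r2: "strict_mono r2" "escapes (\<lambda>n. g (r1 (r2 n))) a b"
    using escaping_subsequence[of "\<lambda>n. g (r1 n)"] gG by blast
  define h where "h n = g (r1 (r2 n))" for n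
  define w where "w n = v (r1 (r2 n))" for n
  have h: "escapes h a b" using r2(2) by (simp add: h_def[abs_def])
  have hG: "h n \<in> \<Gamma>" for n by (simp add: h_def gG)
  obtain x y s x' y' s' where kk: "kk = ((x, y, s), (x', y', s'))" by (metis prod.exhaust)
  have neq: "x \<noteq> y" "x' \<noteq> y'" using r1(2) K(2) by (auto simp: kk)
  have lim: "(\<lambda>n. (w n, flow_act \<sigma> (h n) (w n))) \<longlonglongrightarrow> ((x, y, s), (x', y', s'))"
    using LIMSEQ_subseq_LIMSEQ[OF r1(3) r2(1)] by (simp add: comp_def kk h_def w_def)
  have lw: "(\<lambda>n. w n) \<longlonglongrightarrow> (x, y, s)" using tendsto_fst[OF lim] by simp
  have lhw: "(\<lambda>n. (h n (fst (w n)), h n (fst (snd (w n))), snd (snd (w n)) + \<sigma> (h n) (fst (snd (w n)))))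
     \<longlonglongrightarrow> (x', y', s')" using tendsto_snd[OF lim] by (simp add: flow_act_eq)
  have X: "(\<lambda>n. fst (w n)) \<longlonglongrightarrow> x" using tendsto_fst[OF lw] by simp
  have Y: "(\<lambda>n. fst (snd (w n))) \<longlonglongrightarrow> y" using tendsto_fst[OF tendsto_snd[OF lw]] by simp
  have S: "(\<lambda>n. snd (snd (w n))) \<longlonglongrightarrow> s" using tendsto_snd[OF tendsto_snd[OF lw]] by simp
  have X': "(\<lambda>n. h n (fst (w n))) \<longlonglongrightarrow> x'" using tendsto_fst[OF lhw] by simp
  have Y': "(\<lambda>n. h n (fst (snd (w n)))) \<longlonglongrightarrow> y'" using tendsto_fst[OF tendsto_snd[OF lhw]] by simp
  have S': "(\<lambda>n. snd (snd (w n)) + \<sigma> (h n) (fst (snd (w n)))) \<longlonglongrightarrow> s'"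
    using tendsto_snd[OF tendsto_snd[OF lhw]] by simp
  have \<sigma>: "(\<lambda>n. \<sigma> (h n) (fst (snd (w n)))) \<longlonglongrightarrow> s' - s" using tendsto_diff[OF S' S] by simp
  have "y = b" using escapesD(4)[OF h Y] tendsto_not_at_top[OF \<sigma>] by blast
  have "(\<lambda>n. \<sigma> (inv (h n)) (h n (fst (snd (w n))))) \<longlonglongrightarrow> - (s' - s)"
    using tendsto_minus[OF \<sigma>] by (simp add: cocycle_inv hG)
  then have "y' = a" using escapesD(5)[OF h Y'] tendsto_not_at_top by blast
  have "(\<lambda>n. h n (fst (w n))) \<longlonglongrightarrow> a" using escapesD(2)[OF h X] neq(1) \<open>y = b\<close> by simp
  then have "x' = a" using X' LIMSEQ_unique by blast
  then show False using \<open>y' = a\<close> neq(2) by simp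
qed

lemma escape_in_compact:
  assumes K: "compact K" and g: "\<And>n::nat. g n \<in> \<Gamma>" "\<And>n. flow_act \<sigma> (g n) (v n) \<in> K"
    and inf: "\<And>r. strict_mono (r :: nat \<Rightarrow> nat) \<Longrightarrow> convergent (\<lambda>n. flow_act \<sigma> (g (r n)) (v (r n)))
       \<Longrightarrow> infinite (range (\<lambda>n. g (r n)))"
  shows "\<exists>r \<kappa> a b. strict_mono (r :: nat \<Rightarrow> nat) \<and> \<kappa> \<in> K \<and> escapes (\<lambda>n. g (r n)) a b \<and>
     (\<lambda>n. flow_act \<sigma> (g (r n)) (v (r n))) \<longlonglongrightarrow> \<kappa>"
proof -
  obtain r1 \<kappa> where r1: "strict_mono (r1 :: nat \<Rightarrow> nat)" "\<kappa> \<in> K"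
     "(\<lambda>n. flow_act \<sigma> (g (r1 n)) (v (r1 n))) \<longlonglongrightarrow> \<kappa>"
    using compact_subsequence[of K "\<lambda>n. flow_act \<sigma> (g n) (v n)", OF K g(2)]
    by (elim exE conjE)
  have "infinite (range (\<lambda>n. g (r1 n)))" using r1(3) by (intro inf r1(1) convergentI)
  then obtain r2 a b where r2: "strict_mono (r2 :: nat \<Rightarrow> nat)" "escapes (\<lambda>n. g (r1 (r2 n))) a b"
    using escape_of_infinite_range[of "\<lambda>n. g (r1 n)"] g(1) by blast
  have "strict_mono (\<lambda>n. r1 (r2 n))" using r1(1) r2(1) by (simp add: strict_mono_def)
  moreover have "(\<lambda>n. flow_act \<sigma> (g (r1 (r2 n))) (v (r1 (r2 n)))) \<longlonglongrightarrow> \<kappa>"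
    using LIMSEQ_subseq_LIMSEQ[OF r1(3) r2(1)] by (simp add: comp_def)
  ultimately show ?thesis using r1(2) r2(2) by blast
qed

text \<open>
  As \<open>t\<^sub>n \<rightarrow> \<infinity>\<close> while the third coordinate stays bounded, \<open>\<sigma>(g\<^sub>n, y) \<rightarrow> -\<infinity>\<close>. This is only possible at the
  repelling point, so \<open>y = b\<close>, and \<open>g\<^sub>n x\<close> and \<open>g\<^sub>n x'\<close> converge to the same point. The other two
  coordinates of the two orbits coincide.
\<close>

lemma stable_common_limit:
  assumes K: "compact K" and neq: "x \<noteq> y" "x' \<noteq> y" and t: "filterlim t at_top sequentially"
    and g: "\<And>n::nat. g n \<in> \<Gamma>" "\<And>n. flow_act \<sigma> (g n) (x, y, s + t n) \<in> K"
  shows "\<exists>r \<kappa>. strict_mono (r :: nat \<Rightarrow> nat) \<and> (\<lambda>n. flow_act \<sigma> (g (r n)) (x, y, s + t (r n))) \<longlonglongrightarrow> \<kappa> \<and>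
     (\<lambda>n. flow_act \<sigma> (g (r n)) (x', y, s + t (r n))) \<longlonglongrightarrow> \<kappa>"
proof -
  have bot: "filterlim (\<lambda>n. \<sigma> (g (r n)) y) at_bot sequentially"
    if r: "strict_mono (r :: nat \<Rightarrow> nat)" and lim: "(\<lambda>n. flow_act \<sigma> (g (r n)) (x, y, s + t (r n))) \<longlonglongrightarrow> \<kappa>" for r \<kappa>
  proof -
    have "(\<lambda>n. s + t (r n) + \<sigma> (g (r n)) y) \<longlonglongrightarrow> snd (snd \<kappa>)"
      using tendsto_snd[OF tendsto_snd[OF lim]] by (simp add: flow_act_def)
    then have "(\<lambda>n. s - (s + t (r n) + \<sigma> (g (r n)) y)) \<longlonglongrightarrow> s - snd (snd \<kappa>)" by (intro tendsto_intros)
    moreover have "filterlim (\<lambda>n. t (r n)) at_top sequentially"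
      by (rule filterlim_compose[OF t filterlim_subseq[OF r]])
    ultimately have "filterlim (\<lambda>n. (s - (s + t (r n) + \<sigma> (g (r n)) y)) + t (r n)) at_top sequentially"
      by (rule filterlim_tendsto_add_at_top)
    then show ?thesis by (simp add: filterlim_uminus_at_bot)
  qed
  have inf: "infinite (range (\<lambda>n. g (r n)))"
    if r: "strict_mono r" and conv: "convergent (\<lambda>n. flow_act \<sigma> (g (r n)) (x, y, s + t (r n)))" for r :: "nat \<Rightarrow> nat"
  proof -
    obtain \<kappa> where "(\<lambda>n. flow_act \<sigma> (g (r n)) (x, y, s + t (r n))) \<longlonglongrightarrow> \<kappa>"
      using conv by (auto simp: convergent_def)
    from bot[OF r this] show ?thesis
      by (intro infinite_range_if_filterlim[of _ "\<lambda>\<gamma>. \<sigma> \<gamma> y"]) auto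
  qed
  from escape_in_compact[of K g "\<lambda>n. (x, y, s + t n)", OF K g inf] obtain r \<kappa> a b where r: "strict_mono (r :: nat \<Rightarrow> nat)"
    and esc: "escapes (\<lambda>n. g (r n)) a b"
    and lim: "(\<lambda>n. flow_act \<sigma> (g (r n)) (x, y, s + t (r n))) \<longlonglongrightarrow> \<kappa>" by blast
  have "y = b"
    using escapesD(4)[OF esc tendsto_const, of y] at_bot_not_at_top[OF bot[OF r lim]] by blast
  have "(\<lambda>n. g (r n) x) \<longlonglongrightarrow> a" using escapesD(2)[OF esc tendsto_const] neq(1) \<open>y = b\<close> by blast
  moreover have "(\<lambda>n. g (r n) x) \<longlonglongrightarrow> fst \<kappa>" using tendsto_fst[OF lim] by (simp add: flow_act_def)
  ultimately have "a = fst \<kappa>" by (rule LIMSEQ_unique)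
  have "(\<lambda>n. g (r n) x') \<longlonglongrightarrow> fst \<kappa>"
    using escapesD(2)[OF esc tendsto_const] neq(2) \<open>y = b\<close> \<open>a = fst \<kappa>\<close> by blast
  from tendsto_Pair[OF this tendsto_snd[OF lim]]
  have "(\<lambda>n. flow_act \<sigma> (g (r n)) (x', y, s + t (r n))) \<longlonglongrightarrow> \<kappa>" by (simp add: flow_act_def)
  then show ?thesis using r lim by blast
qed

end

text \<open>
  The cocycle relation for \<open>G\<close> is stated as the difference of the defining relation of a GPS system at
  \<open>y\<close> and \<open>y'\<close>, in which \<open>\<sigma>'\<close> cancels.
\<close>

locale gps_flow = expanding_convergence_group \<Gamma> d \<sigma> N
  for \<Gamma> :: "('m::metric_space \<Rightarrow> 'm) set" and d \<sigma> N +
  fixes G :: "'m \<times> 'm \<Rightarrow> real"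
  assumes G_continuous: "continuous_on (distinct_pairs UNIV) G"
    and G_cocycle: "\<lbrakk>\<gamma> \<in> \<Gamma>; x \<noteq> y; x \<noteq> y'\<rbrakk> \<Longrightarrow>
       \<sigma> \<gamma> y - \<sigma> \<gamma> y' = (G (\<gamma> x, \<gamma> y) - G (x, y)) - (G (\<gamma> x, \<gamma> y') - G (x, y'))"
begin

text \<open>
  Now \<open>\<sigma>(g\<^sub>n, y) \<rightarrow> \<infinity>\<close>, so the inverses do not expand at \<open>g\<^sub>n y\<close>, whose limit must therefore be the
  attracting point \<open>a\<close>. The limit of \<open>g\<^sub>n x\<close> is different, because \<open>K\<close> avoids the diagonal; hence
  \<open>x = b\<close> and \<open>g\<^sub>n y' \<rightarrow> a\<close> as well. The heights differ by
  \<open>G(g\<^sub>n x, g\<^sub>n y') - G(g\<^sub>n x, g\<^sub>n y)\<close>, which tends to \<open>0\<close> since \<open>G\<close> is continuous.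
\<close>

lemma unstable_common_limit:
  assumes K: "compact K" "\<And>x y s. (x, y, s) \<in> K \<Longrightarrow> x \<noteq> y" and neq: "x \<noteq> y" "x \<noteq> y'"
    and t: "filterlim t at_bot sequentially" and s': "s' = s + G (x, y') - G (x, y)"
    and g: "\<And>n::nat. g n \<in> \<Gamma>" "\<And>n. flow_act \<sigma> (g n) (x, y, s + t n) \<in> K"
  shows "\<exists>r \<kappa>. strict_mono (r :: nat \<Rightarrow> nat) \<and> (\<lambda>n. flow_act \<sigma> (g (r n)) (x, y, s + t (r n))) \<longlonglongrightarrow> \<kappa> \<and>
     (\<lambda>n. flow_act \<sigma> (g (r n)) (x, y', s' + t (r n))) \<longlonglongrightarrow> \<kappa>"
proof -
  have top: "filterlim (\<lambda>n. \<sigma> (g (r n)) y) at_top sequentially"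
    if r: "strict_mono (r :: nat \<Rightarrow> nat)" and lim: "(\<lambda>n. flow_act \<sigma> (g (r n)) (x, y, s + t (r n))) \<longlonglongrightarrow> \<kappa>" for r \<kappa>
  proof -
    have "(\<lambda>n. s + t (r n) + \<sigma> (g (r n)) y) \<longlonglongrightarrow> snd (snd \<kappa>)"
      using tendsto_snd[OF tendsto_snd[OF lim]] by (simp add: flow_act_def)
    then have "(\<lambda>n. (s + t (r n) + \<sigma> (g (r n)) y) - s) \<longlonglongrightarrow> snd (snd \<kappa>) - s" by (intro tendsto_intros)
    moreover have "filterlim (\<lambda>n. - t (r n)) at_top sequentially"
      using filterlim_compose[OF t filterlim_subseq[OF r]] by (simp add: filterlim_uminus_at_top)
    ultimately have "filterlim (\<lambda>n. ((s + t (r n) + \<sigma> (g (r n)) y) - s) + (- t (r n))) at_top sequentially"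
      by (rule filterlim_tendsto_add_at_top)
    then show ?thesis by simp
  qed
  have inf: "infinite (range (\<lambda>n. g (r n)))"
    if r: "strict_mono r" and conv: "convergent (\<lambda>n. flow_act \<sigma> (g (r n)) (x, y, s + t (r n)))" for r :: "nat \<Rightarrow> nat"
  proof -
    obtain \<kappa> where "(\<lambda>n. flow_act \<sigma> (g (r n)) (x, y, s + t (r n))) \<longlonglongrightarrow> \<kappa>"
      using conv by (auto simp: convergent_def)
    from top[OF r this] show ?thesis
      by (intro infinite_range_if_filterlim[of _ "\<lambda>\<gamma>. \<sigma> \<gamma> y"]) auto
  qed
  from escape_in_compact[of K g "\<lambda>n. (x, y, s + t n)", OF K(1) g inf] obtain r \<kappa> a b where r: "strict_mono (r :: nat \<Rightarrow> nat)"
    and \<kappa>: "\<kappa> \<in> K" and esc: "escapes (\<lambda>n. g (r n)) a b"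
    and lim: "(\<lambda>n. flow_act \<sigma> (g (r n)) (x, y, s + t (r n))) \<longlonglongrightarrow> \<kappa>" by blast
  obtain \<xi> \<eta> \<tau> where k: "\<kappa> = (\<xi>, \<eta>, \<tau>)" by (metis prod.exhaust)
  have "\<xi> \<noteq> \<eta>" using K(2) \<kappa> k by blast
  have limx: "(\<lambda>n. g (r n) x) \<longlonglongrightarrow> \<xi>" using tendsto_fst[OF lim] by (simp add: flow_act_def k)
  have limy: "(\<lambda>n. g (r n) y) \<longlonglongrightarrow> \<eta>" using tendsto_fst[OF tendsto_snd[OF lim]] by (simp add: flow_act_def k)
  have lims: "(\<lambda>n. s + t (r n) + \<sigma> (g (r n)) y) \<longlonglongrightarrow> \<tau>"
    using tendsto_snd[OF tendsto_snd[OF lim]] by (simp add: flow_act_def k)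
  have "\<eta> = a"
  proof (rule ccontr)
    assume "\<eta> \<noteq> a"
    from escapesD(5)[OF esc limy this] have "filterlim (\<lambda>n. - \<sigma> (g (r n)) y) at_top sequentially"
      by (simp add: cocycle_inv g(1))
    moreover have "filterlim (\<lambda>n. - \<sigma> (g (r n)) y) at_bot sequentially"
      using top[OF r lim] by (simp add: filterlim_uminus_at_bot)
    ultimately show False using at_bot_not_at_top by blast
  qed
  have "x = b"
  proof (rule ccontr)
    assume "x \<noteq> b"
    then have "(\<lambda>n. g (r n) x) \<longlonglongrightarrow> a" by (rule escapesD(2)[OF esc tendsto_const])
    then have "\<xi> = a" using limx LIMSEQ_unique by blast
    then show False using \<open>\<xi> \<noteq> \<eta>\<close> \<open>\<eta> = a\<close> by simp
  qed
  have limy': "(\<lambda>n. g (r n) y') \<longlonglongrightarrow> \<eta>"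
    using escapesD(2)[OF esc tendsto_const, of y'] neq(2) \<open>x = b\<close> \<open>\<eta> = a\<close> by simp
  have Glim: "(\<lambda>n. G (g (r n) x, g (r n) z)) \<longlonglongrightarrow> G (\<xi>, \<eta>)"
    if "(\<lambda>n. g (r n) z) \<longlonglongrightarrow> \<eta>" "x \<noteq> z" for z
  proof (rule continuous_on_tendsto_compose[OF G_continuous])
    show "(\<lambda>n. (g (r n) x, g (r n) z)) \<longlonglongrightarrow> (\<xi>, \<eta>)" using limx that(1) by (rule tendsto_Pair)
    show "(\<xi>, \<eta>) \<in> distinct_pairs UNIV" using \<open>\<xi> \<noteq> \<eta>\<close> by (simp add: distinct_pairs_def)
    show "\<forall>\<^sub>F n in sequentially. (g (r n) x, g (r n) z) \<in> distinct_pairs UNIV"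
      using that(2) g(1) elem_eq_iff by (simp add: distinct_pairs_def)
  qed
  have "(\<lambda>n. (s + t (r n) + \<sigma> (g (r n)) y) - (G (g (r n) x, g (r n) y) - G (g (r n) x, g (r n) y')))
      \<longlonglongrightarrow> \<tau> - (G (\<xi>, \<eta>) - G (\<xi>, \<eta>))"
    using lims Glim[OF limy neq(1)] Glim[OF limy' neq(2)] by (intro tendsto_intros)
  moreover have "(s + t (r n) + \<sigma> (g (r n)) y) - (G (g (r n) x, g (r n) y) - G (g (r n) x, g (r n) y'))
      = s' + t (r n) + \<sigma> (g (r n)) y'" for n
    using G_cocycle[OF g(1) neq, of "r n"] by (simp add: s')
  ultimately have "(\<lambda>n. s' + t (r n) + \<sigma> (g (r n)) y') \<longlonglongrightarrow> \<tau>" by simp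
  from tendsto_Pair[OF limx tendsto_Pair[OF limy' this]]
  have "(\<lambda>n. flow_act \<sigma> (g (r n)) (x, y', s' + t (r n))) \<longlonglongrightarrow> \<kappa>" by (simp add: flow_act_def k)
  then show ?thesis using r lim by blast
qed

end

text \<open>
  Turns a compactly supported function on the cover into one on the orbit space. Compared with the sum
  over the orbit, the supremum keeps the bounds \<open>0\<close> and \<open>1\<close> and does not increase distances
  (\<open>orbit_sup_close\<close>).
\<close>

definition orbit_sup :: "('a \<Rightarrow> real) \<Rightarrow> 'a set \<Rightarrow> real" where
  "orbit_sup f c = (SUP v\<in>c. f v)"

context expanding_convergence_group
begin

lemma orbit_sup_close:
  assumes f: "\<And>v. 0 \<le> f v \<and> f v \<le> 1"
    and close: "\<And>\<gamma>. \<gamma> \<in> \<Gamma> \<Longrightarrow> \<bar>f (flow_act \<sigma> \<gamma> v) - f (flow_act \<sigma> \<gamma> w)\<bar> \<le> e"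
  shows "\<bar>orbit_sup f (flow_orbit \<Gamma> \<sigma> v) - orbit_sup f (flow_orbit \<Gamma> \<sigma> w)\<bar> \<le> e"
proof -
  have *: "orbit_sup f (flow_orbit \<Gamma> \<sigma> v) \<le> orbit_sup f (flow_orbit \<Gamma> \<sigma> w) + e"
    if "\<And>\<gamma>. \<gamma> \<in> \<Gamma> \<Longrightarrow> f (flow_act \<sigma> \<gamma> v) \<le> f (flow_act \<sigma> \<gamma> w) + e" for v w
    unfolding orbit_sup_def flow_orbit_def image_image
  proof (rule cSUP_least)
    show "\<Gamma> \<noteq> {}" using id_in by blast
    fix \<gamma> assume \<gamma>: "\<gamma> \<in> \<Gamma>"
    have "f (flow_act \<sigma> \<gamma> w) \<le> (SUP \<gamma>\<in>\<Gamma>. f (flow_act \<sigma> \<gamma> w))"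
      using f \<gamma> by (intro cSUP_upper bdd_aboveI2[where M = 1]) auto
    then show "f (flow_act \<sigma> \<gamma> v) \<le> (SUP \<gamma>\<in>\<Gamma>. f (flow_act \<sigma> \<gamma> w)) + e"
      using that[OF \<gamma>] by linarith
  qed
  have "orbit_sup f (flow_orbit \<Gamma> \<sigma> v) \<le> orbit_sup f (flow_orbit \<Gamma> \<sigma> w) + e"
    by (rule *) (use close in fastforce)
  moreover have "orbit_sup f (flow_orbit \<Gamma> \<sigma> w) \<le> orbit_sup f (flow_orbit \<Gamma> \<sigma> v) + e"
    by (rule *) (use close in fastforce)
  ultimately show ?thesis by linarith
qed

text \<open>
  Otherwise there are times \<open>t\<^sub>n \<rightarrow> \<infinity>\<close> and \<open>g\<^sub>n \<in> \<Gamma>\<close> such that the values of \<open>f\<close> at \<open>g\<^sub>n v(t\<^sub>n)\<close> and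
  \<open>g\<^sub>n w(t\<^sub>n)\<close> differ by a fixed amount. One of the two points is in \<open>K\<close> infinitely often, so along a
  subsequence they have a common limit, at which \<open>f\<close> is continuous.
\<close>

lemma orbit_sup_asymptotic:
  assumes f: "continuous_on UNIV f" "\<And>v. 0 \<le> f v \<and> f v \<le> 1" "\<And>v. f v \<noteq> 0 \<Longrightarrow> v \<in> K"
    and lim: "\<And>t g. \<lbrakk>filterlim t at_top sequentially; \<And>n::nat. g n \<in> \<Gamma>;
        \<And>n. flow_act \<sigma> (g n) (v (t n)) \<in> K\<rbrakk> \<Longrightarrow> \<exists>r \<kappa>. strict_mono (r :: nat \<Rightarrow> nat) \<and>
        (\<lambda>n. flow_act \<sigma> (g (r n)) (v (t (r n)))) \<longlonglongrightarrow> \<kappa> \<and> (\<lambda>n. flow_act \<sigma> (g (r n)) (w (t (r n)))) \<longlonglongrightarrow> \<kappa>"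
    and lim': "\<And>t g. \<lbrakk>filterlim t at_top sequentially; \<And>n::nat. g n \<in> \<Gamma>;
        \<And>n. flow_act \<sigma> (g n) (w (t n)) \<in> K\<rbrakk> \<Longrightarrow> \<exists>r \<kappa>. strict_mono (r :: nat \<Rightarrow> nat) \<and>
        (\<lambda>n. flow_act \<sigma> (g (r n)) (w (t (r n)))) \<longlonglongrightarrow> \<kappa> \<and> (\<lambda>n. flow_act \<sigma> (g (r n)) (v (t (r n)))) \<longlonglongrightarrow> \<kappa>"
  shows "((\<lambda>t::real. orbit_sup f (flow_orbit \<Gamma> \<sigma> (v t)) - orbit_sup f (flow_orbit \<Gamma> \<sigma> (w t))) \<longlongrightarrow> 0) at_top"
proof -
  have side: False
    if lim: "\<And>t g. \<lbrakk>filterlim t at_top sequentially; \<And>n::nat. g n \<in> \<Gamma>;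
        \<And>n. flow_act \<sigma> (g n) (v (t n)) \<in> K\<rbrakk> \<Longrightarrow> \<exists>r \<kappa>. strict_mono (r :: nat \<Rightarrow> nat) \<and>
        (\<lambda>n. flow_act \<sigma> (g (r n)) (v (t (r n)))) \<longlonglongrightarrow> \<kappa> \<and> (\<lambda>n. flow_act \<sigma> (g (r n)) (w (t (r n)))) \<longlonglongrightarrow> \<kappa>"
      and t: "filterlim t at_top sequentially" and g: "\<And>n::nat. g n \<in> \<Gamma>" and "e > 0"
      and far: "\<And>n. e < \<bar>f (flow_act \<sigma> (g n) (v (t n))) - f (flow_act \<sigma> (g n) (w (t n)))\<bar>"
      and inf: "infinite {n. flow_act \<sigma> (g n) (v (t n)) \<in> K}" for v w :: "real \<Rightarrow> _" and t g e
  proof -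
    define q where "q = enumerate {n. flow_act \<sigma> (g n) (v (t n)) \<in> K}"
    have q: "strict_mono q" unfolding q_def by (rule strict_mono_enumerate[OF inf])
    have qK: "flow_act \<sigma> (g (q n)) (v (t (q n))) \<in> K" for n
      using enumerate_in_set[OF inf, of n] by (simp add: q_def)
    have "filterlim (\<lambda>n. t (q n)) at_top sequentially"
      by (rule filterlim_compose[OF t filterlim_subseq[OF q]])
    from lim[of "\<lambda>n. t (q n)" "\<lambda>n. g (q n)", OF this g qK] obtain r \<kappa> where
      1: "(\<lambda>n. flow_act \<sigma> (g (q (r n))) (v (t (q (r n))))) \<longlonglongrightarrow> \<kappa>" and
      2: "(\<lambda>n. flow_act \<sigma> (g (q (r n))) (w (t (q (r n))))) \<longlonglongrightarrow> \<kappa>" by blast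
    have "(\<lambda>n. f (flow_act \<sigma> (g (q (r n))) (v (t (q (r n)))))
         - f (flow_act \<sigma> (g (q (r n))) (w (t (q (r n)))))) \<longlonglongrightarrow> f \<kappa> - f \<kappa>"
      by (intro tendsto_diff continuous_on_tendsto_compose[OF f(1) 1] continuous_on_tendsto_compose[OF f(1) 2]) auto
    then have "(\<lambda>n. f (flow_act \<sigma> (g (q (r n))) (v (t (q (r n)))))
         - f (flow_act \<sigma> (g (q (r n))) (w (t (q (r n)))))) \<longlonglongrightarrow> 0" by simp
    from tendstoD[OF this \<open>e > 0\<close>] obtain n where
      "\<bar>f (flow_act \<sigma> (g (q (r n))) (v (t (q (r n))))) - f (flow_act \<sigma> (g (q (r n))) (w (t (q (r n)))))\<bar> < e"
      by (auto simp: eventually_sequentially)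
    then show False using far[of "q (r n)"] by simp
  qed
  let ?D = "\<lambda>t. orbit_sup f (flow_orbit \<Gamma> \<sigma> (v t)) - orbit_sup f (flow_orbit \<Gamma> \<sigma> (w t))"
  show ?thesis
  proof (rule tendsto_at_topI_sequentially)
    fix t :: "nat \<Rightarrow> real" assume t: "filterlim t at_top sequentially"
    show "(\<lambda>n. ?D (t n)) \<longlonglongrightarrow> 0"
    proof (rule ccontr)
      assume "\<not> (\<lambda>n. ?D (t n)) \<longlonglongrightarrow> 0"
      then obtain e where e: "e > 0" "\<not> (\<forall>\<^sub>F n in sequentially. dist (?D (t n)) 0 < e)"
        unfolding tendsto_iff by blast
      define S where "S = {n. e \<le> \<bar>?D (t n)\<bar>}"
      have S: "infinite S"
        using e(2) by (simp add: S_def eventually_cofinite not_less flip: cofinite_eq_sequentially)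
      define q where "q = enumerate S"
      have q: "strict_mono q" unfolding q_def by (rule strict_mono_enumerate[OF S])
      have "\<exists>\<gamma>. \<gamma> \<in> \<Gamma> \<and> e / 2 < \<bar>f (flow_act \<sigma> \<gamma> (v (t (q n)))) - f (flow_act \<sigma> \<gamma> (w (t (q n))))\<bar>" for n
      proof (rule ccontr)
        assume "\<nexists>\<gamma>. \<gamma> \<in> \<Gamma> \<and> e / 2 < \<bar>f (flow_act \<sigma> \<gamma> (v (t (q n)))) - f (flow_act \<sigma> \<gamma> (w (t (q n))))\<bar>"
        then have "\<bar>?D (t (q n))\<bar> \<le> e / 2"
          by (intro orbit_sup_close f(2)) (simp add: not_less)
        moreover have "e \<le> \<bar>?D (t (q n))\<bar>" using enumerate_in_set[OF S, of n] by (simp add: q_def S_def)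
        ultimately show False using e(1) by simp
      qed
      then obtain g where g: "\<And>n. g n \<in> \<Gamma>"
        and far: "\<And>n. e / 2 < \<bar>f (flow_act \<sigma> (g n) (v (t (q n)))) - f (flow_act \<sigma> (g n) (w (t (q n))))\<bar>"
        by metis
      have tq: "filterlim (\<lambda>n. t (q n)) at_top sequentially"
        by (rule filterlim_compose[OF t filterlim_subseq[OF q]])
      have "f (flow_act \<sigma> (g n) (v (t (q n)))) \<noteq> 0 \<or> f (flow_act \<sigma> (g n) (w (t (q n)))) \<noteq> 0" for n
        using far[of n] e(1) by auto
      then have eq: "{n. flow_act \<sigma> (g n) (v (t (q n))) \<in> K} \<union> {n. flow_act \<sigma> (g n) (w (t (q n))) \<in> K} = UNIV"
        using f(3) by blast
      have "infinite ({n. flow_act \<sigma> (g n) (v (t (q n))) \<in> K} \<union> {n. flow_act \<sigma> (g n) (w (t (q n))) \<in> K})"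
        unfolding eq by (rule infinite_UNIV_nat)
      then have "infinite {n. flow_act \<sigma> (g n) (v (t (q n))) \<in> K} \<or> infinite {n. flow_act \<sigma> (g n) (w (t (q n))) \<in> K}"
        unfolding finite_Un by blast
      then show False
      proof
        assume "infinite {n. flow_act \<sigma> (g n) (v (t (q n))) \<in> K}"
        from side[of v w "\<lambda>n. t (q n)" g "e / 2", OF lim tq g half_gt_zero[OF e(1)] far this]
        show False .
      next
        assume inf: "infinite {n. flow_act \<sigma> (g n) (w (t (q n))) \<in> K}"
        have far': "e / 2 < \<bar>f (flow_act \<sigma> (g n) (w (t (q n)))) - f (flow_act \<sigma> (g n) (v (t (q n))))\<bar>" for n
          using far[of n] by (simp add: abs_minus_commute)
        from side[of w v "\<lambda>n. t (q n)" g "e / 2", OF lim' tq g half_gt_zero[OF e(1)] far' inf]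
        show False .
      qed
    qed
  qed
qed

end


section \<open>The measure on the flow space\<close>

lemma infsum_cmult_ennreal:
  fixes c :: ennreal
  shows "infsum (\<lambda>x. c * f x) A = c * infsum f A"
  by (simp add: nonneg_infsum_complete SUP_mult_left_ennreal sum_distrib_left)

locale bms_flow = gps_flow \<Gamma> d \<sigma> N G
  for \<Gamma> :: "('m::polish_space \<Rightarrow> 'm) set" and d \<sigma> N G +
  fixes \<delta> :: real and \<mu> \<mu>' :: "'m measure" and m :: "('m \<times> 'm \<times> real) set measure"
  assumes prob: "prob_space \<mu>" and prob': "prob_space \<mu>'"
    and sets_\<mu> [measurable_cong]: "sets \<mu> = sets borel" and sets_\<mu>' [measurable_cong]: "sets \<mu>' = sets borel"
    and qi: "\<lbrakk>\<gamma> \<in> \<Gamma>; E \<in> sets borel; emeasure \<mu> E = 0\<rbrakk> \<Longrightarrow> emeasure \<mu> (\<gamma> -` E) = 0"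
    and qi': "\<lbrakk>\<gamma> \<in> \<Gamma>; E \<in> sets borel; emeasure \<mu>' E = 0\<rbrakk> \<Longrightarrow> emeasure \<mu>' (\<gamma> -` E) = 0"
    and BMS: "BMS_measure \<Gamma> \<sigma> G \<delta> \<mu>' \<mu> m"
    and fin_m: "finite_measure m"
begin

sublocale P: prob_space \<mu> by (rule prob)
sublocale P': prob_space \<mu>' by (rule prob')

abbreviation "cover \<equiv> flow_cover \<Gamma>"
abbreviation "\<Lambda> \<equiv> limit_set \<Gamma>"
abbreviation "orbit \<equiv> flow_orbit \<Gamma> \<sigma>"
abbreviation "lift \<equiv> restrict_space borel cover"

lemma limit_set_borel [measurable]: "\<Lambda> \<in> sets borel"
  using closed_limit_set by (rule borel_closed)

lemma cover_iff: "(x, y, s) \<in> cover \<longleftrightarrow> x \<in> \<Lambda> \<and> y \<in> \<Lambda> \<and> x \<noteq> y"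
  by (simp add: flow_cover_def distinct_pairs_def)

lemma cover_borel [measurable]: "cover \<in> sets borel"
proof -
  have "closed {v::'m \<times> 'm \<times> real. fst v \<in> \<Lambda>}"
    using closed_vimage[OF closed_limit_set, of "\<lambda>v::'m \<times> 'm \<times> real. fst v"]
    by (simp add: vimage_def continuous_on_fst continuous_on_id)
  moreover have "closed {v::'m \<times> 'm \<times> real. fst (snd v) \<in> \<Lambda>}"
    using closed_vimage[OF closed_limit_set, of "\<lambda>v::'m \<times> 'm \<times> real. fst (snd v)"]
    by (simp add: vimage_def continuous_on_fst continuous_on_snd continuous_on_id)
  ultimately have "closed {v::'m \<times> 'm \<times> real. fst v \<in> \<Lambda> \<and> fst (snd v) \<in> \<Lambda>}"
    unfolding Collect_conj_eq by (rule closed_Int)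
  moreover have "open {v::'m \<times> 'm \<times> real. fst v \<noteq> fst (snd v)}"
    by (intro open_Collect_neq continuous_intros)
  moreover have "cover = {v. fst v \<in> \<Lambda> \<and> fst (snd v) \<in> \<Lambda>} \<inter> {v. fst v \<noteq> fst (snd v)}"
    by (auto simp: flow_cover_def distinct_pairs_def)
  ultimately show ?thesis by auto
qed

lemma act_cover: "\<gamma> \<in> \<Gamma> \<Longrightarrow> flow_act \<sigma> \<gamma> v \<in> cover \<longleftrightarrow> v \<in> cover"
  by (cases v) (simp add: flow_act_def cover_iff limit_set_elem_iff elem_eq_iff)

lemma act_comp: "\<alpha> \<in> \<Gamma> \<Longrightarrow> \<beta> \<in> \<Gamma> \<Longrightarrow> flow_act \<sigma> \<alpha> (flow_act \<sigma> \<beta> v) = flow_act \<sigma> (\<alpha> \<circ> \<beta>) v"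
  by (cases v) (simp add: flow_act_def cocycle_comp)

lemma act_continuous:
  assumes "\<gamma> \<in> \<Gamma>"
  shows "continuous_on UNIV (flow_act \<sigma> \<gamma>)"
proof -
  have c1: "continuous_on UNIV (\<lambda>v::'m \<times> 'm \<times> real. fst v)"
    and c2: "continuous_on UNIV (\<lambda>v::'m \<times> 'm \<times> real. fst (snd v))"
    by (intro continuous_intros)+
  have "continuous_on UNIV (\<lambda>v::'m \<times> 'm \<times> real. \<gamma> (fst v))"
    by (rule continuous_on_compose2[OF continuous_elem[OF assms] c1]) simp
  moreover have "continuous_on UNIV (\<lambda>v::'m \<times> 'm \<times> real. \<gamma> (fst (snd v)))"
    by (rule continuous_on_compose2[OF continuous_elem[OF assms] c2]) simp
  moreover have "continuous_on UNIV (\<lambda>v::'m \<times> 'm \<times> real. \<sigma> \<gamma> (fst (snd v)))"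
    by (rule continuous_on_compose2[OF cocycle_continuous[OF assms] c2]) simp
  ultimately show ?thesis
    unfolding flow_act_eq[abs_def] by (intro continuous_intros)
qed

lemma bij_betw_right_mult:
  assumes "\<alpha> \<in> \<Gamma>"
  shows "bij_betw (\<lambda>\<gamma>. \<gamma> \<circ> \<alpha>) \<Gamma> \<Gamma>"
proof (rule bij_betw_byWitness[where f' = "\<lambda>\<gamma>. \<gamma> \<circ> inv \<alpha>"])
  show "\<forall>\<gamma>\<in>\<Gamma>. \<gamma> \<circ> \<alpha> \<circ> inv \<alpha> = \<gamma>" "\<forall>\<gamma>\<in>\<Gamma>. \<gamma> \<circ> inv \<alpha> \<circ> \<alpha> = \<gamma>"
    by (intro ballI, simp only: comp_assoc inv_elem(4,5)[OF assms] comp_id)+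
  show "(\<lambda>\<gamma>. \<gamma> \<circ> \<alpha>) ` \<Gamma> \<subseteq> \<Gamma>" using assms comp_in by blast
  show "(\<lambda>\<gamma>. \<gamma> \<circ> inv \<alpha>) ` \<Gamma> \<subseteq> \<Gamma>" using assms comp_in inv_in by blast
qed

lemma orbit_act: "\<alpha> \<in> \<Gamma> \<Longrightarrow> orbit (flow_act \<sigma> \<alpha> v) = orbit v"
proof -
  assume \<alpha>: "\<alpha> \<in> \<Gamma>"
  have "orbit (flow_act \<sigma> \<alpha> v) = (\<lambda>\<gamma>. flow_act \<sigma> \<gamma> v) ` (\<lambda>\<gamma>. \<gamma> \<circ> \<alpha>) ` \<Gamma>"
    using \<alpha> by (auto simp: flow_orbit_def act_comp image_image)
  then show ?thesis
    using bij_betw_imp_surj_on[OF bij_betw_right_mult[OF \<alpha>]] by (simp add: flow_orbit_def)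
qed

definition orbit_sum :: "('m \<times> 'm \<times> real \<Rightarrow> ennreal) \<Rightarrow> 'm \<times> 'm \<times> real \<Rightarrow> ennreal" where
  "orbit_sum f v = (\<Sum>\<^sub>\<infinity>\<gamma>\<in>\<Gamma>. f (flow_act \<sigma> \<gamma> v))"

lemma orbit_sum_act:
  assumes "\<alpha> \<in> \<Gamma>"
  shows "orbit_sum f (flow_act \<sigma> \<alpha> v) = orbit_sum f v"
proof -
  have "orbit_sum f (flow_act \<sigma> \<alpha> v) = (\<Sum>\<^sub>\<infinity>\<gamma>\<in>\<Gamma>. f (flow_act \<sigma> (\<gamma> \<circ> \<alpha>) v))"
    unfolding orbit_sum_def using assms by (intro infsum_cong) (simp only: act_comp)
  also have "\<dots> = orbit_sum f v"
    unfolding orbit_sum_def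
    by (rule infsum_reindex_bij_betw[OF bij_betw_right_mult[OF assms], of "\<lambda>\<gamma>. f (flow_act \<sigma> \<gamma> v)"])
  finally show ?thesis .
qed

lemma the_elem_orbit_sum: "the_elem (orbit_sum f ` orbit v) = orbit_sum f v"
proof -
  have "orbit_sum f ` orbit v = {orbit_sum f v}"
    using id_in by (auto simp: flow_orbit_def orbit_sum_act image_image)
  then show ?thesis by simp
qed

lemma space_m: "space m = flow_space \<Gamma> \<sigma>"
  and sets_m: "sets m = sigma_sets (flow_space \<Gamma> \<sigma>) {W. openin (flow_topology \<Gamma> \<sigma>) W}"
  and opens_m: "{W. openin (flow_topology \<Gamma> \<sigma>) W} \<subseteq> Pow (flow_space \<Gamma> \<sigma>)"
proof -
  have "topspace (flow_topology \<Gamma> \<sigma>) = flow_space \<Gamma> \<sigma>"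
    using quotient_imp_surjective_map[OF quotient_map_flow_orbit[of \<Gamma> \<sigma>]]
    by (simp add: flow_space_def)
  then show *: "{W. openin (flow_topology \<Gamma> \<sigma>) W} \<subseteq> Pow (flow_space \<Gamma> \<sigma>)"
    using openin_subset by fastforce
  have **: "sets m = sets (sigma (flow_space \<Gamma> \<sigma>) {W. openin (flow_topology \<Gamma> \<sigma>) W})"
    using BMS by (simp add: BMS_measure_def)
  then show "sets m = sigma_sets (flow_space \<Gamma> \<sigma>) {W. openin (flow_topology \<Gamma> \<sigma>) W}"
    using * by simp
  show "space m = flow_space \<Gamma> \<sigma>" using sets_eq_imp_space_eq[OF **] * by simp
qed

lemma openin_flow_topology:
  "openin (flow_topology \<Gamma> \<sigma>) W \<longleftrightarrow>
     W \<subseteq> flow_space \<Gamma> \<sigma> \<and> openin (top_of_set cover) {v \<in> cover. orbit v \<in> W}"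
proof -
  have "topspace (flow_topology \<Gamma> \<sigma>) = flow_space \<Gamma> \<sigma>"
    using quotient_imp_surjective_map[OF quotient_map_flow_orbit[of \<Gamma> \<sigma>]]
    by (simp add: flow_space_def)
  then show ?thesis
    using quotient_map_flow_orbit[of \<Gamma> \<sigma>] openin_subset[of "flow_topology \<Gamma> \<sigma>" W]
    unfolding quotient_map_def by auto
qed

lemma orbit_measurable [measurable]: "orbit \<in> measurable lift m"
proof (rule measurable_sigma_sets[OF sets_m[folded space_m] opens_m[folded space_m]])
  show "orbit \<in> space lift \<rightarrow> space m" by (auto simp: space_restrict_space space_m flow_space_def)
  fix W assume "W \<in> {W. openin (flow_topology \<Gamma> \<sigma>) W}"
  then have "openin (top_of_set cover) {v \<in> cover. orbit v \<in> W}" by (simp add: openin_flow_topology)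
  then obtain U where "open U" "{v \<in> cover. orbit v \<in> W} = cover \<inter> U" by (auto simp: openin_open)
  moreover have "orbit -` W \<inter> space lift = {v \<in> cover. orbit v \<in> W}" by (auto simp: space_restrict_space)
  ultimately show "orbit -` W \<inter> space lift \<in> sets lift" by (auto simp: sets_restrict_space)
qed

abbreviation "base \<equiv> \<mu>' \<Otimes>\<^sub>M (\<mu> \<Otimes>\<^sub>M (lborel :: real measure))"
abbreviation "Bm \<equiv> BMS_cover_measure \<Gamma> G \<delta> \<mu>' \<mu>"
abbreviation "dens \<equiv> (\<lambda>(x, y, s::real). ennreal (exp (\<delta> * G (x, y))))"

lemma sets_base [measurable_cong]: "sets base = sets borel"
proof -
  have "sets (\<mu> \<Otimes>\<^sub>M (lborel :: real measure)) = sets (borel \<Otimes>\<^sub>M borel)"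
    by (rule sets_pair_measure_cong[OF sets_\<mu> sets_lborel])
  then have "sets base = sets (borel \<Otimes>\<^sub>M (borel \<Otimes>\<^sub>M borel))"
    by (rule sets_pair_measure_cong[OF sets_\<mu>'])
  then show ?thesis by (simp only: borel_prod)
qed

lemma space_base [simp]: "space base = UNIV"
  using sets_eq_imp_space_eq[OF sets_base] by simp

lemma sets_restrict_base: "sets (restrict_space base cover) = sets lift"
  by (rule sets_restrict_space_cong[OF sets_base])

lemma dens_measurable: "dens \<in> borel_measurable lift"
proof -
  have "continuous_on cover (\<lambda>v. G (fst v, fst (snd v)))"
    by (rule continuous_on_compose2[OF G_continuous])
      (auto intro!: continuous_intros simp: flow_cover_def distinct_pairs_def)
  then have "(\<lambda>v. G (fst v, fst (snd v))) \<in> borel_measurable lift"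
    by (rule borel_measurable_continuous_on_restrict)
  then have "(\<lambda>v. ennreal (exp (\<delta> * G (fst v, fst (snd v))))) \<in> borel_measurable lift" by measurable
  then show ?thesis by (simp add: case_prod_beta')
qed

lemma dens_base: "dens \<in> borel_measurable (restrict_space base cover)"
  using dens_measurable by (simp only: measurable_cong_sets[OF sets_restrict_base refl])

lemma dens_times: "f \<in> borel_measurable lift \<Longrightarrow> (\<lambda>v. dens v * f v) \<in> borel_measurable lift"
  by (rule borel_measurable_times_ennreal[OF dens_measurable])

lemma sets_Bm [measurable_cong]: "sets Bm = sets lift"
  by (simp add: BMS_cover_measure_def sets_restrict_base)

lemma AE_Bm_iff: "(AE v in Bm. Q v) \<longleftrightarrow> (AE v in base. v \<in> cover \<longrightarrow> Q v)"
proof -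
  have c: "cover \<inter> space base \<in> sets base" unfolding sets_base space_base by measurable
  show ?thesis
    unfolding BMS_cover_measure_def
    by (subst AE_density[OF dens_base], subst AE_restrict_space_iff[OF c]) (simp add: case_prod_beta')
qed

lemma nn_integral_Bm:
  assumes f: "f \<in> borel_measurable lift"
  shows "(\<integral>\<^sup>+v. f v \<partial>Bm) = (\<integral>\<^sup>+x. \<integral>\<^sup>+y. \<integral>\<^sup>+s. dens (x, y, s) * f (x, y, s) * indicator cover (x, y, s) \<partial>lborel \<partial>\<mu> \<partial>\<mu>')"
proof -
  have c: "cover \<inter> space base \<in> sets base" unfolding sets_base space_base by measurable
  have m1: "(\<lambda>v. dens v * f v) \<in> borel_measurable lift" using f by (rule dens_times)
  then have m2: "(\<lambda>v. dens v * f v * indicator cover v) \<in> borel_measurable base"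
    using borel_measurable_restrict_space_iff_ennreal[of cover borel "\<lambda>v. dens v * f v"]
      measurable_cong_sets[OF sets_base refl, of borel] by simp
  have "(\<integral>\<^sup>+v. f v \<partial>Bm) = (\<integral>\<^sup>+v. dens v * f v \<partial>restrict_space base cover)"
    unfolding BMS_cover_measure_def
    by (rule nn_integral_density[OF dens_base])
      (use f in \<open>simp only: measurable_cong_sets[OF sets_restrict_base refl]\<close>)
  also have "\<dots> = (\<integral>\<^sup>+v. dens v * f v * indicator cover v \<partial>base)"
    by (rule nn_integral_restrict_space[OF c])
  also have "\<dots> = (\<integral>\<^sup>+x. \<integral>\<^sup>+u. dens (x, u) * f (x, u) * indicator cover (x, u) \<partial>(\<mu> \<Otimes>\<^sub>M lborel) \<partial>\<mu>')"
  proof -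
    interpret Q: pair_sigma_finite \<mu> "lborel :: real measure" ..
    show ?thesis
      using Q.nn_integral_fst[OF m2] by (simp del: split_paired_All)
  qed
  also have "\<dots> = (\<integral>\<^sup>+x. \<integral>\<^sup>+y. \<integral>\<^sup>+s. dens (x, y, s) * f (x, y, s) * indicator cover (x, y, s) \<partial>lborel \<partial>\<mu> \<partial>\<mu>')"
  proof (rule nn_integral_cong)
    fix x assume "x \<in> space \<mu>'"
    then have "(\<lambda>u. dens (x, u) * f (x, u) * indicator cover (x, u)) \<in> borel_measurable (\<mu> \<Otimes>\<^sub>M lborel)"
      using measurable_compose[OF measurable_Pair1' m2, of x] by (simp add: comp_def)
    from lborel.nn_integral_fst[OF this]
    show "(\<integral>\<^sup>+u. dens (x, u) * f (x, u) * indicator cover (x, u) \<partial>(\<mu> \<Otimes>\<^sub>M lborel)) =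
      (\<integral>\<^sup>+y. \<integral>\<^sup>+s. dens (x, y, s) * f (x, y, s) * indicator cover (x, y, s) \<partial>lborel \<partial>\<mu>)"
      by simp
  qed
  finally show ?thesis .
qed

lemma tilde_cover: "flow_tilde t v \<in> cover \<longleftrightarrow> v \<in> cover"
  by (cases v) (simp add: flow_tilde_def cover_iff)

lemma tilde_measurable [measurable]: "flow_tilde t \<in> measurable lift lift"
proof (rule measurable_restrict_space3)
  show "flow_tilde t \<in> borel_measurable (borel :: ('m \<times> 'm \<times> real) measure)"
    unfolding flow_tilde_def case_prod_beta'
    by (intro borel_measurable_continuous_onI continuous_intros)
  show "flow_tilde t \<in> cover \<rightarrow> cover" by (simp add: Pi_iff tilde_cover)
qed

lemma act_measurable [measurable]:
  assumes "\<gamma> \<in> \<Gamma>"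
  shows "flow_act \<sigma> \<gamma> \<in> measurable lift lift"
proof (rule measurable_restrict_space3)
  show "flow_act \<sigma> \<gamma> \<in> borel_measurable (borel :: ('m \<times> 'm \<times> real) measure)"
    by (rule borel_measurable_continuous_onI[OF act_continuous[OF assms]])
  show "flow_act \<sigma> \<gamma> \<in> cover \<rightarrow> cover" by (simp add: Pi_iff act_cover assms)
qed

text \<open>
  The density depends on the first two coordinates only, and Lebesgue measure is translation invariant.
\<close>

lemma nn_integral_Bm_tilde:
  assumes f: "f \<in> borel_measurable lift"
  shows "(\<integral>\<^sup>+v. f (flow_tilde t v) \<partial>Bm) = (\<integral>\<^sup>+v. f v \<partial>Bm)"
proof -
  have f': "(\<lambda>v. f (flow_tilde t v)) \<in> borel_measurable lift"
    using measurable_comp[OF tilde_measurable[of t] f] by (simp only: comp_def)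
  have "(\<lambda>v. dens v * f v) \<in> borel_measurable lift" using f by (rule dens_times)
  then have m2: "(\<lambda>v. dens v * f v * indicator cover v) \<in> borel_measurable borel"
    by (subst (asm) borel_measurable_restrict_space_iff_ennreal) simp_all
  have "(\<integral>\<^sup>+s. dens (x, y, s) * f (flow_tilde t (x, y, s)) * indicator cover (x, y, s) \<partial>lborel)
      = (\<integral>\<^sup>+s. dens (x, y, s) * f (x, y, s) * indicator cover (x, y, s) \<partial>lborel)" for x y
  proof -
    have meas: "(\<lambda>s. dens (x, y, s) * f (x, y, s) * indicator cover (x, y, s)) \<in> borel_measurable borel"
      by (rule measurable_compose[OF _ m2])
        (intro borel_measurable_continuous_onI continuous_intros)
    have "(\<integral>\<^sup>+s. dens (x, y, s) * f (x, y, s) * indicator cover (x, y, s) \<partial>lborel)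
       = (\<integral>\<^sup>+s. dens (x, y, t + s) * f (x, y, t + s) * indicator cover (x, y, t + s) \<partial>lborel)"
      using nn_integral_real_affine[OF meas, of 1 t] by simp
    also have "\<dots> = (\<integral>\<^sup>+s. dens (x, y, s) * f (flow_tilde t (x, y, s)) * indicator cover (x, y, s) \<partial>lborel)"
      by (simp add: flow_tilde_def indicator_def cover_iff add.commute)
    finally show ?thesis by simp
  qed
  then show ?thesis by (simp only: nn_integral_Bm[OF f] nn_integral_Bm[OF f'])
qed

text \<open>
  The defining property of the quotient measure, applied to \<open>v \<mapsto> h (orbit v) * f v\<close>: the factor
  \<open>h (orbit v)\<close> is constant along orbits and comes out of the sum.
\<close>

lemma bms_formula:
  assumes h: "h \<in> borel_measurable m" and f: "f \<in> borel_measurable lift"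
  shows "(\<integral>\<^sup>+v. h (orbit v) * f v \<partial>Bm) = (\<integral>\<^sup>+c. h c * the_elem (orbit_sum f ` c) \<partial>m)"
proof -
  have meas: "(\<lambda>v. h (orbit v) * f v) \<in> borel_measurable lift"
    by (rule borel_measurable_times_ennreal[OF _ f])
      (use measurable_comp[OF orbit_measurable h] in \<open>simp only: comp_def\<close>)
  have "(\<integral>\<^sup>+c. h c * the_elem (orbit_sum f ` c) \<partial>m)
     = (\<integral>\<^sup>+c. the_elem (orbit_sum (\<lambda>v. h (orbit v) * f v) ` c) \<partial>m)"
  proof (rule nn_integral_cong)
    fix c assume "c \<in> space m"
    then obtain v where c: "c = orbit v" by (auto simp: space_m flow_space_def)
    have "orbit_sum (\<lambda>v. h (orbit v) * f v) v = h (orbit v) * orbit_sum f v"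
      unfolding orbit_sum_def infsum_cmult_ennreal[symmetric]
      by (rule infsum_cong) (simp add: orbit_act)
    then show "h c * the_elem (orbit_sum f ` c) = the_elem (orbit_sum (\<lambda>v. h (orbit v) * f v) ` c)"
      by (simp add: c the_elem_orbit_sum)
  qed
  also have "\<dots> = (\<integral>\<^sup>+v. h (orbit v) * f v \<partial>Bm)"
    using bspec[OF conjunct2[OF BMS[unfolded BMS_measure_def]] meas]
    by (simp only: orbit_sum_def[abs_def])
  finally show ?thesis by simp
qed

end


section \<open>A fundamental weight for the action\<close>

context bms_flow
begin

text \<open>
  A countable exhaustion of the cover by compact sets, to which \<open>finite_returns\<close> applies.
\<close>

definition level :: "nat \<Rightarrow> ('m \<times> 'm \<times> real) set" where
  "level n = {(x, y, s). x \<in> \<Lambda> \<and> y \<in> \<Lambda> \<and> 1 / real (Suc n) \<le> dist x y \<and> \<bar>s\<bar> \<le> real n}"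

lemma compact_level: "compact (level n)"
proof -
  have "level n = (UNIV \<times> UNIV \<times> {- real n..real n}) \<inter>
     ({v. fst v \<in> \<Lambda>} \<inter> ({v. fst (snd v) \<in> \<Lambda>} \<inter> {v. 1 / real (Suc n) \<le> dist (fst v) (fst (snd v))}))"
    unfolding level_def by (auto simp: abs_le_iff)
  moreover have "closed {v::'m \<times> 'm \<times> real. fst v \<in> \<Lambda>}"
    using closed_vimage[OF closed_limit_set, of "\<lambda>v::'m \<times> 'm \<times> real. fst v"]
    by (simp add: vimage_def continuous_on_fst continuous_on_id)
  moreover have "closed {v::'m \<times> 'm \<times> real. fst (snd v) \<in> \<Lambda>}"
    using closed_vimage[OF closed_limit_set, of "\<lambda>v::'m \<times> 'm \<times> real. fst (snd v)"]
    by (simp add: vimage_def continuous_on_fst continuous_on_snd continuous_on_id)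
  moreover have "closed {v::'m \<times> 'm \<times> real. 1 / real (Suc n) \<le> dist (fst v) (fst (snd v))}"
    by (intro closed_Collect_le continuous_intros)
  moreover have "compact ((UNIV :: 'm set) \<times> (UNIV :: 'm set) \<times> {- real n..real n})"
    by (intro compact_Times compact_M compact_Icc)
  ultimately show ?thesis by (simp add: compact_Int_closed closed_Int)
qed

lemma level_distinct: "(x, y, s) \<in> level n \<Longrightarrow> x \<noteq> y"
  by (auto simp: level_def)

lemma level_exhausts: "v \<in> cover \<Longrightarrow> \<exists>n. v \<in> level n"
proof (cases v)
  fix x y s assume "v \<in> cover" and v: "v = (x, y, s)"
  then have xy: "x \<in> \<Lambda>" "y \<in> \<Lambda>" "x \<noteq> y" by (simp_all add: cover_iff)
  obtain k where k: "k \<noteq> 0" "inverse (real k) < dist x y"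
    using real_arch_inverse[of "dist x y"] xy by auto
  obtain l where l: "\<bar>s\<bar> \<le> real l" using real_arch_simple by blast
  have "1 / real (Suc (max k l)) \<le> inverse (real k)"
    using k by (simp add: inverse_eq_divide frac_le)
  then have "v \<in> level (max k l)" using xy k l by (simp add: level_def v)
  then show ?thesis ..
qed

text \<open>
  The points in the lowest level that is visited by their orbit. Every orbit has such points, and
  finitely many group elements lead to them (\<open>first_hits_finite\<close>): two of these points belong to the
  same level, so they differ by an element returning to a compact set.
\<close>

definition first_hits :: "('m \<times> 'm \<times> real) set" where
  "first_hits = (\<Union>n. level n - (\<Union>j<n. \<Union>\<gamma>\<in>\<Gamma>. flow_act \<sigma> \<gamma> -` level j))"

lemma first_hits_borel [measurable]: "first_hits \<in> sets borel"
proof -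
  have lev: "level n \<in> sets borel" for n using compact_level by (rule borel_compact)
  have "flow_act \<sigma> \<gamma> -` level j \<in> sets borel" if "\<gamma> \<in> \<Gamma>" for \<gamma> j
    using measurable_sets[OF borel_measurable_continuous_onI[OF act_continuous[OF that]] lev] by simp
  then have "(\<Union>\<gamma>\<in>\<Gamma>. flow_act \<sigma> \<gamma> -` level j) \<in> sets borel" for j
    using countable_group by (intro sets.countable_UN') auto
  then have "(\<Union>j<n. \<Union>\<gamma>\<in>\<Gamma>. flow_act \<sigma> \<gamma> -` level j) \<in> sets borel" for n
    by (intro sets.finite_UN[OF finite_lessThan])
  then have "level n - (\<Union>j<n. \<Union>\<gamma>\<in>\<Gamma>. flow_act \<sigma> \<gamma> -` level j) \<in> sets borel" for n
    using lev by blast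
  then show ?thesis unfolding first_hits_def by blast
qed

lemma first_hitsD:
  assumes "v \<in> first_hits"
  shows "\<exists>n. v \<in> level n \<and> (\<forall>j<n. \<forall>\<gamma>\<in>\<Gamma>. flow_act \<sigma> \<gamma> v \<notin> level j)"
  using assms by (simp add: first_hits_def) blast

lemma first_hits_nonempty:
  assumes "v \<in> cover"
  shows "\<exists>\<gamma>\<in>\<Gamma>. flow_act \<sigma> \<gamma> v \<in> first_hits"
proof -
  define Q where "Q n \<longleftrightarrow> (\<exists>\<gamma>\<in>\<Gamma>. flow_act \<sigma> \<gamma> v \<in> level n)" for n
  obtain n0 where "flow_act \<sigma> id v \<in> level n0"
    using level_exhausts[of "flow_act \<sigma> id v"] act_cover[OF id_in] assms by blast
  then have "Q n0" using id_in by (auto simp: Q_def)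
  define n where "n = (LEAST n. Q n)"
  have "Q n" unfolding n_def using \<open>Q n0\<close> by (rule LeastI)
  then obtain \<gamma> where \<gamma>: "\<gamma> \<in> \<Gamma>" "flow_act \<sigma> \<gamma> v \<in> level n" by (auto simp: Q_def)
  have "flow_act \<sigma> \<beta> (flow_act \<sigma> \<gamma> v) \<notin> level j" if "j < n" "\<beta> \<in> \<Gamma>" for j \<beta>
  proof -
    have "\<not> Q j" using not_less_Least that(1) unfolding n_def by blast
    then show ?thesis using that(2) \<gamma>(1) by (auto simp: Q_def act_comp comp_in)
  qed
  then show ?thesis using \<gamma> unfolding first_hits_def by blast
qed

lemma first_hits_finite: "finite {\<gamma>\<in>\<Gamma>. flow_act \<sigma> \<gamma> v \<in> first_hits}"
proof (cases "{\<gamma>\<in>\<Gamma>. flow_act \<sigma> \<gamma> v \<in> first_hits} = {}")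
  case False
  then obtain \<alpha> where "\<alpha> \<in> \<Gamma>" "flow_act \<sigma> \<alpha> v \<in> first_hits" by auto
  with first_hitsD[of "flow_act \<sigma> \<alpha> v"]
  obtain n where \<alpha>: "\<alpha> \<in> \<Gamma>" "flow_act \<sigma> \<alpha> v \<in> level n"
    and first: "\<And>j \<beta>. j < n \<Longrightarrow> \<beta> \<in> \<Gamma> \<Longrightarrow> flow_act \<sigma> \<beta> (flow_act \<sigma> \<alpha> v) \<notin> level j"
    by auto
  define R where "R = {\<gamma>\<in>\<Gamma>. \<exists>u\<in>level n. flow_act \<sigma> \<gamma> u \<in> level n}"
  have R: "finite R" unfolding R_def by (rule finite_returns[OF compact_level level_distinct])
  have "{\<gamma>\<in>\<Gamma>. flow_act \<sigma> \<gamma> v \<in> first_hits} \<subseteq> (\<lambda>\<beta>. \<beta> \<circ> \<alpha>) ` R"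
  proof
    fix \<gamma> assume "\<gamma> \<in> {\<gamma>\<in>\<Gamma>. flow_act \<sigma> \<gamma> v \<in> first_hits}"
    then obtain k where \<gamma>: "\<gamma> \<in> \<Gamma>" "flow_act \<sigma> \<gamma> v \<in> level k"
      and first': "\<And>j \<beta>. j < k \<Longrightarrow> \<beta> \<in> \<Gamma> \<Longrightarrow> flow_act \<sigma> \<beta> (flow_act \<sigma> \<gamma> v) \<notin> level j"
      using first_hitsD[of "flow_act \<sigma> \<gamma> v"] by auto
    have g1: "flow_act \<sigma> (\<gamma> \<circ> inv \<alpha>) (flow_act \<sigma> \<alpha> v) = flow_act \<sigma> \<gamma> v"
      using \<alpha>(1) \<gamma>(1) by (simp add: act_comp comp_in inv_in comp_assoc)
    have g2: "flow_act \<sigma> (\<alpha> \<circ> inv \<gamma>) (flow_act \<sigma> \<gamma> v) = flow_act \<sigma> \<alpha> v"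
      using \<alpha>(1) \<gamma>(1) by (simp add: act_comp comp_in inv_in comp_assoc)
    have "\<not> k < n" using first[of k "\<gamma> \<circ> inv \<alpha>"] \<gamma> \<alpha>(1) g1 comp_in inv_in by auto
    moreover have "\<not> n < k" using first'[of n "\<alpha> \<circ> inv \<gamma>"] \<gamma> \<alpha> g2 comp_in inv_in by auto
    ultimately have "k = n" by simp
    then have "\<gamma> \<circ> inv \<alpha> \<in> R"
      unfolding R_def using \<alpha> \<gamma> g1 comp_in inv_in by (intro CollectI conjI bexI[of _ "flow_act \<sigma> \<alpha> v"]) auto
    moreover have "\<gamma> = (\<gamma> \<circ> inv \<alpha>) \<circ> \<alpha>" using \<alpha>(1) by (simp add: comp_assoc)
    ultimately show "\<gamma> \<in> (\<lambda>\<beta>. \<beta> \<circ> \<alpha>) ` R" by (rule rev_image_eqI[where f = "\<lambda>\<beta>. \<beta> \<circ> \<alpha>"])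
  qed
  then show ?thesis using R finite_surj by blast
next
  case True
  then show ?thesis by (simp only: finite.emptyI)
qed

lemma orbit_sum_measurable:
  assumes f: "f \<in> borel_measurable lift"
  shows "orbit_sum f \<in> borel_measurable lift"
proof -
  have "orbit_sum f = (\<lambda>v. SUP F\<in>{F. finite F \<and> F \<subseteq> \<Gamma>}. \<Sum>\<gamma>\<in>F. f (flow_act \<sigma> \<gamma> v))"
    unfolding orbit_sum_def by (intro ext nonneg_infsum_complete) simp
  moreover have "(\<lambda>v. \<Sum>\<gamma>\<in>F. f (flow_act \<sigma> \<gamma> v)) \<in> borel_measurable lift"
    if "F \<in> {F. finite F \<and> F \<subseteq> \<Gamma>}" for F
  proof (rule borel_measurable_sum)
    fix \<gamma> assume "\<gamma> \<in> F"
    then have "\<gamma> \<in> \<Gamma>" using that by auto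
    from measurable_comp[OF act_measurable[OF this] f]
    show "(\<lambda>v. f (flow_act \<sigma> \<gamma> v)) \<in> borel_measurable lift" by (simp only: comp_def)
  qed
  ultimately show ?thesis
    using countable_Collect_finite_subset[OF countable_group] by (simp only: borel_measurable_SUP)
qed

lemma orbit_sum_first_hits:
  assumes "v \<in> cover"
  shows "orbit_sum (indicator first_hits) v \<noteq> 0" "orbit_sum (indicator first_hits) v \<noteq> \<infinity>"
proof -
  let ?R = "{\<gamma>\<in>\<Gamma>. flow_act \<sigma> \<gamma> v \<in> first_hits}"
  have "orbit_sum (indicator first_hits) v = (\<Sum>\<^sub>\<infinity>\<gamma>\<in>?R. 1)"
    unfolding orbit_sum_def by (rule infsum_cong_neutral) auto
  also have "\<dots> = of_nat (card ?R)" using first_hits_finite[of v] by simp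
  finally have eq: "orbit_sum (indicator first_hits) v = of_nat (card ?R)" .
  have "card ?R \<noteq> 0" using first_hits_nonempty[OF assms] first_hits_finite[of v] by auto
  then show "orbit_sum (indicator first_hits) v \<noteq> 0" "orbit_sum (indicator first_hits) v \<noteq> \<infinity>"
    by (simp_all add: eq)
qed

text \<open>
  A substitute for the indicator of a fundamental domain that allows for nontrivial stabilisers.
\<close>

definition weight :: "'m \<times> 'm \<times> real \<Rightarrow> ennreal" where
  "weight v = indicator first_hits v / orbit_sum (indicator first_hits) v"

lemma first_hits_indicator_measurable: "(indicator first_hits :: _ \<Rightarrow> ennreal) \<in> borel_measurable lift"
  by (rule measurable_restrict_space1) (rule borel_measurable_indicator[OF first_hits_borel])

lemma weight_measurable: "weight \<in> borel_measurable lift"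
  unfolding weight_def[abs_def]
  by (intro borel_measurable_divide_ennreal first_hits_indicator_measurable orbit_sum_measurable)

lemma orbit_sum_weight:
  assumes "v \<in> cover"
  shows "orbit_sum weight v = 1"
proof -
  let ?S = "orbit_sum (indicator first_hits) v"
  have "orbit_sum weight v = (\<Sum>\<^sub>\<infinity>\<gamma>\<in>\<Gamma>. inverse ?S * indicator first_hits (flow_act \<sigma> \<gamma> v))"
    unfolding orbit_sum_def[of weight]
    by (rule infsum_cong) (simp add: weight_def orbit_sum_act divide_ennreal_def mult.commute)
  also have "\<dots> = ?S / ?S"
    unfolding infsum_cmult_ennreal by (simp add: orbit_sum_def divide_ennreal_def mult.commute)
  also have "\<dots> = 1" using orbit_sum_first_hits[OF assms] by (simp add: ennreal_divide_self top.not_eq_extremum)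
  finally show ?thesis .
qed

lemma m_formula:
  assumes h: "h \<in> borel_measurable m"
  shows "(\<integral>\<^sup>+c. h c \<partial>m) = (\<integral>\<^sup>+v. h (orbit v) * weight v \<partial>Bm)"
  unfolding bms_formula[OF h weight_measurable]
  by (rule nn_integral_cong) (auto simp: space_m flow_space_def the_elem_orbit_sum orbit_sum_weight)

lemma tilde_act: "flow_tilde t (flow_act \<sigma> \<gamma> v) = flow_act \<sigma> \<gamma> (flow_tilde t v)"
  by (cases v) (simp add: flow_tilde_def flow_act_def)

lemma tilde_tilde: "flow_tilde s (flow_tilde t v) = flow_tilde (s + t) v"
  by (cases v) (simp add: flow_tilde_def)

lemma tilde_zero: "flow_tilde 0 v = v"
  by (cases v) (simp add: flow_tilde_def)

lemma flow_measurable: "flow t \<in> measurable m m"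
proof (rule measurable_sigma_sets[OF sets_m[folded space_m] opens_m[folded space_m]])
  show "flow t \<in> space m \<rightarrow> space m"
    by (auto simp: space_m flow_space_def flow_flow_orbit tilde_cover)
  fix W assume "W \<in> {W. openin (flow_topology \<Gamma> \<sigma>) W}"
  then have "openin (top_of_set cover) {v \<in> cover. orbit v \<in> W}" by (simp add: openin_flow_topology)
  then obtain U where U: "open U" "{v \<in> cover. orbit v \<in> W} = cover \<inter> U" by (auto simp: openin_open)
  have "continuous_on UNIV (flow_tilde t :: 'm \<times> 'm \<times> real \<Rightarrow> _)"
    unfolding flow_tilde_def case_prod_beta' by (intro continuous_intros)
  then have "open (flow_tilde t -` U)" using U(1) by (simp add: open_vimage)
  moreover have "{v \<in> cover. orbit v \<in> flow t -` W \<inter> space m} = cover \<inter> flow_tilde t -` U"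
  proof -
    have "orbit v \<in> flow t -` W \<inter> space m \<longleftrightarrow> flow_tilde t v \<in> U" if "v \<in> cover" for v
    proof -
      have "orbit v \<in> flow t -` W \<inter> space m \<longleftrightarrow> orbit (flow_tilde t v) \<in> W"
        using that by (simp add: space_m flow_space_def flow_flow_orbit)
      also have "\<dots> \<longleftrightarrow> flow_tilde t v \<in> {v \<in> cover. orbit v \<in> W}" using that by (simp add: tilde_cover)
      also have "\<dots> \<longleftrightarrow> flow_tilde t v \<in> U" using that by (simp add: U(2) tilde_cover)
      finally show ?thesis .
    qed
    then show ?thesis by blast
  qed
  ultimately have "openin (top_of_set cover) {v \<in> cover. orbit v \<in> flow t -` W \<inter> space m}"
    by (auto simp: openin_open)
  then have "openin (flow_topology \<Gamma> \<sigma>) (flow t -` W \<inter> space m)"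
    by (simp add: openin_flow_topology space_m)
  then show "flow t -` W \<inter> space m \<in> sets m" by (simp add: sets_m)
qed

text \<open>
  The translate of \<open>weight\<close> under the flow has orbit sums \<open>1\<close> as well, because the flow commutes with
  \<open>\<Gamma>\<close>; so it represents the same quotient measure.
\<close>

lemma flow_preserves: "distr m m (flow t) = m"
proof (rule measure_eqI)
  fix E assume "E \<in> sets (distr m m (flow t))"
  then have E: "E \<in> sets m" by simp
  then have i1: "(indicator E :: _ \<Rightarrow> ennreal) \<in> borel_measurable m" by (rule borel_measurable_indicator)
  have i2: "(\<lambda>c. indicator E (flow t c) :: ennreal) \<in> borel_measurable m"
    using measurable_comp[OF flow_measurable i1] by (simp only: comp_def)
  have w: "(\<lambda>v. weight (flow_tilde (- t) v)) \<in> borel_measurable lift"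
    using measurable_comp[OF tilde_measurable weight_measurable] by (simp only: comp_def)
  have f: "(\<lambda>v. indicator E (orbit v) * weight (flow_tilde (- t) v)) \<in> borel_measurable lift"
    by (rule borel_measurable_times_ennreal[OF _ w])
      (use measurable_comp[OF orbit_measurable i1] in \<open>simp only: comp_def\<close>)
  have "emeasure (distr m m (flow t)) E = (\<integral>\<^sup>+c. indicator E c \<partial>distr m m (flow t))"
    using E by simp
  also have "\<dots> = (\<integral>\<^sup>+c. indicator E (flow t c) \<partial>m)"
    by (rule nn_integral_distr[OF flow_measurable]) (use i1 in simp)
  also have "\<dots> = (\<integral>\<^sup>+v. indicator E (flow t (orbit v)) * weight v \<partial>Bm)"
    by (rule m_formula[OF i2])
  also have "\<dots> = (\<integral>\<^sup>+v. indicator E (orbit (flow_tilde t v)) * weight (flow_tilde (- t) (flow_tilde t v)) \<partial>Bm)"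
    by (simp only: flow_flow_orbit tilde_tilde) (simp add: tilde_zero)
  also have "\<dots> = (\<integral>\<^sup>+v. indicator E (orbit v) * weight (flow_tilde (- t) v) \<partial>Bm)"
    by (rule nn_integral_Bm_tilde[OF f])
  also have "\<dots> = (\<integral>\<^sup>+c. indicator E c * the_elem (orbit_sum (\<lambda>v. weight (flow_tilde (- t) v)) ` c) \<partial>m)"
    by (rule bms_formula[OF i1 w])
  also have "\<dots> = (\<integral>\<^sup>+c. indicator E c \<partial>m)"
  proof (rule nn_integral_cong)
    fix c assume "c \<in> space m"
    then obtain v where v: "v \<in> cover" "c = orbit v" by (auto simp: space_m flow_space_def)
    have "orbit_sum (\<lambda>v. weight (flow_tilde (- t) v)) v = orbit_sum weight (flow_tilde (- t) v)"
      by (simp add: orbit_sum_def tilde_act)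
    also have "\<dots> = 1" using v(1) by (intro orbit_sum_weight) (simp add: tilde_cover)
    finally show "indicator E c * the_elem (orbit_sum (\<lambda>v. weight (flow_tilde (- t) v)) ` c) = (indicator E c :: ennreal)"
      by (simp add: v(2) the_elem_orbit_sum)
  qed
  also have "\<dots> = emeasure m E" using E by simp
  finally show "emeasure (distr m m (flow t)) E = emeasure m E" .
qed simp

sublocale measure_preserving_flow m flow
proof (intro measure_preserving_flow.intro measure_preserving_flow_axioms.intro fin_m
    flow_measurable flow_preserves)
  fix c :: "('m \<times> 'm \<times> real) set"
  show "flow s (flow t c) = flow (s + t) c" for s t
    by (simp add: flow_def image_image tilde_tilde)
  show "flow 0 c = c" by (simp add: flow_def tilde_zero)
qed

text \<open>
  From left to right, the lift of a null set is unfolded with the constant weight \<open>1\<close>, whose orbit sums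
  may be infinite; from right to left, with \<open>weight\<close>.
\<close>

lemma null_iff_AE_base:
  assumes E: "E \<in> sets m"
  shows "emeasure m E = 0 \<longleftrightarrow> (AE v in base. v \<in> cover \<longrightarrow> orbit v \<notin> E)"
proof -
  have i1: "(indicator E :: _ \<Rightarrow> ennreal) \<in> borel_measurable m" using E by (rule borel_measurable_indicator)
  have i2: "(\<lambda>v. indicator E (orbit v) :: ennreal) \<in> borel_measurable Bm"
    using measurable_comp[OF orbit_measurable i1]
    by (simp only: comp_def measurable_cong_sets[OF sets_Bm refl])
  have "emeasure m E = 0 \<longleftrightarrow> (AE v in Bm. orbit v \<notin> E)"
  proof
    assume null: "emeasure m E = 0"
    have one: "(\<lambda>_. 1 :: ennreal) \<in> borel_measurable lift" by simp
    have "(\<integral>\<^sup>+v. indicator E (orbit v) * 1 \<partial>Bm) = (\<integral>\<^sup>+c. indicator E c * the_elem (orbit_sum (\<lambda>_. 1) ` c) \<partial>m)"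
      by (rule bms_formula[OF i1 one])
    also have "\<dots> = (\<integral>\<^sup>+c. 0 \<partial>m)"
    proof (rule nn_integral_cong_AE)
      have "AE c in m. c \<notin> E" using AE_iff_null_sets[OF E] null E by (auto simp: null_sets_def)
      then show "AE c in m. indicator E c * the_elem (orbit_sum (\<lambda>_. 1) ` c) = (0 :: ennreal)"
        by (rule AE_mp) (auto intro!: AE_I2)
    qed
    finally have "(\<integral>\<^sup>+v. indicator E (orbit v) \<partial>Bm) = 0" by simp
    then have "AE v in Bm. indicator E (orbit v) = (0 :: ennreal)"
      by (simp only: nn_integral_0_iff_AE[OF i2])
    then show "AE v in Bm. orbit v \<notin> E"
      by (rule AE_mp) (auto intro!: AE_I2 simp: indicator_def split: if_splits)
  next
    assume ae: "AE v in Bm. orbit v \<notin> E"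
    have "emeasure m E = (\<integral>\<^sup>+v. indicator E (orbit v) * weight v \<partial>Bm)"
      using m_formula[OF i1] E by simp
    also have "\<dots> = (\<integral>\<^sup>+v. 0 \<partial>Bm)"
      by (rule nn_integral_cong_AE, rule AE_mp[OF ae]) (auto intro!: AE_I2)
    finally show "emeasure m E = 0" by simp
  qed
  then show ?thesis by (simp only: AE_Bm_iff)
qed

end


section \<open>Null sets in product coordinates\<close>

lemma AE_prod2:
  assumes "sigma_finite_measure A" "sigma_finite_measure B"
    and Q: "{w \<in> space (A \<Otimes>\<^sub>M B). Q w} \<in> sets (A \<Otimes>\<^sub>M B)"
  shows "(AE w in A \<Otimes>\<^sub>M B. Q w) \<longleftrightarrow> (AE a in A. AE b in B. Q (a, b))"
proof -
  interpret A: sigma_finite_measure A by fact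
  interpret B: sigma_finite_measure B by fact
  interpret pair_sigma_finite A B ..
  show ?thesis using AE_pair[of Q] AE_pair_measure[OF Q] by blast
qed

lemma sigma_finite_pair:
  assumes "sigma_finite_measure A" "sigma_finite_measure B"
  shows "sigma_finite_measure (A \<Otimes>\<^sub>M B)"
proof -
  interpret A: sigma_finite_measure A by fact
  interpret B: sigma_finite_measure B by fact
  interpret pair_sigma_finite A B ..
  show ?thesis by unfold_locales
qed

lemma sets_section:
  assumes "{w \<in> space (A \<Otimes>\<^sub>M B). Q w} \<in> sets (A \<Otimes>\<^sub>M B)" "a \<in> space A"
  shows "{u \<in> space B. Q (a, u)} \<in> sets B"
proof -
  have "{u \<in> space B. Q (a, u)} = Pair a -` {w \<in> space (A \<Otimes>\<^sub>M B). Q w}"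
    using assms(2) by (auto simp: space_pair_measure)
  then show ?thesis using sets_Pair1[OF assms(1)] by simp
qed

lemma AE_cong_space: "(\<And>x. x \<in> space M \<Longrightarrow> P x \<longleftrightarrow> Q x) \<Longrightarrow> (AE x in M. P x) \<longleftrightarrow> (AE x in M. Q x)"
  by (rule AE_cong) simp

lemma AE_prod3:
  assumes sf: "sigma_finite_measure A" "sigma_finite_measure B" "sigma_finite_measure C"
    and Q: "{w \<in> space (A \<Otimes>\<^sub>M (B \<Otimes>\<^sub>M C)). Q w} \<in> sets (A \<Otimes>\<^sub>M (B \<Otimes>\<^sub>M C))"
  shows "(AE w in A \<Otimes>\<^sub>M (B \<Otimes>\<^sub>M C). Q w) \<longleftrightarrow> (AE a in A. AE b in B. AE c in C. Q (a, b, c))"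
proof -
  have "(AE w in A \<Otimes>\<^sub>M (B \<Otimes>\<^sub>M C). Q w) \<longleftrightarrow> (AE a in A. AE u in B \<Otimes>\<^sub>M C. Q (a, u))"
    by (rule AE_prod2[OF sf(1) sigma_finite_pair[OF sf(2,3)] Q])
  also have "\<dots> \<longleftrightarrow> (AE a in A. AE b in B. AE c in C. Q (a, b, c))"
    by (rule AE_cong_space, rule AE_prod2[OF sf(2,3)], rule sets_section[OF Q])
  finally show ?thesis .
qed

lemma AE_prod4:
  assumes sf: "sigma_finite_measure A" "sigma_finite_measure B" "sigma_finite_measure C" "sigma_finite_measure D"
    and Q: "{w \<in> space (A \<Otimes>\<^sub>M (B \<Otimes>\<^sub>M (C \<Otimes>\<^sub>M D))). Q w} \<in> sets (A \<Otimes>\<^sub>M (B \<Otimes>\<^sub>M (C \<Otimes>\<^sub>M D)))"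
  shows "(AE w in A \<Otimes>\<^sub>M (B \<Otimes>\<^sub>M (C \<Otimes>\<^sub>M D)). Q w) \<longleftrightarrow>
    (AE a in A. AE b in B. AE c in C. AE d in D. Q (a, b, c, d))"
proof -
  have "(AE w in A \<Otimes>\<^sub>M (B \<Otimes>\<^sub>M (C \<Otimes>\<^sub>M D)). Q w) \<longleftrightarrow> (AE a in A. AE u in B \<Otimes>\<^sub>M (C \<Otimes>\<^sub>M D). Q (a, u))"
    by (rule AE_prod2[OF sf(1) sigma_finite_pair[OF sf(2) sigma_finite_pair[OF sf(3,4)]] Q])
  also have "\<dots> \<longleftrightarrow> (AE a in A. AE b in B. AE c in C. AE d in D. Q (a, b, c, d))"
    by (rule AE_cong_space, rule AE_prod3[OF sf(2,3,4)], rule sets_section[OF Q])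
  finally show ?thesis .
qed

text \<open>
  A probability measure with the null sets of Lebesgue measure. It replaces Lebesgue measure where a
  finite measure is wanted.
\<close>

definition gauss :: "real measure" where
  "gauss = density lborel (\<lambda>s. ennreal (std_normal_density s))"

lemma prob_gauss: "prob_space gauss"
  unfolding gauss_def by (rule prob_space_normal_density) simp

lemma sets_gauss [measurable_cong]: "sets gauss = sets borel"
  by (simp add: gauss_def)

lemma AE_gauss: "(AE s in gauss. Q s) \<longleftrightarrow> (AE s in lborel. Q s)"
  unfolding gauss_def by (subst AE_density) (auto simp: normal_density_pos)

lemma AE_lborel_shift:
  assumes "AE s in lborel. Q (s::real)"
  shows "AE s in lborel. Q (s + c)"
proof -
  have "AE s in distr lborel borel ((+) c). Q s" using assms by (simp only: lborel_distr_plus)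
  then have "AE s in lborel. Q (c + s)" by (rule AE_distrD[rotated]) simp
  then show ?thesis by (simp only: add.commute)
qed

context bms_flow
begin

lemma sigma_finite_\<mu>: "sigma_finite_measure \<mu>" and sigma_finite_\<mu>': "sigma_finite_measure \<mu>'"
  and sigma_finite_gauss: "sigma_finite_measure gauss"
  using prob prob' prob_gauss by (simp_all add: prob_space_imp_sigma_finite)

lemma space_\<mu> [simp]: "space \<mu> = UNIV" and space_\<mu>' [simp]: "space \<mu>' = UNIV" and space_gauss [simp]: "space gauss = UNIV"
  using sets_eq_imp_space_eq[OF sets_\<mu>] sets_eq_imp_space_eq[OF sets_\<mu>'] sets_eq_imp_space_eq[OF sets_gauss]
  by simp_all

text \<open>
  Fubini's theorem for null sets: the iterated quantifiers can be brought into the order in which the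
  coordinates of a pair of points on a leaf are listed.
\<close>

lemma AE_orders:
  fixes C :: "real measure"
  assumes N: "Q \<in> sets borel" and C: "sigma_finite_measure C" and setsC: "sets C = sets borel"
  shows "(AE v in \<mu>' \<Otimes>\<^sub>M (\<mu> \<Otimes>\<^sub>M C). v \<in> Q) \<longleftrightarrow> (AE y in \<mu>. AE x in \<mu>'. AE s in C. (x, y, s) \<in> Q)"
    and "(AE y in \<mu>. AE x in \<mu>'. AE s in C. (x, y, s) \<in> Q) \<longleftrightarrow> (AE y in \<mu>. AE s in C. AE x in \<mu>'. (x, y, s) \<in> Q)"
proof -
  interpret C: sigma_finite_measure C by (rule C)
  interpret MM: pair_sigma_finite \<mu>' \<mu> ..
  interpret MC: pair_sigma_finite \<mu>' C ..
  note [measurable_cong] = setsC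
  have spC: "space C = UNIV" using sets_eq_imp_space_eq[OF setsC] by simp
  have "sets (\<mu>' \<Otimes>\<^sub>M (\<mu> \<Otimes>\<^sub>M C)) = sets (borel \<Otimes>\<^sub>M (borel \<Otimes>\<^sub>M borel))"
    by (intro sets_pair_measure_cong sets_\<mu> sets_\<mu>' setsC)
  then have s3: "sets (\<mu>' \<Otimes>\<^sub>M (\<mu> \<Otimes>\<^sub>M C)) = sets borel" by (simp only: borel_prod)
  have "{w \<in> space (\<mu>' \<Otimes>\<^sub>M (\<mu> \<Otimes>\<^sub>M C)). w \<in> Q} = Q"
    using sets_eq_imp_space_eq[OF s3] by simp
  then have "{w \<in> space (\<mu>' \<Otimes>\<^sub>M (\<mu> \<Otimes>\<^sub>M C)). w \<in> Q} \<in> sets (\<mu>' \<Otimes>\<^sub>M (\<mu> \<Otimes>\<^sub>M C))"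
    using N s3 by simp
  from AE_prod3[OF sigma_finite_\<mu>' sigma_finite_\<mu> C this]
  have 1: "(AE v in \<mu>' \<Otimes>\<^sub>M (\<mu> \<Otimes>\<^sub>M C). v \<in> Q) \<longleftrightarrow> (AE x in \<mu>'. AE y in \<mu>. AE s in C. (x, y, s) \<in> Q)" .
  have "{z \<in> space (\<mu>' \<Otimes>\<^sub>M \<mu>). AE s in C. (fst z, snd z, s) \<in> Q} \<in> sets (\<mu>' \<Otimes>\<^sub>M \<mu>)"
  proof -
    have Nc: "- Q \<in> sets borel" using N by auto
    have cont: "(\<lambda>w::('m \<times> 'm) \<times> real. (fst (fst w), snd (fst w), snd w)) \<in> borel_measurable borel"
      by (intro borel_measurable_continuous_onI continuous_intros)
    define R where "R = {w::('m \<times> 'm) \<times> real. (fst (fst w), snd (fst w), snd w) \<in> - Q}"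
    have "R \<in> sets borel" using measurable_sets[OF cont Nc] by (simp add: R_def vimage_def)
    moreover have "sets ((\<mu>' \<Otimes>\<^sub>M \<mu>) \<Otimes>\<^sub>M C) = sets ((borel \<Otimes>\<^sub>M borel) \<Otimes>\<^sub>M borel)"
      by (intro sets_pair_measure_cong sets_\<mu> sets_\<mu>' setsC)
    ultimately have R: "R \<in> sets ((\<mu>' \<Otimes>\<^sub>M \<mu>) \<Otimes>\<^sub>M C)" by (simp only: borel_prod)
    have eq: "(AE s in C. (fst z, snd z, s) \<in> Q) \<longleftrightarrow> emeasure C (Pair z -` R) = 0" for z
    proof -
      have sec: "Pair z -` R \<in> sets C" using sets_Pair1[OF R] .
      have "(AE s in C. (fst z, snd z, s) \<in> Q) \<longleftrightarrow> (AE s in C. s \<notin> Pair z -` R)" by (simp add: R_def)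
      also have "\<dots> \<longleftrightarrow> emeasure C (Pair z -` R) = 0"
        using AE_iff_null_sets[OF sec] sec by (auto simp: null_sets_def)
      finally show ?thesis .
    qed
    have "(\<lambda>z. emeasure C (Pair z -` R)) \<in> borel_measurable (\<mu>' \<Otimes>\<^sub>M \<mu>)"
      by (rule C.measurable_emeasure_Pair[OF R])
    then show ?thesis unfolding eq by measurable
  qed
  from MM.AE_commute[of "\<lambda>x y. AE s in C. (x, y, s) \<in> Q", OF this]
  show "(AE v in \<mu>' \<Otimes>\<^sub>M (\<mu> \<Otimes>\<^sub>M C). v \<in> Q) \<longleftrightarrow> (AE y in \<mu>. AE x in \<mu>'. AE s in C. (x, y, s) \<in> Q)"
    unfolding 1 .
  have "(AE x in \<mu>'. AE s in C. (x, y, s) \<in> Q) \<longleftrightarrow> (AE s in C. AE x in \<mu>'. (x, y, s) \<in> Q)" for y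
  proof (rule MC.AE_commute)
    have cont: "(\<lambda>w::'m \<times> real. (fst w, y, snd w)) \<in> borel_measurable borel"
      by (intro borel_measurable_continuous_onI continuous_intros)
    have "sets (\<mu>' \<Otimes>\<^sub>M C) = sets (borel \<Otimes>\<^sub>M borel)" by (intro sets_pair_measure_cong sets_\<mu>' setsC)
    then have s2: "sets (\<mu>' \<Otimes>\<^sub>M C) = sets borel" by (simp only: borel_prod)
    show "{w \<in> space (\<mu>' \<Otimes>\<^sub>M C). (fst w, y, snd w) \<in> Q} \<in> sets (\<mu>' \<Otimes>\<^sub>M C)"
      using measurable_sets[OF cont N] sets_eq_imp_space_eq[OF s2] by (simp add: s2 vimage_def)
  qed
  then show "(AE y in \<mu>. AE x in \<mu>'. AE s in C. (x, y, s) \<in> Q) \<longleftrightarrow> (AE y in \<mu>. AE s in C. AE x in \<mu>'. (x, y, s) \<in> Q)"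
    by (simp only:)
qed

lemma null_iff_iterated:
  assumes E: "E \<in> sets m"
  shows "emeasure m E = 0 \<longleftrightarrow>
    (AE y in \<mu>. AE x in \<mu>'. AE s in lborel. (x, y, s) \<in> cover \<longrightarrow> orbit (x, y, s) \<notin> E)"
    and "emeasure m E = 0 \<longleftrightarrow>
    (AE y in \<mu>. AE s in lborel. AE x in \<mu>'. (x, y, s) \<in> cover \<longrightarrow> orbit (x, y, s) \<notin> E)"
proof -
  have "orbit -` E \<inter> space lift \<in> sets lift" by (rule measurable_sets[OF orbit_measurable E])
  then have "orbit -` E \<inter> cover \<in> sets borel"
    using cover_borel by (simp add: space_restrict_space sets_restrict_space_iff)
  then have "- (orbit -` E \<inter> cover) \<in> sets borel" by (rule borel_comp)
  note o = AE_orders[OF this lborel.sigma_finite_measure_axioms sets_lborel]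
  have mem: "v \<in> - (orbit -` E \<inter> cover) \<longleftrightarrow> (v \<in> cover \<longrightarrow> orbit v \<notin> E)" for v by auto
  show "emeasure m E = 0 \<longleftrightarrow>
    (AE y in \<mu>. AE x in \<mu>'. AE s in lborel. (x, y, s) \<in> cover \<longrightarrow> orbit (x, y, s) \<notin> E)"
    unfolding null_iff_AE_base[OF E] by (rule o(1)[unfolded mem])
  moreover note o(2)[unfolded mem]
  ultimately show "emeasure m E = 0 \<longleftrightarrow>
    (AE y in \<mu>. AE s in lborel. AE x in \<mu>'. (x, y, s) \<in> cover \<longrightarrow> orbit (x, y, s) \<notin> E)" by blast
qed

end


section \<open>Pairs on a common stable or unstable leaf\<close>

context bms_flow
begin

text \<open>
  \<open>G\<close> is continuous off the diagonal only; the value \<open>0\<close> on the diagonal makes it Borel.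
\<close>

definition G0 :: "'m \<times> 'm \<Rightarrow> real" where
  "G0 p = indicator (distinct_pairs UNIV) p *\<^sub>R G p"

lemma G0_eq: "x \<noteq> y \<Longrightarrow> G0 (x, y) = G (x, y)"
  by (simp add: G0_def distinct_pairs_def)

lemma G0_measurable [measurable]: "G0 \<in> borel_measurable borel"
proof -
  have "distinct_pairs (UNIV :: 'm set) = {p. fst p \<noteq> snd p}" by (auto simp: distinct_pairs_def)
  moreover have "open {p :: 'm \<times> 'm. fst p \<noteq> snd p}" by (intro open_Collect_neq continuous_intros)
  ultimately have "distinct_pairs (UNIV :: 'm set) \<in> sets borel" by simp
  from borel_measurable_continuous_on_indicator[OF this G_continuous]
  show ?thesis by (simp add: G0_def[abs_def])
qed

text \<open>
  \<open>(y, x, s, x')\<close> stands for the pair of \<open>(x, y, s)\<close> and \<open>(x', y, s)\<close>, points with the same forward end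
  and the same height; \<open>(y, y', x, s)\<close> stands for the pair of \<open>(x, y, s)\<close> and
  \<open>(x, y', s + G(x, y') - G(x, y))\<close> with the same backward end. The two points of a pair are the values
  of \<open>s1\<close>, \<open>s2\<close> and of \<open>u1\<close>, \<open>u2\<close>.
\<close>

definition stable_pairs :: "('m \<times> 'm \<times> real \<times> 'm) measure" where
  "stable_pairs = restrict_space (\<mu> \<Otimes>\<^sub>M (\<mu>' \<Otimes>\<^sub>M (gauss \<Otimes>\<^sub>M \<mu>')))
     {(y, x, s, x'). y \<in> \<Lambda> \<and> x \<in> \<Lambda> \<and> x' \<in> \<Lambda> \<and> x \<noteq> y \<and> x' \<noteq> y}"

definition unstable_pairs :: "('m \<times> 'm \<times> 'm \<times> real) measure" where
  "unstable_pairs = restrict_space (\<mu> \<Otimes>\<^sub>M (\<mu> \<Otimes>\<^sub>M (\<mu>' \<Otimes>\<^sub>M gauss)))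
     {(y, y', x, s). y \<in> \<Lambda> \<and> y' \<in> \<Lambda> \<and> x \<in> \<Lambda> \<and> x \<noteq> y \<and> x \<noteq> y'}"

abbreviation "s1 \<equiv> (\<lambda>(y, x, s, x'). (x, y, s)) :: 'm \<times> 'm \<times> real \<times> 'm \<Rightarrow> 'm \<times> 'm \<times> real"
abbreviation "s2 \<equiv> (\<lambda>(y, x, s, x'). (x', y, s)) :: 'm \<times> 'm \<times> real \<times> 'm \<Rightarrow> 'm \<times> 'm \<times> real"
abbreviation "u1 \<equiv> (\<lambda>(y, y', x, s). (x, y, s)) :: 'm \<times> 'm \<times> 'm \<times> real \<Rightarrow> 'm \<times> 'm \<times> real"
abbreviation "u2 \<equiv> (\<lambda>(y, y', x, s). (x, y', s + (G0 (x, y') - G0 (x, y)))) :: 'm \<times> 'm \<times> 'm \<times> real \<Rightarrow> 'm \<times> 'm \<times> real"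

lemma pairs_measurable:
  "s1 \<in> borel_measurable borel" "s2 \<in> borel_measurable borel"
  "u1 \<in> borel_measurable borel" "u2 \<in> borel_measurable borel"
proof -
  show "s1 \<in> borel_measurable borel" "s2 \<in> borel_measurable borel" "u1 \<in> borel_measurable borel"
    unfolding case_prod_beta' by (intro borel_measurable_continuous_onI continuous_intros)+
  have a: "(\<lambda>w::'m \<times> 'm \<times> 'm \<times> real. (fst (snd (snd w)), fst (snd w))) \<in> borel_measurable borel"
    and b: "(\<lambda>w::'m \<times> 'm \<times> 'm \<times> real. (fst (snd (snd w)), fst w)) \<in> borel_measurable borel"
    and c: "(\<lambda>w::'m \<times> 'm \<times> 'm \<times> real. snd (snd (snd w))) \<in> borel_measurable borel"
    and e: "(\<lambda>w::'m \<times> 'm \<times> 'm \<times> real. fst (snd (snd w))) \<in> borel_measurable borel"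
    and f: "(\<lambda>w::'m \<times> 'm \<times> 'm \<times> real. fst (snd w)) \<in> borel_measurable borel"
    by (intro borel_measurable_continuous_onI continuous_intros)+
  have "(\<lambda>w::'m \<times> 'm \<times> 'm \<times> real. snd (snd (snd w)) + (G0 (fst (snd (snd w)), fst (snd w)) - G0 (fst (snd (snd w)), fst w))) \<in> borel_measurable borel"
    by (intro borel_measurable_add borel_measurable_diff c
        measurable_compose[OF a G0_measurable] measurable_compose[OF b G0_measurable])
  from borel_measurable_Pair[OF e borel_measurable_Pair[OF f this]]
  show "u2 \<in> borel_measurable borel" unfolding case_prod_beta' .
qed

lemma sets_stable_base: "sets (\<mu> \<Otimes>\<^sub>M (\<mu>' \<Otimes>\<^sub>M (gauss \<Otimes>\<^sub>M \<mu>'))) = sets borel"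
proof -
  have "sets (\<mu> \<Otimes>\<^sub>M (\<mu>' \<Otimes>\<^sub>M (gauss \<Otimes>\<^sub>M \<mu>'))) = sets (borel \<Otimes>\<^sub>M (borel \<Otimes>\<^sub>M (borel \<Otimes>\<^sub>M borel)))"
    by (intro sets_pair_measure_cong sets_\<mu> sets_\<mu>' sets_gauss)
  then show ?thesis by (simp only: borel_prod)
qed

lemma sets_unstable_base: "sets (\<mu> \<Otimes>\<^sub>M (\<mu> \<Otimes>\<^sub>M (\<mu>' \<Otimes>\<^sub>M gauss))) = sets borel"
proof -
  have "sets (\<mu> \<Otimes>\<^sub>M (\<mu> \<Otimes>\<^sub>M (\<mu>' \<Otimes>\<^sub>M gauss))) = sets (borel \<Otimes>\<^sub>M (borel \<Otimes>\<^sub>M (borel \<Otimes>\<^sub>M borel)))"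
    by (intro sets_pair_measure_cong sets_\<mu> sets_\<mu>' sets_gauss)
  then show ?thesis by (simp only: borel_prod)
qed

lemma cover_vimage:
  assumes "p \<in> borel_measurable (borel :: 'b::topological_space measure)"
  shows "{w. p w \<in> cover} \<in> sets borel"
  using measurable_sets[OF assms cover_borel] by (simp add: vimage_def)

lemma stable_region: "{(y, x, s, x'). y \<in> \<Lambda> \<and> x \<in> \<Lambda> \<and> x' \<in> \<Lambda> \<and> x \<noteq> y \<and> x' \<noteq> y} = {w. s1 w \<in> cover} \<inter> {w. s2 w \<in> cover}"
  by (auto simp: cover_iff)

lemma unstable_region: "{(y, y', x, s). y \<in> \<Lambda> \<and> y' \<in> \<Lambda> \<and> x \<in> \<Lambda> \<and> x \<noteq> y \<and> x \<noteq> y'} = {w. u1 w \<in> cover} \<inter> {w. u2 w \<in> cover}"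
  by (auto simp: cover_iff)

lemma stable_region_borel: "{(y, x, s::real, x'). y \<in> \<Lambda> \<and> x \<in> \<Lambda> \<and> x' \<in> \<Lambda> \<and> x \<noteq> y \<and> x' \<noteq> y} \<in> sets borel"
  unfolding stable_region using cover_vimage[OF pairs_measurable(1)] cover_vimage[OF pairs_measurable(2)]
  by (rule sets.Int)

lemma stable_region_sets: "{(y, x, s::real, x'). y \<in> \<Lambda> \<and> x \<in> \<Lambda> \<and> x' \<in> \<Lambda> \<and> x \<noteq> y \<and> x' \<noteq> y} \<inter> space (\<mu> \<Otimes>\<^sub>M (\<mu>' \<Otimes>\<^sub>M (gauss \<Otimes>\<^sub>M \<mu>'))) \<in> sets (\<mu> \<Otimes>\<^sub>M (\<mu>' \<Otimes>\<^sub>M (gauss \<Otimes>\<^sub>M \<mu>')))"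
  using stable_region_borel
  by (simp only: sets_stable_base sets_eq_imp_space_eq[OF sets_stable_base] space_borel Int_UNIV_right)

lemma unstable_region_borel: "{(y, y', x, s::real). y \<in> \<Lambda> \<and> y' \<in> \<Lambda> \<and> x \<in> \<Lambda> \<and> x \<noteq> y \<and> x \<noteq> y'} \<in> sets borel"
  unfolding unstable_region using cover_vimage[OF pairs_measurable(3)] cover_vimage[OF pairs_measurable(4)]
  by (rule sets.Int)

lemma unstable_region_sets: "{(y, y', x, s::real). y \<in> \<Lambda> \<and> y' \<in> \<Lambda> \<and> x \<in> \<Lambda> \<and> x \<noteq> y \<and> x \<noteq> y'} \<inter> space (\<mu> \<Otimes>\<^sub>M (\<mu> \<Otimes>\<^sub>M (\<mu>' \<Otimes>\<^sub>M gauss))) \<in> sets (\<mu> \<Otimes>\<^sub>M (\<mu> \<Otimes>\<^sub>M (\<mu>' \<Otimes>\<^sub>M gauss)))"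
  using unstable_region_borel
  by (simp only: sets_unstable_base sets_eq_imp_space_eq[OF sets_unstable_base] space_borel Int_UNIV_right)

lemma finite_stable_pairs: "finite_measure stable_pairs"
  and finite_unstable_pairs: "finite_measure unstable_pairs"
proof -
  interpret g: prob_space gauss by (rule prob_gauss)
  interpret p1: pair_prob_space gauss \<mu>' ..
  interpret p2: pair_prob_space \<mu>' "gauss \<Otimes>\<^sub>M \<mu>'" ..
  interpret p3: pair_prob_space \<mu> "\<mu>' \<Otimes>\<^sub>M (gauss \<Otimes>\<^sub>M \<mu>')" ..
  interpret q1: pair_prob_space \<mu>' gauss ..
  interpret q2: pair_prob_space \<mu> "\<mu>' \<Otimes>\<^sub>M gauss" ..
  interpret q3: pair_prob_space \<mu> "\<mu> \<Otimes>\<^sub>M (\<mu>' \<Otimes>\<^sub>M gauss)" ..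
  have "prob_space (\<mu> \<Otimes>\<^sub>M (\<mu>' \<Otimes>\<^sub>M (gauss \<Otimes>\<^sub>M \<mu>')))" by unfold_locales
  from prob_space.finite_measure[OF this] show "finite_measure stable_pairs"
    unfolding stable_pairs_def by (rule finite_measure_restrict_space)
      (simp only: sets_stable_base stable_region_borel)
  have "prob_space (\<mu> \<Otimes>\<^sub>M (\<mu> \<Otimes>\<^sub>M (\<mu>' \<Otimes>\<^sub>M gauss)))" by unfold_locales
  from prob_space.finite_measure[OF this] show "finite_measure unstable_pairs"
    unfolding unstable_pairs_def by (rule finite_measure_restrict_space)
      (simp only: sets_unstable_base unstable_region_borel)
qed

lemma AE_stable_pairs:
  assumes "{w. R w} \<in> sets borel"
  shows "(AE w in stable_pairs. R w) \<longleftrightarrow> (AE y in \<mu>. AE x in \<mu>'. AE s in lborel. AE x' in \<mu>'.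
     y \<in> \<Lambda> \<and> x \<in> \<Lambda> \<and> x' \<in> \<Lambda> \<and> x \<noteq> y \<and> x' \<noteq> y \<longrightarrow> R (y, x, s, x'))"
proof -
  let ?O = "{(y, x, s::real, x'). y \<in> \<Lambda> \<and> x \<in> \<Lambda> \<and> x' \<in> \<Lambda> \<and> x \<noteq> y \<and> x' \<noteq> y}"
  note O = stable_region_borel and O' = stable_region_sets
  have "{w. w \<in> ?O \<longrightarrow> R w} = - ?O \<union> {w. R w}" by auto
  also have "\<dots> \<in> sets borel" using O assms by (intro sets.Un borel_comp)
  finally have "{w \<in> space (\<mu> \<Otimes>\<^sub>M (\<mu>' \<Otimes>\<^sub>M (gauss \<Otimes>\<^sub>M \<mu>'))). w \<in> ?O \<longrightarrow> R w} \<in> sets (\<mu> \<Otimes>\<^sub>M (\<mu>' \<Otimes>\<^sub>M (gauss \<Otimes>\<^sub>M \<mu>')))"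
    by (simp only: sets_stable_base sets_eq_imp_space_eq[OF sets_stable_base] space_borel UNIV_I simp_thms)
  from AE_prod4[OF sigma_finite_\<mu> sigma_finite_\<mu>' sigma_finite_gauss sigma_finite_\<mu>' this]
  show ?thesis
    unfolding stable_pairs_def AE_restrict_space_iff[OF O'] by (simp add: AE_gauss)
qed

lemma AE_unstable_pairs:
  assumes "{w. R w} \<in> sets borel"
  shows "(AE w in unstable_pairs. R w) \<longleftrightarrow> (AE y in \<mu>. AE y' in \<mu>. AE x in \<mu>'. AE s in lborel.
     y \<in> \<Lambda> \<and> y' \<in> \<Lambda> \<and> x \<in> \<Lambda> \<and> x \<noteq> y \<and> x \<noteq> y' \<longrightarrow> R (y, y', x, s))"
proof -
  let ?O = "{(y, y', x, s::real). y \<in> \<Lambda> \<and> y' \<in> \<Lambda> \<and> x \<in> \<Lambda> \<and> x \<noteq> y \<and> x \<noteq> y'}"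
  note O = unstable_region_borel and O' = unstable_region_sets
  have "{w. w \<in> ?O \<longrightarrow> R w} = - ?O \<union> {w. R w}" by auto
  also have "\<dots> \<in> sets borel" using O assms by (intro sets.Un borel_comp)
  finally have "{w \<in> space (\<mu> \<Otimes>\<^sub>M (\<mu> \<Otimes>\<^sub>M (\<mu>' \<Otimes>\<^sub>M gauss))). w \<in> ?O \<longrightarrow> R w} \<in> sets (\<mu> \<Otimes>\<^sub>M (\<mu> \<Otimes>\<^sub>M (\<mu>' \<Otimes>\<^sub>M gauss)))"
    by (simp only: sets_unstable_base sets_eq_imp_space_eq[OF sets_unstable_base] space_borel UNIV_I simp_thms)
  from AE_prod4[OF sigma_finite_\<mu> sigma_finite_\<mu> sigma_finite_\<mu>' sigma_finite_gauss this]
  show ?thesis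
    unfolding unstable_pairs_def AE_restrict_space_iff[OF O'] by (simp add: AE_gauss)
qed

lemma measurable_orbit_comp:
  assumes p: "p \<in> borel_measurable borel" and P: "sets P0 = sets borel" and W: "\<And>w. w \<in> W \<Longrightarrow> p w \<in> cover"
  shows "(\<lambda>w. orbit (p w)) \<in> measurable (restrict_space P0 W) m"
proof (rule measurable_compose[OF _ orbit_measurable])
  show "p \<in> measurable (restrict_space P0 W) lift"
    by (rule measurable_restrict_space3)
      (use p W in \<open>auto simp: measurable_cong_sets[OF P refl]\<close>)
qed

lemma absolutely_continuous_orbit_comp:
  assumes f: "(\<lambda>w. orbit (p w)) \<in> measurable P m"
    and null: "\<And>E. E \<in> sets m \<Longrightarrow> emeasure m E = 0 \<Longrightarrow> AE w in P. orbit (p w) \<notin> E"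
  shows "absolutely_continuous m (distr P m (\<lambda>w. orbit (p w)))"
  unfolding absolutely_continuous_def
proof
  fix E assume "E \<in> null_sets m"
  then have E: "E \<in> sets m" "emeasure m E = 0" by (auto simp: null_sets_def)
  have sec: "(\<lambda>w. orbit (p w)) -` E \<inter> space P \<in> sets P" by (rule measurable_sets[OF f E(1)])
  have "AE w in P. w \<notin> (\<lambda>w. orbit (p w)) -` E \<inter> space P"
    by (rule AE_mp[OF null[OF E]]) (auto intro!: AE_I2)
  then have "emeasure P ((\<lambda>w. orbit (p w)) -` E \<inter> space P) = 0"
    using AE_iff_null_sets[OF sec] by (auto simp: null_sets_def)
  then show "E \<in> null_sets (distr P m (\<lambda>w. orbit (p w)))"
    using E(1) by (simp add: null_sets_def emeasure_distr[OF f])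
qed

lemma orbit_notin_borel:
  assumes p: "p \<in> borel_measurable borel" and E: "E \<in> sets m"
  shows "{w. p w \<in> cover \<longrightarrow> orbit (p w) \<notin> E} \<in> sets borel"
proof -
  have "orbit -` E \<inter> space lift \<in> sets lift" by (rule measurable_sets[OF orbit_measurable E])
  then have "orbit -` E \<inter> cover \<in> sets borel"
    using cover_borel by (simp add: space_restrict_space sets_restrict_space_iff)
  then have "- (orbit -` E \<inter> cover) \<in> sets borel" by (rule borel_comp)
  from measurable_sets[OF p this] have "p -` (- (orbit -` E \<inter> cover)) \<in> sets borel" by simp
  moreover have "p -` (- (orbit -` E \<inter> cover)) = {w. p w \<in> cover \<longrightarrow> orbit (p w) \<notin> E}" by auto
  ultimately show ?thesis by simp
qed

text \<open>
  Both points of a pair are distributed according to a measure of product class in \<open>(x, y, s)\<close>, which is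
  the class of the lift of \<open>m\<close> by \<open>null_iff_iterated\<close>. This is where the product structure of the
  measure enters.
\<close>

sublocale stable: leaf_pairs m flow stable_pairs "\<lambda>w. orbit (s1 w)" "\<lambda>w. orbit (s2 w)"
proof (intro leaf_pairs.intro leaf_pairs_axioms.intro measure_preserving_flow_axioms finite_stable_pairs)
  show m1: "(\<lambda>w. orbit (s1 w)) \<in> measurable stable_pairs m"
    unfolding stable_pairs_def
    by (rule measurable_orbit_comp[OF pairs_measurable(1) sets_stable_base]) (auto simp: cover_iff)
  show m2: "(\<lambda>w. orbit (s2 w)) \<in> measurable stable_pairs m"
    unfolding stable_pairs_def
    by (rule measurable_orbit_comp[OF pairs_measurable(2) sets_stable_base]) (auto simp: cover_iff)
  have sp: "w \<in> space stable_pairs \<Longrightarrow> s1 w \<in> cover \<and> s2 w \<in> cover" for w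
    by (auto simp: stable_pairs_def space_restrict_space cover_iff)
  show "absolutely_continuous m (distr stable_pairs m (\<lambda>w. orbit (s1 w)))"
  proof (rule absolutely_continuous_orbit_comp[OF m1])
    fix E assume E: "E \<in> sets m" "emeasure m E = 0"
    have "AE w in stable_pairs. s1 w \<in> cover \<longrightarrow> orbit (s1 w) \<notin> E"
      unfolding AE_stable_pairs[OF orbit_notin_borel[OF pairs_measurable(1) E(1)]] prod.case
    proof (rule AE_mp[OF iffD1[OF null_iff_iterated(1)[OF E(1)] E(2)]], rule AE_I2, rule impI, elim AE_mp, rule AE_I2, rule impI, elim AE_mp, intro AE_I2 impI)
      fix y x s x' assume "(x, y, s) \<in> cover \<longrightarrow> orbit (x, y, s) \<notin> E" "(x, y, s) \<in> cover"
      then show "orbit (x, y, s) \<notin> E" by blast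
    qed
    then show "AE w in stable_pairs. orbit (s1 w) \<notin> E"
      by (rule AE_mp) (use sp in \<open>auto intro!: AE_I2\<close>)
  qed
  show "absolutely_continuous m (distr stable_pairs m (\<lambda>w. orbit (s2 w)))"
  proof (rule absolutely_continuous_orbit_comp[OF m2])
    fix E assume E: "E \<in> sets m" "emeasure m E = 0"
    have "AE w in stable_pairs. s2 w \<in> cover \<longrightarrow> orbit (s2 w) \<notin> E"
      unfolding AE_stable_pairs[OF orbit_notin_borel[OF pairs_measurable(2) E(1)]] prod.case
    proof (rule AE_mp[OF iffD1[OF null_iff_iterated(2)[OF E(1)] E(2)]], rule AE_I2, rule impI, rule AE_I2, elim AE_mp, rule AE_I2, rule impI, elim AE_mp, intro AE_I2 impI)
      fix y x s x' assume "(x', y, s) \<in> cover \<longrightarrow> orbit (x', y, s) \<notin> E" "(x', y, s) \<in> cover"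
      then show "orbit (x', y, s) \<notin> E" by blast
    qed
    then show "AE w in stable_pairs. orbit (s2 w) \<notin> E"
      by (rule AE_mp) (use sp in \<open>auto intro!: AE_I2\<close>)
  qed
qed

text \<open>
  The change of height depends on \<open>x\<close>, \<open>y\<close> and \<open>y'\<close> only, so for fixed ends the second point is
  obtained by a translation of the line, which preserves null sets.
\<close>

sublocale unstable: leaf_pairs m "\<lambda>t. flow (- t)" unstable_pairs "\<lambda>w. orbit (u1 w)" "\<lambda>w. orbit (u2 w)"
proof (intro leaf_pairs.intro leaf_pairs_axioms.intro reversed finite_unstable_pairs)
  show m1: "(\<lambda>w. orbit (u1 w)) \<in> measurable unstable_pairs m"
    unfolding unstable_pairs_def
    by (rule measurable_orbit_comp[OF pairs_measurable(3) sets_unstable_base]) (auto simp: cover_iff)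
  show m2: "(\<lambda>w. orbit (u2 w)) \<in> measurable unstable_pairs m"
    unfolding unstable_pairs_def
    by (rule measurable_orbit_comp[OF pairs_measurable(4) sets_unstable_base]) (auto simp: cover_iff)
  have sp: "w \<in> space unstable_pairs \<Longrightarrow> u1 w \<in> cover \<and> u2 w \<in> cover" for w
    by (auto simp: unstable_pairs_def space_restrict_space cover_iff)
  show "absolutely_continuous m (distr unstable_pairs m (\<lambda>w. orbit (u1 w)))"
  proof (rule absolutely_continuous_orbit_comp[OF m1])
    fix E assume E: "E \<in> sets m" "emeasure m E = 0"
    have "AE w in unstable_pairs. u1 w \<in> cover \<longrightarrow> orbit (u1 w) \<notin> E"
      unfolding AE_unstable_pairs[OF orbit_notin_borel[OF pairs_measurable(3) E(1)]] prod.case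
    proof (rule AE_mp[OF iffD1[OF null_iff_iterated(1)[OF E(1)] E(2)]], rule AE_I2, rule impI, rule AE_I2, elim AE_mp, rule AE_I2, rule impI, elim AE_mp, intro AE_I2 impI)
      fix y y' x s assume "(x, y, s) \<in> cover \<longrightarrow> orbit (x, y, s) \<notin> E" "(x, y, s) \<in> cover"
      then show "orbit (x, y, s) \<notin> E" by blast
    qed
    then show "AE w in unstable_pairs. orbit (u1 w) \<notin> E"
      by (rule AE_mp) (use sp in \<open>auto intro!: AE_I2\<close>)
  qed
  show "absolutely_continuous m (distr unstable_pairs m (\<lambda>w. orbit (u2 w)))"
  proof (rule absolutely_continuous_orbit_comp[OF m2])
    fix E assume E: "E \<in> sets m" "emeasure m E = 0"
    have "AE w in unstable_pairs. u2 w \<in> cover \<longrightarrow> orbit (u2 w) \<notin> E"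
      unfolding AE_unstable_pairs[OF orbit_notin_borel[OF pairs_measurable(4) E(1)]] prod.case
    proof (rule AE_I2, rule AE_mp[OF iffD1[OF null_iff_iterated(1)[OF E(1)] E(2)]], rule AE_I2, rule impI, elim AE_mp, rule AE_I2, rule impI)
      fix y y' x assume "AE s in lborel. (x, y', s) \<in> cover \<longrightarrow> orbit (x, y', s) \<notin> E"
      from AE_lborel_shift[OF this, of "G0 (x, y') - G0 (x, y)"]
      show "AE s in lborel. y \<in> \<Lambda> \<and> y' \<in> \<Lambda> \<and> x \<in> \<Lambda> \<and> x \<noteq> y \<and> x \<noteq> y' \<longrightarrow>
         (x, y', s + (G0 (x, y') - G0 (x, y))) \<in> cover \<longrightarrow> orbit (x, y', s + (G0 (x, y') - G0 (x, y))) \<notin> E"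
        by (rule AE_mp) (intro AE_I2 impI, blast)
    qed
    then show "AE w in unstable_pairs. orbit (u2 w) \<notin> E"
      by (rule AE_mp) (use sp in \<open>auto intro!: AE_I2\<close>)
  qed
qed

end


section \<open>Observables on the flow space\<close>

context bms_flow
begin

text \<open>
  Continuous functions increasing to the indicator of an open set \<open>V\<close>. They have compact support in
  \<open>V\<close>, even if the closure of \<open>V\<close> meets the diagonal.
\<close>

definition bump :: "('m \<times> 'm \<times> real) set \<Rightarrow> nat \<Rightarrow> 'm \<times> 'm \<times> real \<Rightarrow> real" where
  "bump V k v = max 0 (min 1 (min (real k * infdist v (- V) - 1) (real k - \<bar>snd (snd v)\<bar>)))"

lemma bump_bounds: "0 \<le> bump V k v \<and> bump V k v \<le> 1"
  by (simp add: bump_def)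

lemma bump_continuous: "continuous_on UNIV (bump V k)"
  unfolding bump_def[abs_def] by (intro continuous_intros)

lemma bump_support:
  assumes V: "open V" "V \<subseteq> {v. fst v \<noteq> fst (snd v)}"
  obtains K where "compact K" "K \<subseteq> {v. fst v \<noteq> fst (snd v)}" "{v. bump V k v \<noteq> 0} \<subseteq> K"
proof (rule that)
  let ?K = "(UNIV \<times> UNIV \<times> {- real k..real k}) \<inter> {v. 1 \<le> real k * infdist v (- V)}"
  show "compact ?K"
    by (intro compact_Int_closed compact_Times compact_M compact_Icc closed_Collect_le continuous_intros)
  show "{v. bump V k v \<noteq> 0} \<subseteq> ?K"
    by (auto simp: bump_def max_def min_def abs_le_iff split: if_splits)
  have "v \<in> V" if "v \<in> ?K" for v
  proof -
    have "infdist v (- V) \<noteq> 0" using that by auto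
    then show "v \<in> V" by (metis ComplI infdist_zero)
  qed
  then show "?K \<subseteq> {v. fst v \<noteq> fst (snd v)}" using V(2) by blast
qed

lemma bump_eventually_one:
  assumes V: "open V" "V \<subseteq> {v. fst v \<noteq> fst (snd v)}" and v: "v \<in> V"
  shows "\<forall>\<^sub>F k in sequentially. bump V k v = 1"
proof -
  have "(fst v, fst v, 0) \<in> - V" using V(2) by auto
  then have "infdist v (- V) \<noteq> 0"
    using V(1) v in_closed_iff_infdist_zero[of "- V" v] by (auto simp: closed_Compl)
  then have pos: "0 < infdist v (- V)" using infdist_nonneg[of v "- V"] by linarith
  obtain k0 where k0: "2 / infdist v (- V) \<le> real k0" using real_arch_simple by blast
  obtain k1 where k1: "\<bar>snd (snd v)\<bar> + 1 \<le> real k1" using real_arch_simple by blast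
  have "bump V k v = 1" if "k \<ge> max k0 k1" for k
  proof -
    have "2 / infdist v (- V) \<le> real k" using k0 that by linarith
    then have "2 \<le> real k * infdist v (- V)" using pos by (simp add: field_simps)
    moreover have "\<bar>snd (snd v)\<bar> + 1 \<le> real k" using k1 that by linarith
    ultimately show ?thesis by (simp add: bump_def)
  qed
  then show ?thesis by (rule eventually_sequentiallyI)
qed

lemma bump_outside: "v \<notin> V \<Longrightarrow> bump V k v = 0"
  using infdist_zero[of v "- V"] by (simp add: bump_def)

text \<open>
  The value \<open>0\<close> on sets that are not orbits makes the bounds of \<open>unit_valued\<close> hold everywhere.
\<close>

definition orbit_test :: "('m \<times> 'm \<times> real \<Rightarrow> real) \<Rightarrow> ('m \<times> 'm \<times> real) set \<Rightarrow> real" where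
  "orbit_test f c = (if c \<in> space m then orbit_sup f c else 0)"

lemma orbit_sup_bounds:
  assumes "\<And>v. 0 \<le> f v \<and> f v \<le> 1"
  shows "f v \<le> orbit_sup f (orbit v)" "orbit_sup f (orbit v) \<le> 1"
proof -
  have "bdd_above (f ` orbit v)" using assms by (intro bdd_aboveI2[where M = 1]) auto
  moreover have "v \<in> orbit v"
  proof -
    have "flow_act \<sigma> id v = v" by (cases v) (simp add: flow_act_def cocycle_id)
    then show ?thesis using id_in by (force simp: flow_orbit_def)
  qed
  ultimately show "f v \<le> orbit_sup f (orbit v)" unfolding orbit_sup_def by (rule cSUP_upper[rotated])
  show "orbit_sup f (orbit v) \<le> 1"
    unfolding orbit_sup_def using assms \<open>v \<in> orbit v\<close> by (intro cSUP_least) auto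
qed

text \<open>
  Superlevel sets of the supremum over the orbit are open: they lift to unions of translates of
  superlevel sets of \<open>f\<close>.
\<close>

lemma orbit_test_unit_valued:
  assumes f: "continuous_on UNIV f" "\<And>v. 0 \<le> f v \<and> f v \<le> 1"
  shows "unit_valued m (orbit_test f)"
  unfolding unit_valued_def
proof
  show "orbit_test f \<in> borel_measurable m"
    unfolding borel_measurable_iff_greater
  proof
    fix a :: real
    define W where "W = {c \<in> space m. \<exists>v\<in>c. a < f v}"
    have sup: "a < orbit_sup f (orbit v) \<longleftrightarrow> (\<exists>u\<in>orbit v. a < f u)" for v
      unfolding orbit_sup_def
      using f(2) id_in by (intro less_cSUP_iff bdd_aboveI2[where M = 1]) (auto simp: flow_orbit_def)
    have "{c \<in> space m. a < orbit_test f c} = W"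
      using sup by (auto simp: W_def orbit_test_def space_m flow_space_def)
    moreover have "W \<in> sets m"
    proof -
      have "{v \<in> cover. orbit v \<in> W} = cover \<inter> (\<Union>\<gamma>\<in>\<Gamma>. {v. a < f (flow_act \<sigma> \<gamma> v)})"
        by (auto simp: W_def space_m flow_space_def flow_orbit_def)
      moreover have "open (\<Union>\<gamma>\<in>\<Gamma>. {v. a < f (flow_act \<sigma> \<gamma> v)})"
      proof (rule open_UN, rule ballI)
        fix \<gamma> assume "\<gamma> \<in> \<Gamma>"
        then have "continuous_on UNIV (\<lambda>v. f (flow_act \<sigma> \<gamma> v))"
          by (intro continuous_on_compose2[OF f(1) act_continuous]) auto
        then show "open {v. a < f (flow_act \<sigma> \<gamma> v)}"
          by (intro open_Collect_less continuous_on_const)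
      qed
      ultimately have "openin (top_of_set cover) {v \<in> cover. orbit v \<in> W}"
        unfolding openin_open by blast
      then have "openin (flow_topology \<Gamma> \<sigma>) W"
        by (simp add: openin_flow_topology) (auto simp: W_def space_m)
      then show ?thesis by (simp add: sets_m)
    qed
    ultimately show "{c \<in> space m. a < orbit_test f c} \<in> sets m" by simp
  qed
  show "\<forall>c. 0 \<le> orbit_test f c \<and> orbit_test f c \<le> 1"
  proof
    fix c
    show "0 \<le> orbit_test f c \<and> orbit_test f c \<le> 1"
    proof (cases "c \<in> space m")
      case True
      then obtain v where "c = orbit v" by (auto simp: space_m flow_space_def)
      then show ?thesis using True orbit_sup_bounds[of f v, OF f(2)] f(2)[of v] by (auto simp: orbit_test_def)
    qed (simp add: orbit_test_def)
  qed
qed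

lemma orbit_test_orbit: "v \<in> cover \<Longrightarrow> orbit_test f (orbit v) = orbit_sup f (orbit v)"
  by (auto simp: orbit_test_def space_m flow_space_def)

lemma stable_test:
  assumes f: "continuous_on UNIV f" "\<And>v. 0 \<le> f v \<and> f v \<le> 1" and K: "\<And>v. f v \<noteq> 0 \<Longrightarrow> v \<in> K" "compact K"
    and xy: "x \<noteq> y" "x' \<noteq> y"
  shows "((\<lambda>t. orbit_sup f (orbit (x, y, s + t)) - orbit_sup f (orbit (x', y, s + t))) \<longlongrightarrow> 0) at_top"
proof (rule orbit_sup_asymptotic[OF f K(1)])
  fix t :: "nat \<Rightarrow> real" and g :: "nat \<Rightarrow> 'm \<Rightarrow> 'm"
  assume t: "filterlim t at_top sequentially" and g: "\<And>n. g n \<in> \<Gamma>"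
  show "\<exists>r \<kappa>. strict_mono (r :: nat \<Rightarrow> nat) \<and> (\<lambda>n. flow_act \<sigma> (g (r n)) (x, y, s + t (r n))) \<longlonglongrightarrow> \<kappa> \<and>
     (\<lambda>n. flow_act \<sigma> (g (r n)) (x', y, s + t (r n))) \<longlonglongrightarrow> \<kappa>"
    if "\<And>n. flow_act \<sigma> (g n) (x, y, s + t n) \<in> K"
    by (rule stable_common_limit[OF K(2) xy t g that])
  show "\<exists>r \<kappa>. strict_mono (r :: nat \<Rightarrow> nat) \<and> (\<lambda>n. flow_act \<sigma> (g (r n)) (x', y, s + t (r n))) \<longlonglongrightarrow> \<kappa> \<and>
     (\<lambda>n. flow_act \<sigma> (g (r n)) (x, y, s + t (r n))) \<longlonglongrightarrow> \<kappa>"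
    if "\<And>n. flow_act \<sigma> (g n) (x', y, s + t n) \<in> K"
    by (rule stable_common_limit[OF K(2) xy(2,1) t g that])
qed

text \<open>
  The indicator of an open set is a limit of the functions \<open>orbit_test (bump V k)\<close>, where \<open>V\<close> is open and
  has the same trace on the cover as the preimage of \<open>W\<close>. For these the orbits of a pair are
  asymptotic in the pointwise sense, by \<open>stable_common_limit\<close> and \<open>unstable_common_limit\<close>.
\<close>

lemma asymptotic_open:
  assumes "openin (flow_topology \<Gamma> \<sigma>) W"
  shows "stable.asymptotic (indicator W)" "unstable.asymptotic (indicator W)"
proof -
  have W: "W \<in> sets m" using assms by (simp add: sets_m)
  have "openin (top_of_set cover) {v \<in> cover. orbit v \<in> W}"
    using assms by (simp add: openin_flow_topology)
  then obtain U where U: "open U" "{v \<in> cover. orbit v \<in> W} = cover \<inter> U" by (auto simp: openin_open)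
  \<comment> \<open>Removing the diagonal does not change the trace on the cover and keeps the supports off it.\<close>
  define V where "V = U \<inter> {v. fst v \<noteq> fst (snd v)}"
  have "open V" unfolding V_def by (intro open_Int U(1) open_Collect_neq continuous_intros)
  have V_neq: "V \<subseteq> {v. fst v \<noteq> fst (snd v)}" by (simp add: V_def)
  have V: "v \<in> V \<longleftrightarrow> orbit v \<in> W" if "v \<in> cover" for v
  proof -
    have "v \<in> V \<longleftrightarrow> v \<in> U" using that by (cases v) (auto simp: V_def cover_iff)
    also have "\<dots> \<longleftrightarrow> v \<in> {v \<in> cover. orbit v \<in> W}" using that U(2) by blast
    finally show ?thesis using that by simp
  qed
  have uv: "unit_valued m (orbit_test (bump V k))" for k
    by (rule orbit_test_unit_valued[OF bump_continuous bump_bounds])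
  have uW: "unit_valued m (indicator W)" by (rule unit_valued_indicator[OF W])
  have lim: "(\<lambda>k. orbit_test (bump V k) c) \<longlonglongrightarrow> indicator W c" if c: "c \<in> space m" for c
  proof -
    obtain v where v: "v \<in> cover" "c = orbit v" using c by (auto simp: space_m flow_space_def)
    have "\<forall>\<^sub>F k in sequentially. orbit_test (bump V k) c = indicator W c"
    proof (cases "c \<in> W")
      case True
      then have "v \<in> V" using V v by simp
      with \<open>open V\<close> V_neq have "\<forall>\<^sub>F k in sequentially. bump V k v = 1"
        by (intro bump_eventually_one)
      then show ?thesis
      proof eventually_elim
        case (elim k)
        then show ?case
          using orbit_sup_bounds[of "bump V k" v, OF bump_bounds] True v by (simp add: orbit_test_orbit)
      qed
    next
      case False
      have "bump V k u = 0" if u: "u \<in> orbit v" for u k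
      proof -
        obtain \<gamma> where \<gamma>: "\<gamma> \<in> \<Gamma>" "u = flow_act \<sigma> \<gamma> v" using u by (auto simp: flow_orbit_def)
        then have "u \<in> cover" "orbit u = c" using v by (simp_all add: act_cover orbit_act)
        then show ?thesis using V False by (intro bump_outside) simp
      qed
      then have "orbit_sup (bump V k) (orbit v) = (SUP u\<in>orbit v. 0)" for k
        unfolding orbit_sup_def by (intro SUP_cong) auto
      moreover have "orbit v \<noteq> {}" using id_in by (auto simp: flow_orbit_def)
      ultimately show ?thesis using False v by (simp add: orbit_test_orbit)
    qed
    then show ?thesis by (rule tendsto_eventually)
  qed
  show "stable.asymptotic (indicator W)"
  proof (rule stable.asymptotic_limit[OF uv _ uW lim])
    fix k
    obtain K where "compact K" "K \<subseteq> {v. fst v \<noteq> fst (snd v)}" "{v. bump V k v \<noteq> 0} \<subseteq> K"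
      by (rule bump_support[of V k, OF \<open>open V\<close> V_neq])
    then have K: "compact K" "\<And>x y s. (x, y, s) \<in> K \<Longrightarrow> x \<noteq> y" "\<And>v. bump V k v \<noteq> 0 \<Longrightarrow> v \<in> K"
      by auto
    show "stable.asymptotic (orbit_test (bump V k))"
    proof (rule stable.asymptotic_pointwise[OF uv])
      fix w assume "w \<in> space stable_pairs"
      then obtain y x s x' where w: "w = (y, x, s, x')" and xy: "y \<in> \<Lambda>" "x \<in> \<Lambda>" "x' \<in> \<Lambda>" "x \<noteq> y" "x' \<noteq> y"
        by (auto simp: stable_pairs_def space_restrict_space)
      have "((\<lambda>t. orbit_sup (bump V k) (orbit (x, y, s + t)) - orbit_sup (bump V k) (orbit (x', y, s + t))) \<longlongrightarrow> 0) at_top"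
        by (rule stable_test[OF bump_continuous bump_bounds K(3,1) xy(4,5)])
      then show "((\<lambda>t. orbit_test (bump V k) (flow t (orbit (s1 w))) - orbit_test (bump V k) (flow t (orbit (s2 w)))) \<longlongrightarrow> 0) at_top"
        using xy by (simp add: w flow_flow_orbit flow_tilde_def orbit_test_orbit cover_iff)
    qed
  qed
  show "unstable.asymptotic (indicator W)"
  proof (rule unstable.asymptotic_limit[OF uv _ uW lim])
    fix k
    obtain K where "compact K" "K \<subseteq> {v. fst v \<noteq> fst (snd v)}" "{v. bump V k v \<noteq> 0} \<subseteq> K"
      by (rule bump_support[of V k, OF \<open>open V\<close> V_neq])
    then have K: "compact K" "\<And>x y s. (x, y, s) \<in> K \<Longrightarrow> x \<noteq> y" "\<And>v. bump V k v \<noteq> 0 \<Longrightarrow> v \<in> K"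
      by auto
    show "unstable.asymptotic (orbit_test (bump V k))"
    proof (rule unstable.asymptotic_pointwise[OF uv])
      fix w assume "w \<in> space unstable_pairs"
      then obtain y y' x s where w: "w = (y, y', x, s)" and xy: "y \<in> \<Lambda>" "y' \<in> \<Lambda>" "x \<in> \<Lambda>" "x \<noteq> y" "x \<noteq> y'"
        by (auto simp: unstable_pairs_def space_restrict_space)
      define s' where "s' = s + (G (x, y') - G (x, y))"
      have "((\<lambda>t. orbit_sup (bump V k) (orbit (x, y, s + - t)) - orbit_sup (bump V k) (orbit (x, y', s' + - t))) \<longlongrightarrow> 0) at_top"
      proof (rule orbit_sup_asymptotic[OF bump_continuous bump_bounds K(3)])
        fix t :: "nat \<Rightarrow> real" and g :: "nat \<Rightarrow> 'm \<Rightarrow> 'm"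
        assume "filterlim t at_top sequentially" and g: "\<And>n. g n \<in> \<Gamma>"
        then have t: "filterlim (\<lambda>n. - t n) at_bot sequentially" by (simp add: filterlim_uminus_at_bot)
        show "\<exists>r \<kappa>. strict_mono (r :: nat \<Rightarrow> nat) \<and> (\<lambda>n. flow_act \<sigma> (g (r n)) (x, y, s + - t (r n))) \<longlonglongrightarrow> \<kappa> \<and>
             (\<lambda>n. flow_act \<sigma> (g (r n)) (x, y', s' + - t (r n))) \<longlonglongrightarrow> \<kappa>"
          if "\<And>n. flow_act \<sigma> (g n) (x, y, s + - t n) \<in> K"
          by (rule unstable_common_limit[where K = K, OF K(1) _ xy(4,5) t _ g that])
            (use K(2) in \<open>auto simp: s'_def\<close>)
        \<comment> \<open>The relation of the two points of a pair is symmetric, as the change of height only changes sign.\<close>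
        show "\<exists>r \<kappa>. strict_mono (r :: nat \<Rightarrow> nat) \<and> (\<lambda>n. flow_act \<sigma> (g (r n)) (x, y', s' + - t (r n))) \<longlonglongrightarrow> \<kappa> \<and>
             (\<lambda>n. flow_act \<sigma> (g (r n)) (x, y, s + - t (r n))) \<longlonglongrightarrow> \<kappa>"
          if "\<And>n. flow_act \<sigma> (g n) (x, y', s' + - t n) \<in> K"
          by (rule unstable_common_limit[where K = K, OF K(1) _ xy(5,4) t _ g that])
            (use K(2) in \<open>auto simp: s'_def\<close>)
      qed
      then show "((\<lambda>t. orbit_test (bump V k) (flow (- t) (orbit (u1 w))) - orbit_test (bump V k) (flow (- t) (orbit (u2 w)))) \<longlongrightarrow> 0) at_top"
        using xy by (simp add: w flow_flow_orbit flow_tilde_def orbit_test_orbit cover_iff s'_def G0_eq)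
    qed
  qed
qed

lemma asymptotic_all:
  assumes "unit_valued m h"
  shows "stable.asymptotic h" "unstable.asymptotic h"
proof -
  let ?O = "{W. openin (flow_topology \<Gamma> \<sigma>) W}"
  have gen: "sets m = sigma_sets (space m) ?O" "?O \<subseteq> Pow (space m)"
    using sets_m opens_m by (simp_all add: space_m)
  have Int: "Int_stable ?O" by (auto simp: Int_stable_def)
  show "stable.asymptotic h"
    by (rule stable.asymptotic_of_generator[OF gen(1) Int gen(2) _ assms]) (simp add: asymptotic_open)
  show "unstable.asymptotic h"
    by (rule unstable.asymptotic_of_generator[OF gen(1) Int gen(2) _ assms]) (simp add: asymptotic_open)
qed

theorem mixing_if_rigid:
  assumes rigid: "\<And>g. \<lbrakk>unit_valued m g; AE w in stable_pairs. g (orbit (s1 w)) = g (orbit (s2 w));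
      AE w in unstable_pairs. g (orbit (u1 w)) = g (orbit (u2 w))\<rbrakk> \<Longrightarrow> \<exists>c. AE x in m. g x = c"
  shows "mixing m flow"
proof (rule mixing_if_weak_limits_rigid[where
    S = "\<lambda>g. AE w in stable_pairs. g (orbit (s1 w)) = g (orbit (s2 w))" and
    U = "\<lambda>g. AE w in unstable_pairs. g (orbit (u1 w)) = g (orbit (u2 w))"])
  fix F :: "real filter" and h g :: "('m \<times> 'm \<times> real) set \<Rightarrow> real"
  assume F: "F \<noteq> bot" "F \<le> at_top" and h: "unit_valued m h"
  show "AE w in stable_pairs. g (orbit (s1 w)) = g (orbit (s2 w))" if "weak_limit m F (\<lambda>t x. h (flow t x)) g"
    by (rule stable.weak_limit_leaf_invariant[OF F h asymptotic_all(1)[OF h] that])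
  show "AE w in unstable_pairs. g (orbit (u1 w)) = g (orbit (u2 w))" if "weak_limit m F (\<lambda>t x. h (flow (- t) x)) g"
    by (rule unstable.weak_limit_leaf_invariant[OF F h asymptotic_all(2)[OF h] that])
qed (rule rigid)

end


section \<open>Periods of functions on the line\<close>

lemma AE_eq_if_interval_integrals_eq:
  fixes f h :: "real \<Rightarrow> real"
  assumes f: "unit_valued borel f" and h: "unit_valued borel h"
    and eq: "\<And>a b. (\<integral>s. indicator {a..b} s * f s \<partial>lborel) = (\<integral>s. indicator {a..b} s * h s \<partial>lborel)"
  shows "AE s in lborel. f s = h s"
proof -
  have em: "emeasure (density lborel (\<lambda>s. ennreal (u s))) {a..b} = ennreal (\<integral>s. indicator {a..b} s * u s \<partial>lborel)"
    if u: "unit_valued borel u" for u and a b :: real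
  proof -
    have [measurable]: "u \<in> borel_measurable borel" using u by (simp add: unit_valued_def)
    have "integrable lborel (indicator {a..b} :: real \<Rightarrow> real)" by (simp add: emeasure_lborel_Icc_eq)
    then have "integrable lborel (\<lambda>s. indicator {a..b} s * u s)"
      by (rule Bochner_Integration.integrable_bound)
        (use u in \<open>auto simp: unit_valued_def indicator_def\<close>)
    then have "(\<integral>\<^sup>+s. ennreal (indicator {a..b} s * u s) \<partial>lborel) = ennreal (\<integral>s. indicator {a..b} s * u s \<partial>lborel)"
      using u by (intro nn_integral_eq_integral) (auto simp: unit_valued_def)
    moreover have "emeasure (density lborel (\<lambda>s. ennreal (u s))) {a..b} = (\<integral>\<^sup>+s. ennreal (indicator {a..b} s * u s) \<partial>lborel)"
      by (subst emeasure_density) (auto intro!: nn_integral_cong simp: indicator_def)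
    ultimately show ?thesis by simp
  qed
  let ?E = "range (\<lambda>(a, b). {a..b} :: real set)"
  have D: "density lborel (\<lambda>s. ennreal (f s)) = density lborel (\<lambda>s. ennreal (h s))"
  proof (rule measure_eqI_generator_eq[where E = ?E and \<Omega> = UNIV and A = "\<lambda>n. {- real n..real n}"])
    show "Int_stable ?E" by (auto simp: Int_stable_def)
    show "(\<Union>n. {- real n..real n}) = UNIV"
    proof (intro set_eqI iffI UNIV_I)
      fix x :: real
      obtain n where "\<bar>x\<bar> \<le> real n" using real_arch_simple by blast
      then show "x \<in> (\<Union>n. {- real n..real n})" by (auto simp: abs_le_iff intro!: exI[of _ n])
    qed
    show "sets (density lborel (\<lambda>s. ennreal (f s))) = sigma_sets UNIV ?E"
      "sets (density lborel (\<lambda>s. ennreal (h s))) = sigma_sets UNIV ?E"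
      by (simp_all add: borel_eq_atLeastAtMost)
  qed (auto simp: em[OF f] em[OF h] eq)
  have "(\<lambda>s. ennreal (f s)) \<in> borel_measurable lborel" "(\<lambda>s. ennreal (h s)) \<in> borel_measurable lborel"
    using f h by (auto simp: unit_valued_def)
  from sigma_finite_measure.density_unique[OF lborel.sigma_finite_measure_axioms this D]
  have "AE s in lborel. ennreal (f s) = ennreal (h s)" .
  then show ?thesis
    by (rule AE_mp) (use f h in \<open>auto intro!: AE_I2 simp: unit_valued_def\<close>)
qed

text \<open>
  \<open>f\<close> is the translate of \<open>h\<close> by \<open>c\<close>; for \<open>f = h\<close> this says that \<open>c\<close> is a period of \<open>f\<close>.
\<close>

definition shift_eq :: "(real \<Rightarrow> real) \<Rightarrow> (real \<Rightarrow> real) \<Rightarrow> real \<Rightarrow> bool" where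
  "shift_eq f h c \<longleftrightarrow> (AE s in lborel. f s = h (s + c))"

lemma shift_eq_refl: "shift_eq f f 0"
  by (simp add: shift_eq_def)

lemma shift_eq_sym:
  assumes "shift_eq f h c"
  shows "shift_eq h f (- c)"
  using AE_lborel_shift[OF assms[unfolded shift_eq_def], of "- c"]
  unfolding shift_eq_def by eventually_elim simp

lemma shift_eq_trans:
  assumes "shift_eq f h c" "shift_eq h k e"
  shows "shift_eq f k (c + e)"
  unfolding shift_eq_def
  using assms(1)[unfolded shift_eq_def] AE_lborel_shift[OF assms(2)[unfolded shift_eq_def], of c]
  by eventually_elim (simp only: add.assoc)

text \<open>
  The integral of \<open>f\<close> over \<open>[a + c, b + c]\<close> depends continuously on \<open>c\<close>, and a number \<open>c\<close> is a period
  if and only if this integral agrees with that over \<open>[a, b]\<close> for all \<open>a\<close> and \<open>b\<close>.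
\<close>

lemma closed_periods:
  assumes f: "unit_valued borel f"
  shows "closed {c. shift_eq f f c}"
  unfolding closed_sequential_limits
proof (intro allI impI, elim conjE)
  fix cs c assume cs: "\<forall>n. cs n \<in> {c. shift_eq f f c}" and lim: "cs \<longlonglongrightarrow> c"
  have [measurable]: "f \<in> borel_measurable borel" using f by (simp add: unit_valued_def)
  have f01: "0 \<le> f s" "f s \<le> 1" for s using f by (auto simp: unit_valued_def)
  let ?J = "\<lambda>a b c. \<integral>s. indicator {a + c..b + c} s * f s \<partial>lborel"
  have J: "(\<integral>s. indicator {a..b} s * f (s + c) \<partial>lborel) = ?J a b c" for a b c
    using lborel_integral_real_affine[of 1 "\<lambda>s. indicator {a + c..b + c} s * f s" c]
    by (simp add: indicator_def add.commute)
  obtain B where B: "\<And>n. \<bar>cs n\<bar> \<le> B"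
    using convergent_imp_Bseq[OF convergentI[OF lim]] by (auto simp: Bseq_def)
  have "(\<integral>s. indicator {a..b} s * f s \<partial>lborel) = (\<integral>s. indicator {a..b} s * f (s + c) \<partial>lborel)" for a b
  proof -
    have "?J a b (cs n) = (\<integral>s. indicator {a..b} s * f s \<partial>lborel)" for n
    proof -
      have "AE s in lborel. f s = f (s + cs n)" using cs by (simp add: shift_eq_def)
      then have "AE s in lborel. indicator {a..b} s * f s = indicator {a..b} s * f (s + cs n)"
        by eventually_elim simp
      then have "(\<integral>s. indicator {a..b} s * f s \<partial>lborel) = (\<integral>s. indicator {a..b} s * f (s + cs n) \<partial>lborel)"
        by (intro integral_cong_AE) auto
      then show ?thesis by (simp only: J)
    qed
    moreover have "(\<lambda>n. ?J a b (cs n)) \<longlonglongrightarrow> ?J a b c"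
    proof (rule integral_dominated_convergence[where w = "indicator {a - B..b + B}"])
      have "AE s in lborel. s \<noteq> a + c" "AE s in lborel. s \<noteq> b + c" by (rule AE_lborel_singleton)+
      then show "AE s in lborel. (\<lambda>n. indicator {a + cs n..b + cs n} s * f s) \<longlonglongrightarrow> indicator {a + c..b + c} s * f s"
      proof eventually_elim
        case (elim s)
        have la: "(\<lambda>n. a + cs n) \<longlonglongrightarrow> a + c" and lb: "(\<lambda>n. b + cs n) \<longlonglongrightarrow> b + c"
          by (rule tendsto_add[OF tendsto_const lim])+
        have "\<forall>\<^sub>F n in sequentially. (a + cs n \<le> s) = (a + c \<le> s)"
        proof (cases "a + c < s")
          case True
          from order_tendstoD(2)[OF la this] show ?thesis by eventually_elim (use True in auto)
        next
          case False
          then have "s < a + c" using elim by simp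
          from order_tendstoD(1)[OF la this] show ?thesis by eventually_elim (use False elim in auto)
        qed
        moreover have "\<forall>\<^sub>F n in sequentially. (s \<le> b + cs n) = (s \<le> b + c)"
        proof (cases "b + c < s")
          case True
          from order_tendstoD(2)[OF lb this] show ?thesis by eventually_elim (use True in auto)
        next
          case False
          then have "s < b + c" using elim by simp
          from order_tendstoD(1)[OF lb this] show ?thesis by eventually_elim (use False elim in auto)
        qed
        ultimately have "\<forall>\<^sub>F n in sequentially. indicator {a + cs n..b + cs n} s * f s = indicator {a + c..b + c} s * f s"
          by eventually_elim (simp add: indicator_def)
        then show ?case by (rule tendsto_eventually)
      qed
      show "integrable lborel (indicator {a - B..b + B} :: real \<Rightarrow> real)" by (simp add: emeasure_lborel_Icc_eq)
      show "AE s in lborel. norm (indicator {a + cs n..b + cs n} s * f s) \<le> indicator {a - B..b + B} s" for n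
        using B[of n] f01 by (intro AE_I2) (auto simp: indicator_def abs_le_iff)
    qed auto
    ultimately have "?J a b c = (\<integral>s. indicator {a..b} s * f s \<partial>lborel)"
      by (simp add: LIMSEQ_const_iff)
    then show ?thesis by (simp only: J)
  qed
  moreover have "unit_valued borel (\<lambda>s. f (s + c))" using f by (auto simp: unit_valued_def)
  ultimately have "AE s in lborel. f s = f (s + c)"
    using f by (intro AE_eq_if_interval_integrals_eq)
  then show "c \<in> {c. shift_eq f f c}" by (simp add: shift_eq_def)
qed

text \<open>
  By Fubini's theorem there is a point \<open>s0\<close> with \<open>f s0 = f (s0 + c)\<close> for almost all \<open>c\<close>.
\<close>

lemma AE_const_if_all_periods:
  assumes f[measurable]: "f \<in> borel_measurable borel" and per: "\<And>c. shift_eq f f c"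
  shows "\<exists>k. AE s in lborel. f s = k"
proof -
  have "AE c in lborel. AE s in lborel. f s = f (s + c)"
    by (rule AE_I2) (rule per[unfolded shift_eq_def])
  moreover have "{x \<in> space (lborel \<Otimes>\<^sub>M lborel). f (fst x) = f (fst x + snd x)} \<in> sets (lborel \<Otimes>\<^sub>M lborel)"
    by measurable
  ultimately have "AE s in lborel. AE c in lborel. f s = f (s + c)"
    using lborel_pair.AE_commute[of "\<lambda>s c. f s = f (s + c)"] by blast
  then have ae: "AE s in gauss. AE c in lborel. f s = f (s + c)" by (simp only: AE_gauss)
  have "\<exists>s0. AE c in lborel. f s0 = f (s0 + c)"
  proof (rule ccontr)
    assume "\<not> ?thesis"
    with ae have "AE s in gauss. False" by simp
    then show False using prob_space.AE_False[OF prob_gauss] by simp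
  qed
  then obtain s0 where "AE c in lborel. f s0 = f (s0 + c)" ..
  from AE_lborel_shift[OF this, of "- s0"] have "AE s in lborel. f s = f s0"
    by eventually_elim simp
  then show ?thesis by blast
qed

lemma group_closure_subset_periods:
  assumes "S \<subseteq> {c. shift_eq f f c}"
  shows "group_closure S \<subseteq> {c. shift_eq f f c}"
proof
  fix c assume "c \<in> group_closure S"
  then show "c \<in> {c. shift_eq f f c}"
  proof induction
    case (base s) then show ?case using assms shift_eq_refl by auto
  next
    case (diff s t)
    then show ?case using shift_eq_trans[OF _ shift_eq_sym, of f f s f t] by simp
  qed
qed

lemma AE_pick:
  assumes "AE x in M. Q x" "S \<in> sets M" "emeasure M S \<noteq> 0"
  shows "\<exists>x\<in>S. Q x"
proof (rule ccontr)
  assume "\<not> ?thesis"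
  then have "AE x in M. x \<notin> S" by (intro AE_mp[OF assms(1) AE_I2]) blast
  then show False using AE_iff_null_sets[OF assms(2)] assms(3) by (auto simp: null_sets_def)
qed

context bms_flow
begin

lemma limit_set_in_supports:
  assumes "open U" "x \<in> U" "x \<in> \<Lambda>"
  shows "emeasure \<mu> \<Lambda> \<noteq> 0 \<Longrightarrow> emeasure \<mu> (U \<inter> \<Lambda>) \<noteq> 0"
    and "emeasure \<mu>' \<Lambda> \<noteq> 0 \<Longrightarrow> emeasure \<mu>' (U \<inter> \<Lambda>) \<noteq> 0"
  by (rule quasi_invariant_support[OF sets_\<mu> qi _ assms], assumption+)
    (rule quasi_invariant_support[OF sets_\<mu>' qi' _ assms], assumption+)

end


section \<open>Rigidity and mixing\<close>

context bms_flow
begin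

text \<open>
  The cross ratio is continuous where it is defined and \<open>T\<close> is closed, so a cross ratio outside \<open>T\<close>
  stays outside on a product of four neighbourhoods. These have positive measure, and points in
  them can be chosen one after the other, in the order of the quantifiers.
\<close>

lemma spectrum_subset_if_AE_cross_ratio:
  assumes "closed T" and pos: "emeasure \<mu> \<Lambda> \<noteq> 0" "emeasure \<mu>' \<Lambda> \<noteq> 0"
    and ae: "AE y in \<mu>. AE y' in \<mu>. AE x in \<mu>'. AE x' in \<mu>'.
       x \<in> \<Lambda> \<and> x' \<in> \<Lambda> \<and> y \<in> \<Lambda> \<and> y' \<in> \<Lambda> \<and> {x, x'} \<inter> {y, y'} = {} \<longrightarrow> cross_ratio G x x' y y' \<in> T"
  shows "cross_ratio_spectrum \<Gamma> G \<subseteq> T"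
proof (rule ccontr)
  assume "\<not> ?thesis"
  then obtain u u' v v' where L: "u \<in> \<Lambda>" "u' \<in> \<Lambda>" "v \<in> \<Lambda>" "v' \<in> \<Lambda>"
    and disj: "{u, u'} \<inter> {v, v'} = {}" and notin: "cross_ratio G u u' v v' \<notin> T"
    by (auto simp: cross_ratio_spectrum_def)
  let ?D = "{w::'m \<times> 'm \<times> 'm \<times> 'm. fst (snd (snd w)) \<noteq> fst w \<and> snd (snd (snd w)) \<noteq> fst w \<and>
       fst (snd (snd w)) \<noteq> fst (snd w) \<and> snd (snd (snd w)) \<noteq> fst (snd w)}"
  have openD: "open ?D"
    by (intro open_Collect_conj open_Collect_neq continuous_intros)
  have contG: "continuous_on ?D (\<lambda>w. G (p w, q w))"
    if "continuous_on ?D p" "continuous_on ?D q" "\<And>w. w \<in> ?D \<Longrightarrow> p w \<noteq> q w" for p q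
    by (rule continuous_on_compose2[OF G_continuous])
      (use that in \<open>auto intro!: continuous_on_Pair simp: distinct_pairs_def\<close>)
  have "continuous_on ?D (\<lambda>w. cross_ratio G (fst w) (fst (snd w)) (fst (snd (snd w))) (snd (snd (snd w))))"
    unfolding cross_ratio_def
    by (intro continuous_on_add continuous_on_diff contG continuous_intros) auto
  moreover have "open (- T)" using assms(1) by (simp add: open_Compl)
  ultimately have "open ((\<lambda>w. cross_ratio G (fst w) (fst (snd w)) (fst (snd (snd w))) (snd (snd (snd w)))) -` (- T) \<inter> ?D)"
    using openD continuous_on_open_vimage by blast
  moreover have "(u, u', v, v') \<in> (\<lambda>w. cross_ratio G (fst w) (fst (snd w)) (fst (snd (snd w))) (snd (snd (snd w)))) -` (- T) \<inter> ?D"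
    using disj notin by auto
  ultimately obtain U B where U: "open U" "u \<in> U" and B: "open B" "(u', v, v') \<in> B"
    and UB: "U \<times> B \<subseteq> (\<lambda>w. cross_ratio G (fst w) (fst (snd w)) (fst (snd (snd w))) (snd (snd (snd w)))) -` (- T) \<inter> ?D"
    by (rule open_prod_elim) auto
  obtain U' C where U': "open U'" "u' \<in> U'" and C: "open C" "(v, v') \<in> C" and UC: "U' \<times> C \<subseteq> B"
    by (rule open_prod_elim[OF B]) auto
  obtain V V' where V: "open V" "v \<in> V" and V': "open V'" "v' \<in> V'" and VV: "V \<times> V' \<subseteq> C"
    by (rule open_prod_elim[OF C]) auto
  have good: "cross_ratio G x x' y y' \<notin> T \<and> {x, x'} \<inter> {y, y'} = {}"
    if "x \<in> U" "x' \<in> U'" "y \<in> V" "y' \<in> V'" for x x' y y'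
  proof -
    have "(x, x', y, y') \<in> U \<times> B" using that UC VV by auto
    then show ?thesis using UB by auto
  qed
  have meas: "W \<inter> \<Lambda> \<in> sets \<mu>" "W \<inter> \<Lambda> \<in> sets \<mu>'" if "open W" for W
    using that closed_limit_set by (auto simp: sets_\<mu> sets_\<mu>')
  obtain y where y: "y \<in> V \<inter> \<Lambda>" and ae1: "AE y' in \<mu>. AE x in \<mu>'. AE x' in \<mu>'.
       x \<in> \<Lambda> \<and> x' \<in> \<Lambda> \<and> y \<in> \<Lambda> \<and> y' \<in> \<Lambda> \<and> {x, x'} \<inter> {y, y'} = {} \<longrightarrow> cross_ratio G x x' y y' \<in> T"
    using AE_pick[OF ae meas(1)[OF V(1)] limit_set_in_supports(1)[OF V L(3) pos(1)]] by blast
  obtain y' where y': "y' \<in> V' \<inter> \<Lambda>" and ae2: "AE x in \<mu>'. AE x' in \<mu>'.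
       x \<in> \<Lambda> \<and> x' \<in> \<Lambda> \<and> y \<in> \<Lambda> \<and> y' \<in> \<Lambda> \<and> {x, x'} \<inter> {y, y'} = {} \<longrightarrow> cross_ratio G x x' y y' \<in> T"
    using AE_pick[OF ae1 meas(1)[OF V'(1)] limit_set_in_supports(1)[OF V' L(4) pos(1)]] by blast
  obtain x where x: "x \<in> U \<inter> \<Lambda>" and ae3: "AE x' in \<mu>'.
       x \<in> \<Lambda> \<and> x' \<in> \<Lambda> \<and> y \<in> \<Lambda> \<and> y' \<in> \<Lambda> \<and> {x, x'} \<inter> {y, y'} = {} \<longrightarrow> cross_ratio G x x' y y' \<in> T"
    using AE_pick[OF ae2 meas(2)[OF U(1)] limit_set_in_supports(2)[OF U L(1) pos(2)]] by blast
  obtain x' where x': "x' \<in> U' \<inter> \<Lambda>" and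
     "x \<in> \<Lambda> \<and> x' \<in> \<Lambda> \<and> y \<in> \<Lambda> \<and> y' \<in> \<Lambda> \<and> {x, x'} \<inter> {y, y'} = {} \<longrightarrow> cross_ratio G x x' y y' \<in> T"
    using AE_pick[OF ae3 meas(2)[OF U'(1)] limit_set_in_supports(2)[OF U' L(2) pos(2)]] by blast
  then show False using x y y' good[of x x' y y'] by blast
qed

text \<open>
  The measures might a priori give no mass to the limit set; then \<open>m\<close> is zero. Otherwise \<open>F\<close> is the lift
  of \<open>g\<close>, extended by \<open>0\<close>, and \<open>H y\<close> is its average over the first coordinate, an everywhere
  defined representative of the common value of \<open>F (x, y, s)\<close> for almost all \<open>x\<close>.
\<close>

lemma constant_if_leaf_invariant:
  assumes nonarith: "non_arithmetic (cross_ratio_spectrum \<Gamma> G)"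
    and g: "unit_valued m g"
    and st: "AE w in stable_pairs. g (orbit (s1 w)) = g (orbit (s2 w))"
    and un: "AE w in unstable_pairs. g (orbit (u1 w)) = g (orbit (u2 w))"
  shows "\<exists>c. AE x in m. g x = c"
proof (cases "emeasure \<mu> \<Lambda> \<noteq> 0 \<and> emeasure \<mu>' \<Lambda> \<noteq> 0")
  case False
  have sets: "\<Lambda> \<in> sets \<mu>" "\<Lambda> \<in> sets \<mu>'" using closed_limit_set by (simp_all add: sets_\<mu> sets_\<mu>')
  have "AE y in \<mu>. AE x in \<mu>'. AE s in lborel. (x, y, s) \<in> cover \<longrightarrow> orbit (x, y, s) \<notin> space m"
  proof (cases "emeasure \<mu> \<Lambda> = 0")
    case True
    then have "AE y in \<mu>. y \<notin> \<Lambda>" using AE_iff_null_sets[OF sets(1)] sets by (auto simp: null_sets_def)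
    then show ?thesis by (rule AE_mp) (intro AE_I2 impI, simp add: cover_iff)
  next
    case False
    with \<open>\<not> (emeasure \<mu> \<Lambda> \<noteq> 0 \<and> emeasure \<mu>' \<Lambda> \<noteq> 0)\<close> have "emeasure \<mu>' \<Lambda> = 0" by simp
    then have "AE x in \<mu>'. x \<notin> \<Lambda>" using AE_iff_null_sets[OF sets(2)] sets by (auto simp: null_sets_def)
    then have "AE x in \<mu>'. AE s in lborel. (x, y, s) \<in> cover \<longrightarrow> orbit (x, y, s) \<notin> space m" for y
      by (rule AE_mp) (intro AE_I2 impI, simp add: cover_iff)
    then show ?thesis by (rule AE_I2)
  qed
  then have "emeasure m (space m) = 0" by (simp only: null_iff_iterated(1)[OF sets.top])
  then have "AE x in m. g x = 0"
    using AE_I[of m "\<lambda>x. g x = 0" "space m"] by auto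
  then show ?thesis by blast
next
  case True
  then have pos: "emeasure \<mu> \<Lambda> \<noteq> 0" "emeasure \<mu>' \<Lambda> \<noteq> 0" by auto
  define F where "F v = indicator cover v * g (orbit v)" for v
  have F_cover: "v \<in> cover \<Longrightarrow> F v = g (orbit v)" for v by (simp add: F_def)
  have "(\<lambda>v. g (orbit v)) \<in> borel_measurable lift"
    using measurable_comp[OF orbit_measurable unit_valuedD(1)[OF g]] by (simp only: comp_def)
  then have F[measurable]: "F \<in> borel_measurable borel"
    by (subst (asm) borel_measurable_restrict_space_iff) (simp_all add: F_def[abs_def])
  have F01: "0 \<le> F v" "F v \<le> 1" for v
    using unit_valuedD(2,3)[OF g, of "orbit v"] by (simp_all add: F_def indicator_def)
  have F_pair: "(\<lambda>w. F (p w)) \<in> borel_measurable borel" if "p \<in> borel_measurable borel" for p :: "'b::topological_space \<Rightarrow> _"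
    by (rule measurable_compose[OF that F])
  have F_eq_borel: "{w. F (p w) = F (q w)} \<in> sets borel"
    if "p \<in> borel_measurable borel" "q \<in> borel_measurable borel" for p q :: "'b::topological_space \<Rightarrow> _"
  proof -
    have [measurable]: "(\<lambda>w. F (p w)) \<in> borel_measurable borel" "(\<lambda>w. F (q w)) \<in> borel_measurable borel"
      by (rule F_pair[OF that(1)], rule F_pair[OF that(2)])
    have "{w \<in> space borel. F (p w) = F (q w)} \<in> sets borel" by measurable
    then show ?thesis by simp
  qed
  have "AE w in stable_pairs. F (s1 w) = F (s2 w)"
    by (rule AE_mp[OF st]) (auto intro!: AE_I2 simp: F_cover cover_iff stable_pairs_def space_restrict_space)
  then have S: "AE y in \<mu>. AE x in \<mu>'. AE s in lborel. AE x' in \<mu>'.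
     y \<in> \<Lambda> \<and> x \<in> \<Lambda> \<and> x' \<in> \<Lambda> \<and> x \<noteq> y \<and> x' \<noteq> y \<longrightarrow> F (x, y, s) = F (x', y, s)"
    unfolding AE_stable_pairs[OF F_eq_borel[OF pairs_measurable(1,2)]] prod.case .
  have "AE w in unstable_pairs. F (u1 w) = F (u2 w)"
    by (rule AE_mp[OF un]) (auto intro!: AE_I2 simp: F_cover cover_iff unstable_pairs_def space_restrict_space)
  then have U: "AE y in \<mu>. AE y' in \<mu>. AE x in \<mu>'. AE s in lborel.
     y \<in> \<Lambda> \<and> y' \<in> \<Lambda> \<and> x \<in> \<Lambda> \<and> x \<noteq> y \<and> x \<noteq> y' \<longrightarrow> F (x, y, s) = F (x, y', s + (G0 (x, y') - G0 (x, y)))"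
    unfolding AE_unstable_pairs[OF F_eq_borel[OF pairs_measurable(3,4)]] prod.case .
  have L_meas: "\<Lambda> - {y} \<in> sets \<mu>'" for y using closed_limit_set by (auto simp: sets_\<mu>')
  have L_pos: "0 < measure \<mu>' (\<Lambda> - {y})" for y
  proof -
    obtain z where z: "z \<in> \<Lambda>" "z \<noteq> y" using three_limit_points by blast
    have "emeasure \<mu>' (- {y} \<inter> \<Lambda>) \<noteq> 0" using z by (intro limit_set_in_supports(2)[OF _ _ z(1) pos(2)]) auto
    moreover have "- {y} \<inter> \<Lambda> = \<Lambda> - {y}" by auto
    ultimately show ?thesis by (simp add: P'.emeasure_eq_measure zero_less_measure_iff)
  qed
  define H where "H y s = (\<integral>x'. indicator (\<Lambda> - {y}) x' * F (x', y, s) \<partial>\<mu>') / measure \<mu>' (\<Lambda> - {y})" for y s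
  have iL: "integrable \<mu>' (indicator (\<Lambda> - {y}) :: 'm \<Rightarrow> real)" for y
    using L_meas by (simp add: P'.emeasure_finite less_top[symmetric])
  have F_sec: "(\<lambda>x'. F (x', y, s)) \<in> borel_measurable \<mu>'" for y s
  proof -
    have "(\<lambda>x'::'m. (x', y, s)) \<in> borel_measurable borel"
      by (intro borel_measurable_continuous_onI continuous_intros)
    from F_pair[OF this] show ?thesis by (simp add: measurable_cong_sets[OF sets_\<mu>' refl])
  qed
  have iLF: "integrable \<mu>' (\<lambda>x'. indicator (\<Lambda> - {y}) x' * F (x', y, s))" for y s
    by (rule Bochner_Integration.integrable_bound[OF iL[of y]])
      (use L_meas[of y] F_sec[of y s] F01 in \<open>auto simp: indicator_def intro!: borel_measurable_times\<close>)
  have uH: "unit_valued borel (H y)" for y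
    unfolding unit_valued_def
  proof (intro conjI allI)
    have "(\<lambda>w. indicator (\<Lambda> - {y}) (snd w) * F (snd w, y, fst w)) \<in> borel_measurable (borel \<Otimes>\<^sub>M \<mu>')"
    proof -
      have "(\<lambda>w::real \<times> 'm. (snd w, y, fst w)) \<in> borel_measurable borel"
        by (intro borel_measurable_continuous_onI continuous_intros)
      then have 1: "(\<lambda>w::real \<times> 'm. F (snd w, y, fst w)) \<in> borel_measurable borel" by (rule F_pair)
      have "sets ((borel :: real measure) \<Otimes>\<^sub>M \<mu>') = sets (borel \<Otimes>\<^sub>M borel)"
        by (rule sets_pair_measure_cong[OF refl sets_\<mu>'])
      then have s: "sets ((borel :: real measure) \<Otimes>\<^sub>M \<mu>') = sets borel" by (simp only: borel_prod)
      have 2: "(\<lambda>w::real \<times> 'm. F (snd w, y, fst w)) \<in> borel_measurable (borel \<Otimes>\<^sub>M \<mu>')"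
        using 1 by (simp only: measurable_cong_sets[OF s refl])
      have 3: "(\<lambda>w::real \<times> 'm. indicator (\<Lambda> - {y}) (snd w) :: real) \<in> borel_measurable (borel \<Otimes>\<^sub>M \<mu>')"
        by (rule measurable_compose[OF measurable_snd borel_measurable_indicator[OF L_meas]])
      show ?thesis by (rule borel_measurable_times[OF 3 2])
    qed
    then have "(\<lambda>s. \<integral>x'. indicator (\<Lambda> - {y}) x' * F (x', y, s) \<partial>\<mu>') \<in> borel_measurable borel"
      by (intro P'.borel_measurable_lebesgue_integral) (simp add: case_prod_beta')
    then show "H y \<in> borel_measurable borel" unfolding H_def[abs_def] by simp
  next
    fix s
    have "0 \<le> (\<integral>x'. indicator (\<Lambda> - {y}) x' * F (x', y, s) \<partial>\<mu>')"
      by (rule integral_nonneg_AE) (auto simp: F01)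
    then show "0 \<le> H y s" using L_pos[of y] by (simp add: H_def)
    have "(\<integral>x'. indicator (\<Lambda> - {y}) x' * F (x', y, s) \<partial>\<mu>') \<le> (\<integral>x'. indicator (\<Lambda> - {y}) x' \<partial>\<mu>')"
      by (rule integral_mono[OF iLF iL]) (auto simp: indicator_def F01)
    also have "\<dots> = measure \<mu>' (\<Lambda> - {y})" using L_meas[of y] by simp
    finally show "H y s \<le> 1" using L_pos[of y] by (simp add: H_def)
  qed
  have F_eq_H: "F (x, y, s) = H y s"
    if ae: "AE x' in \<mu>'. y \<in> \<Lambda> \<and> x \<in> \<Lambda> \<and> x' \<in> \<Lambda> \<and> x \<noteq> y \<and> x' \<noteq> y \<longrightarrow> F (x, y, s) = F (x', y, s)"
      and xy: "y \<in> \<Lambda> \<and> x \<in> \<Lambda> \<and> x \<noteq> y" for x y s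
  proof -
    have "(\<integral>x'. indicator (\<Lambda> - {y}) x' * F (x', y, s) \<partial>\<mu>') = (\<integral>x'. indicator (\<Lambda> - {y}) x' * F (x, y, s) \<partial>\<mu>')"
    proof (rule integral_cong_AE)
      show "AE x' in \<mu>'. indicator (\<Lambda> - {y}) x' * F (x', y, s) = indicator (\<Lambda> - {y}) x' * F (x, y, s)"
        by (rule AE_mp[OF ae]) (use xy in \<open>auto intro!: AE_I2 simp: indicator_def\<close>)
    qed (use iLF iL in \<open>auto intro!: borel_measurable_integrable borel_measurable_times\<close>)
    also have "\<dots> = measure \<mu>' (\<Lambda> - {y}) * F (x, y, s)" using L_meas[of y] by simp
    finally show ?thesis using L_pos[of y] by (simp add: H_def)
  qed
  have FH: "AE y in \<mu>. AE x in \<mu>'. AE s in lborel. y \<in> \<Lambda> \<and> x \<in> \<Lambda> \<and> x \<noteq> y \<longrightarrow> F (x, y, s) = H y s"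
    using S
  proof eventually_elim
    case (elim y)
    then show ?case
    proof eventually_elim
      case (elim x)
      then show ?case by eventually_elim (blast intro: F_eq_H)
    qed
  qed
  \<comment> \<open>Invariance along unstable pairs, expressed by the functions \<open>H y\<close>.\<close>
  have R: "AE y in \<mu>. AE y' in \<mu>. AE x in \<mu>'. y \<in> \<Lambda> \<and> y' \<in> \<Lambda> \<and> x \<in> \<Lambda> \<and> x \<noteq> y \<and> x \<noteq> y' \<longrightarrow>
     shift_eq (H y) (H y') (G (x, y') - G (x, y))"
    using FH U
  proof eventually_elim
    case (elim y)
    show ?case
      using FH elim(2)
    proof eventually_elim
      case (elim y')
      show ?case
        using \<open>AE x in \<mu>'. AE s in lborel. y \<in> \<Lambda> \<and> x \<in> \<Lambda> \<and> x \<noteq> y \<longrightarrow> F (x, y, s) = H y s\<close> elim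
      proof eventually_elim
        case (elim x)
        show ?case
        proof
          assume xy: "y \<in> \<Lambda> \<and> y' \<in> \<Lambda> \<and> x \<in> \<Lambda> \<and> x \<noteq> y \<and> x \<noteq> y'"
          from AE_lborel_shift[OF elim(2), of "G0 (x, y') - G0 (x, y)"] elim(1,3)
          have "AE s in lborel. H y s = H y' (s + (G0 (x, y') - G0 (x, y)))"
          proof eventually_elim
            case (elim s)
            then show ?case using xy by simp
          qed
          then show "shift_eq (H y) (H y') (G (x, y') - G (x, y))"
            using xy by (simp add: shift_eq_def G0_eq)
        qed
      qed
    qed
  qed
  \<comment> \<open>The \<open>H y\<close> are translates of each other; a point \<open>x\<close> different from both ends exists, as the limit set has three points.\<close>
  have conn: "AE y in \<mu>. AE y' in \<mu>. y \<in> \<Lambda> \<and> y' \<in> \<Lambda> \<longrightarrow> (\<exists>c. shift_eq (H y) (H y') c)"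
    using R
  proof eventually_elim
    case (elim y)
    then show ?case
    proof eventually_elim
      case (elim y')
      show ?case
      proof
        assume yy: "y \<in> \<Lambda> \<and> y' \<in> \<Lambda>"
        obtain z where z: "z \<in> \<Lambda>" "z \<noteq> y" "z \<noteq> y'" using three_limit_points by blast
        have op: "open (- {y, y'})" by (simp add: open_Compl)
        have "emeasure \<mu>' (- {y, y'} \<inter> \<Lambda>) \<noteq> 0" using z by (intro limit_set_in_supports(2)[OF op _ z(1) pos(2)]) auto
        moreover have "- {y, y'} \<inter> \<Lambda> \<in> sets \<mu>'" using closed_limit_set op by (auto simp: sets_\<mu>')
        ultimately show "\<exists>c. shift_eq (H y) (H y') c"
          using AE_pick[OF elim] yy by fastforce
      qed
    qed
  qed
  \<comment> \<open>Passing from \<open>H y\<close> to \<open>H y'\<close> with \<open>x'\<close> and back with \<open>x\<close> is a translation by the cross ratio.\<close>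
  have B: "AE y in \<mu>. AE y' in \<mu>. AE x in \<mu>'. AE x' in \<mu>'.
     x \<in> \<Lambda> \<and> x' \<in> \<Lambda> \<and> y \<in> \<Lambda> \<and> y' \<in> \<Lambda> \<and> {x, x'} \<inter> {y, y'} = {} \<longrightarrow>
     shift_eq (H y) (H y) (cross_ratio G x x' y y')"
    using R
  proof eventually_elim
    case (elim y)
    then show ?case
    proof eventually_elim
      case (elim y')
      note ae = this
      show ?case
        using ae
      proof eventually_elim
        case (elim x)
        show ?case
          using ae
        proof eventually_elim
          case (elim x')
          show ?case
          proof
            assume L: "x \<in> \<Lambda> \<and> x' \<in> \<Lambda> \<and> y \<in> \<Lambda> \<and> y' \<in> \<Lambda> \<and> {x, x'} \<inter> {y, y'} = {}"
            then have "shift_eq (H y) (H y') (G (x, y') - G (x, y))"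
              "shift_eq (H y) (H y') (G (x', y') - G (x', y))"
              using \<open>y \<in> \<Lambda> \<and> y' \<in> \<Lambda> \<and> x \<in> \<Lambda> \<and> x \<noteq> y \<and> x \<noteq> y' \<longrightarrow> shift_eq (H y) (H y') (G (x, y') - G (x, y))\<close> elim
              by auto
            from shift_eq_trans[OF this(2) shift_eq_sym[OF this(1)]]
            show "shift_eq (H y) (H y) (cross_ratio G x x' y y')"
              by (simp add: cross_ratio_def algebra_simps)
          qed
        qed
      qed
    qed
  qed
  have "\<Lambda> \<in> sets \<mu>" using closed_limit_set by (simp add: sets_\<mu>)
  from AE_pick[OF conn this pos(1)] obtain y1 where y1: "y1 \<in> \<Lambda>"
    and conn1: "AE y in \<mu>. y1 \<in> \<Lambda> \<and> y \<in> \<Lambda> \<longrightarrow> (\<exists>c. shift_eq (H y1) (H y) c)" by blast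
  have "AE y in \<mu>. AE y' in \<mu>. AE x in \<mu>'. AE x' in \<mu>'.
     x \<in> \<Lambda> \<and> x' \<in> \<Lambda> \<and> y \<in> \<Lambda> \<and> y' \<in> \<Lambda> \<and> {x, x'} \<inter> {y, y'} = {} \<longrightarrow>
     cross_ratio G x x' y y' \<in> {c. shift_eq (H y1) (H y1) c}"
    using conn1 B
  proof eventually_elim
    case (elim y)
    \<comment> \<open>Translates of each other have the same periods.\<close>
    have transfer: "shift_eq (H y1) (H y1) c" if yL: "y \<in> \<Lambda>" and c: "shift_eq (H y) (H y) c" for c
    proof -
      obtain e where e: "shift_eq (H y1) (H y) e" using elim(1) y1 yL by blast
      show ?thesis using shift_eq_trans[OF shift_eq_trans[OF e c] shift_eq_sym[OF e]] by simp
    qed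
    show ?case
      using elim(2)
    proof eventually_elim
      case (elim y')
      then show ?case
      proof eventually_elim
        case (elim x)
        then show ?case by eventually_elim (use transfer in blast)
      qed
    qed
  qed
  from spectrum_subset_if_AE_cross_ratio[OF closed_periods[OF uH] pos this]
  have "group_closure (cross_ratio_spectrum \<Gamma> G) \<subseteq> {c. shift_eq (H y1) (H y1) c}"
    by (rule group_closure_subset_periods)
  then have "closure (group_closure (cross_ratio_spectrum \<Gamma> G)) \<subseteq> {c. shift_eq (H y1) (H y1) c}"
    by (rule closure_minimal[OF _ closed_periods[OF uH]])
  then have "shift_eq (H y1) (H y1) c" for c
    using nonarith unfolding non_arithmetic_def by auto
  then obtain k where k: "AE s in lborel. H y1 s = k"
    using AE_const_if_all_periods[OF unit_valuedD(1)[OF uH]] by blast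
  have "AE y in \<mu>. AE x in \<mu>'. AE s in lborel. (x, y, s) \<in> cover \<longrightarrow> orbit (x, y, s) \<notin> {c \<in> space m. g c \<noteq> k}"
    using conn1 FH
  proof eventually_elim
    case (elim y)
    show ?case
    proof (cases "y \<in> \<Lambda>")
      case True
      then obtain e where "shift_eq (H y1) (H y) e" using elim(1) y1 by blast
      from shift_eq_sym[OF this] have "AE s in lborel. H y s = H y1 (s + - e)" by (simp add: shift_eq_def)
      moreover have "AE s in lborel. H y1 (s + - e) = k" by (rule AE_lborel_shift[OF k])
      ultimately have Hk: "AE s in lborel. H y s = k" by eventually_elim simp
      show ?thesis
        using elim(2)
      proof eventually_elim
        case (elim x)
        show ?case
          using elim Hk
          by eventually_elim (auto simp: cover_iff F_cover)
      qed
    next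
      case False
      then show ?thesis by (simp add: cover_iff)
    qed
  qed
  moreover have E: "{c \<in> space m. g c \<noteq> k} \<in> sets m" using unit_valuedD(1)[OF g] by measurable
  ultimately have "emeasure m {c \<in> space m. g c \<noteq> k} = 0" by (simp only: null_iff_iterated(1)[OF E])
  then have "AE c in m. g c = k" using AE_I[OF _ _ E] by auto
  then show ?thesis by blast
qed

theorem mixing_flow:
  assumes "non_arithmetic (cross_ratio_spectrum \<Gamma> G)"
  shows "mixing m flow"
  by (rule mixing_if_rigid, rule constant_if_leaf_invariant[OF assms])

end

text \<open>
  Infinite sublevel sets contribute \<open>\<infinity>\<close> to the upper limit, so sublevel sets are finite beyond some
  radius.
\<close>

lemma finite_sublevel_if_critical_exponent:
  assumes "critical_exponent \<Gamma> N = ereal \<delta>"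
  shows "finite {\<gamma>\<in>\<Gamma>. N \<gamma> \<le> R}"
proof -
  define f where "f R = (if finite {\<gamma>\<in>\<Gamma>. N \<gamma> \<le> R} then ereal (1 / R * ln (real (card {\<gamma>\<in>\<Gamma>. N \<gamma> \<le> R}))) else \<infinity>)" for R
  have "Limsup at_top f < \<infinity>" using assms by (simp add: critical_exponent_def f_def[abs_def])
  then have "\<forall>\<^sub>F R in at_top. f R < \<infinity>" by (rule Limsup_lessD)
  then obtain R0 where R0: "\<And>R'. R' \<ge> R0 \<Longrightarrow> f R' < \<infinity>" by (auto simp: eventually_at_top_linorder)
  then have "f (max R R0) < \<infinity>" by simp
  then have "finite {\<gamma>\<in>\<Gamma>. N \<gamma> \<le> max R R0}" by (auto simp: f_def split: if_splits)
  then show ?thesis by (rule rev_finite_subset) auto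
qed

lemma patterson_sullivan_quasi_invariant:
  assumes "patterson_sullivan \<Gamma> \<sigma> \<beta> \<mu>" "\<gamma> \<in> \<Gamma>" "E \<in> sets borel" "emeasure \<mu> E = 0"
    and \<gamma>: "\<gamma> \<in> borel_measurable borel"
  shows "emeasure \<mu> (\<gamma> -` E) = 0"
proof -
  have sets: "sets \<mu> = sets borel" and ac: "absolutely_continuous \<mu> (distr \<mu> borel \<gamma>)"
    using assms(1,2) by (auto simp: patterson_sullivan_def)
  have m: "\<gamma> \<in> measurable \<mu> borel" using \<gamma> by (simp add: measurable_cong_sets[OF sets refl])
  have "E \<in> null_sets \<mu>" using assms(3,4) sets by (simp add: null_sets_def)
  then have "emeasure (distr \<mu> borel \<gamma>) E = 0" using ac by (auto simp: absolutely_continuous_def)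
  then show ?thesis
    using assms(3) sets_eq_imp_space_eq[OF sets] by (simp add: emeasure_distr[OF m])
qed

theorem theorem4p2:
  fixes \<Gamma> :: "('m::polish_space \<Rightarrow> 'm) set"
    and \<sigma> \<sigma>' :: "('m \<Rightarrow> 'm) \<Rightarrow> 'm \<Rightarrow> real"
    and G :: "'m \<times> 'm \<Rightarrow> real"
    and d :: "('m \<Rightarrow> 'm) + 'm \<Rightarrow> ('m \<Rightarrow> 'm) + 'm \<Rightarrow> real"
    and N :: "('m \<Rightarrow> 'm) \<Rightarrow> real"
    and \<delta> :: real
    and \<mu> \<mu>' :: "'m measure"
    and m :: "('m \<times> 'm \<times> real) set measure"
  assumes "compact (UNIV :: 'm set)"
    and "convergence_group \<Gamma>"
    and "non_elementary \<Gamma>"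
    and "GPS_system \<Gamma> \<sigma> \<sigma>' G"
    and "compactification_metric \<Gamma> d"
    and "magnitude \<Gamma> d \<sigma> N"
    and "critical_exponent \<Gamma> N = ereal \<delta>"
    and "poincare_series \<Gamma> N \<delta> = \<infinity>"
    and "patterson_sullivan \<Gamma> \<sigma> \<delta> \<mu>"
    and "patterson_sullivan \<Gamma> \<sigma>' \<delta> \<mu>'"
    and "BMS_measure \<Gamma> \<sigma> G \<delta> \<mu>' \<mu> m"
    and "finite_measure m"
    and "non_arithmetic (cross_ratio_spectrum \<Gamma> G)"
  shows "mixing m flow"
proof -
  have homeo: "homeo_group \<Gamma>" using assms(2) by (simp add: convergence_group_def)
  interpret expanding_convergence_group \<Gamma> d \<sigma> N
    by unfold_locales
      (use assms homeo finite_sublevel_if_critical_exponent[OF assms(7)] in \<open>auto simp: GPS_system_def\<close>)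
  have rel: "\<sigma>' \<gamma> x + \<sigma> \<gamma> y = G (\<gamma> x, \<gamma> y) - G (x, y)" if "\<gamma> \<in> \<Gamma>" "x \<noteq> y" for \<gamma> x y
    using assms(4) that by (auto simp: GPS_system_def distinct_pairs_def)
  have borel: "\<gamma> \<in> borel_measurable borel" if "\<gamma> \<in> \<Gamma>" for \<gamma>
    by (rule borel_measurable_continuous_onI[OF continuous_elem[OF that]])
  have Gcont: "continuous_on (distinct_pairs UNIV) G" using assms(4) by (simp add: GPS_system_def)
  have Gcoc: "\<sigma> \<gamma> y - \<sigma> \<gamma> y' = (G (\<gamma> x, \<gamma> y) - G (x, y)) - (G (\<gamma> x, \<gamma> y') - G (x, y'))"
    if "\<gamma> \<in> \<Gamma>" "x \<noteq> y" "x \<noteq> y'" for \<gamma> x y y'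
    using rel[OF that(1,2)] rel[OF that(1,3)] by linarith
  have ps: "prob_space \<mu>" "prob_space \<mu>'" "sets \<mu> = sets borel" "sets \<mu>' = sets borel"
    using assms(9,10) by (auto simp: patterson_sullivan_def)
  interpret gps_flow \<Gamma> d \<sigma> N G
    by (intro gps_flow.intro gps_flow_axioms.intro expanding_convergence_group_axioms Gcont Gcoc)
  interpret bms_flow \<Gamma> d \<sigma> N G \<delta> \<mu> \<mu>' m
    by (intro bms_flow.intro bms_flow_axioms.intro gps_flow_axioms ps assms(11,12)
        patterson_sullivan_quasi_invariant[OF assms(9)] patterson_sullivan_quasi_invariant[OF assms(10)] borel)
  show ?thesis by (rule mixing_flow[OF assms(13)])
qed

end
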